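(* For every $k\geq 2$, $$\limsup_{N\to\infty}\sqrt[N]{|C_{k,N}|}=2k-3.$$ For every $k\geq 3$, $$\limsup_{N\to\infty}\sqrt[N]{|C_{k,N}\setminus L_{k,N}|}<2k-3.$$ Moreover, for every $k\ge 3$, as $N\to\infty$, $$|C_{k,N}|=(1+o_N(1))\cdot\frac{2k(2k-2)}{(2k-3)^2}\,(2k-3)^N .$$
   Context: $F_k$ is the free group on $X=\{x_1,\dots,x_k\}$; elements are represented by reduced words in $X^{\pm1}$. An element of $F_k$ is primitive if it belongs to some free generating set (basis) of $F_k$. A reduced word $a_1a_2\cdots a_N$ is cyclically reduced if $a_1\ne a_N^{-1}$; cyclically reduced words up to cyclic permutation of letters correspond bijectively to conjugacy classes in $F_k$. The conjugacy class $[w]$ of $w\in F_k$ is called the cyclic word associated with $w$, and the cyclic length $|w|_c$ is the length of the cyclically reduced representatives of $[w]$. Define $$C_{k,N}=\{[w] : w\in F_k \text{ is primitive and } |w|_c=N\},$$ and let $L_{k,N}\subseteq C_{k,N}$ be the subset of those cyclic words $[w]$ (of cyclic length $N$) such that some letter $x\in X$ appears exactly once, either as $x$ or as $x^{-1}$ (i.e. the total number of occurrences of $x$ and $x^{-1}$ is $1$), in a cyclically reduced representative of $[w]$. *)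

theory Defs
  imports
    "HOL-Algebra.Group"
    "HOL-Library.Extended_Real"
    "HOL-Library.Landau_Symbols"
begin

section \<open>Free groups on a set, as groups of reduced words\<close>

text \<open>The letter \<open>(x, True)\<close> stands for the generator \<open>x\<close>, and \<open>(x, False)\<close> for its formal inverse.\<close>

type_synonym 'a letter = "'a \<times> bool"

definition inv_letter :: "'a letter \<Rightarrow> 'a letter" where
  "inv_letter a = (fst a, \<not> snd a)"

definition reduced :: "'a letter list \<Rightarrow> bool" where
  "reduced w \<longleftrightarrow> successively (\<lambda>a b. a \<noteq> inv_letter b) w"

definition reduced_words :: "'a set \<Rightarrow> 'a letter list set" where
  "reduced_words S = {w. reduced w \<and> fst ` set w \<subseteq> S}"

text \<open>Left multiplication of a reduced word by a letter, with cancellation.  Iterating it computes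
  the reduced form of a concatenation \<open>u @ v\<close> whenever \<open>v\<close> is reduced.\<close>

definition cancel_cons :: "'a letter \<Rightarrow> 'a letter list \<Rightarrow> 'a letter list" where
  "cancel_cons a w = (case w of [] \<Rightarrow> [a] | b # v \<Rightarrow> if a = inv_letter b then v else a # w)"

definition free_group :: "'a set \<Rightarrow> 'a letter list monoid" where
  "free_group S = \<lparr>carrier = reduced_words S, mult = (\<lambda>u v. foldr cancel_cons u v), one = []\<rparr>"

lemma inv_letter_inv_letter [simp]: "inv_letter (inv_letter a) = a"
  by (simp add: inv_letter_def)

lemma fst_inv_letter [simp]: "fst (inv_letter a) = fst a"
  by (simp add: inv_letter_def)

lemma reduced_ConsD: "reduced (a # w) \<Longrightarrow> reduced w"
  by (cases w) (auto simp: reduced_def)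

lemma reduced_cancel_cons: "reduced w \<Longrightarrow> reduced (cancel_cons a w)"
  by (cases w) (auto simp: cancel_cons_def reduced_def successively_Cons)

lemma set_cancel_cons: "set (cancel_cons a w) \<subseteq> insert a (set w)"
  by (cases w) (auto simp: cancel_cons_def)

lemma cancel_cons_in_reduced_words:
  "fst a \<in> S \<Longrightarrow> w \<in> reduced_words S \<Longrightarrow> cancel_cons a w \<in> reduced_words S"
  using set_cancel_cons[of a w] by (auto simp: reduced_words_def reduced_cancel_cons)

lemma foldr_cancel_cons_in_reduced_words:
  "fst ` set u \<subseteq> S \<Longrightarrow> w \<in> reduced_words S \<Longrightarrow> foldr cancel_cons u w \<in> reduced_words S"
  by (induction u) (auto intro: cancel_cons_in_reduced_words)

lemma reduced_foldr_cancel_cons: "reduced w \<Longrightarrow> reduced (foldr cancel_cons u w)"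
  by (induction u) (auto intro: reduced_cancel_cons)

lemma cancel_cons_inv_letter:
  assumes "reduced w"
  shows "cancel_cons a (cancel_cons (inv_letter a) w) = w"
proof (cases w)
  case (Cons b v)
  show ?thesis
  proof (cases "inv_letter a = inv_letter b")
    case True
    then have "a = b" by (metis inv_letter_inv_letter)
    then show ?thesis using assms Cons
      by (cases v) (auto simp: cancel_cons_def reduced_def)
  qed (use Cons in \<open>auto simp: cancel_cons_def\<close>)
qed (simp add: cancel_cons_def)

lemma foldr_cancel_cons_cancel_cons:
  assumes "reduced w"
  shows "foldr cancel_cons (cancel_cons a v) w = cancel_cons a (foldr cancel_cons v w)"
proof (cases v)
  case (Cons b v')
  then show ?thesis
    using cancel_cons_inv_letter[OF reduced_foldr_cancel_cons[OF assms], of "inv_letter b" v']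
    using cancel_cons_inv_letter[OF reduced_foldr_cancel_cons[OF assms], of a v']
    by (auto simp: cancel_cons_def[of a "b # v'"])
qed (simp add: cancel_cons_def)

lemma foldr_cancel_cons_assoc:
  "reduced w \<Longrightarrow>
    foldr cancel_cons (foldr cancel_cons u v) w = foldr cancel_cons u (foldr cancel_cons v w)"
  by (induction u) (auto simp: foldr_cancel_cons_cancel_cons)

lemma foldr_cancel_cons_inverse:
  "reduced u \<Longrightarrow> foldr cancel_cons (rev (map inv_letter u)) u = []"
  by (induction u) (auto simp: cancel_cons_def dest: reduced_ConsD)

lemma reduced_rev_map_inv_letter: "reduced u \<Longrightarrow> reduced (rev (map inv_letter u))"
  unfolding reduced_def successively_rev successively_map
  by (erule successively_mono) (metis inv_letter_inv_letter)+

lemma group_free_group: "group (free_group S)"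
proof (rule groupI)
  fix u v w assume "u \<in> carrier (free_group S)" "v \<in> carrier (free_group S)"
    "w \<in> carrier (free_group S)"
  then show "u \<otimes>\<^bsub>free_group S\<^esub> v \<otimes>\<^bsub>free_group S\<^esub> w
      = u \<otimes>\<^bsub>free_group S\<^esub> (v \<otimes>\<^bsub>free_group S\<^esub> w)"
    by (simp add: free_group_def reduced_words_def foldr_cancel_cons_assoc)
next
  fix u assume u: "u \<in> carrier (free_group S)"
  show "\<exists>v\<in>carrier (free_group S). v \<otimes>\<^bsub>free_group S\<^esub> u = \<one>\<^bsub>free_group S\<^esub>"
    by (rule bexI[of _ "rev (map inv_letter u)"])
      (use u in \<open>auto simp: free_group_def reduced_words_def image_image
         foldr_cancel_cons_inverse reduced_rev_map_inv_letter\<close>)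
next
  fix u v assume "u \<in> carrier (free_group S)" "v \<in> carrier (free_group S)"
  then show "u \<otimes>\<^bsub>free_group S\<^esub> v \<in> carrier (free_group S)"
    using foldr_cancel_cons_in_reduced_words[of u S v]
    by (simp add: free_group_def reduced_words_def)
qed (auto simp: free_group_def reduced_words_def reduced_def)


section \<open>Bases and primitive elements\<close>

definition word_eval :: "('g, 'm) monoid_scheme \<Rightarrow> 'g letter list \<Rightarrow> 'g" where
  "word_eval G w =
     foldr (\<lambda>a g. (if snd a then fst a else inv\<^bsub>G\<^esub> (fst a)) \<otimes>\<^bsub>G\<^esub> g) w \<one>\<^bsub>G\<^esub>"

text \<open>\<open>B\<close> is a free generating set of \<open>G\<close> if the canonical map from the free group
  on \<open>B\<close>, extending the inclusion of \<open>B\<close>, is an isomorphism onto \<open>G\<close>.\<close>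

definition free_basis :: "('g, 'm) monoid_scheme \<Rightarrow> 'g set \<Rightarrow> bool" where
  "free_basis G B \<longleftrightarrow> B \<subseteq> carrier G \<and> word_eval G \<in> iso (free_group B) G"

definition primitive_elem :: "('g, 'm) monoid_scheme \<Rightarrow> 'g \<Rightarrow> bool" where
  "primitive_elem G g \<longleftrightarrow> (\<exists>B. free_basis G B \<and> g \<in> B)"


section \<open>Cyclic words\<close>

definition cyclically_reduced :: "'a letter list \<Rightarrow> bool" where
  "cyclically_reduced w \<longleftrightarrow> reduced w \<and> (w \<noteq> [] \<longrightarrow> hd w \<noteq> inv_letter (last w))"

definition conj_class :: "('g, 'm) monoid_scheme \<Rightarrow> 'g \<Rightarrow> 'g set" where
  "conj_class G g = {h \<otimes>\<^bsub>G\<^esub> g \<otimes>\<^bsub>G\<^esub> inv\<^bsub>G\<^esub> h |h. h \<in> carrier G}"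

text \<open>All cyclically reduced words in a conjugacy class are cyclic permutations of one another, so
  they have a common length.\<close>

definition cyclic_length :: "'a set \<Rightarrow> 'a letter list \<Rightarrow> nat" where
  "cyclic_length S w =
     (THE n. \<exists>u\<in>conj_class (free_group S) w. cyclically_reduced u \<and> length u = n)"


section \<open>Primitive cyclic words of given length\<close>

abbreviation gens :: "nat \<Rightarrow> nat set" where
  "gens k \<equiv> {1..k}"

definition primitive_cyclic_words :: "nat \<Rightarrow> nat \<Rightarrow> nat letter list set set" where
  "primitive_cyclic_words k N = {conj_class (free_group (gens k)) w |w.
     w \<in> carrier (free_group (gens k)) \<and> primitive_elem (free_group (gens k)) w
     \<and> cyclic_length (gens k) w = N}"

text \<open>Those in which some generator occurs exactly once, counting both of its signs.\<close>

definition primitive_cyclic_words_single :: "nat \<Rightarrow> nat \<Rightarrow> nat letter list set set" where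
  "primitive_cyclic_words_single k N = {c \<in> primitive_cyclic_words k N. \<exists>x\<in>gens k. \<exists>u\<in>c. cyclically_reduced u
     \<and> length (filter (\<lambda>a. fst a = x) u) = 1}"

end

theory Submission
  imports Defs "HOL-Library.Multiset" "HOL-Real_Asymp.Real_Asymp"
begin

text \<open>Whitehead's cut vertex lemma: the Whitehead graph of a cyclically reduced primitive word \<open>w\<close> has
  a cut vertex \<open>v\<close>, cutting off a set \<open>Z\<close> of letters.  It is proved here without topology:
  if \<open>w\<close> belongs to a basis \<open>B\<close>, then the set of elements whose \<open>B\<close>-expansion begins with a given
  letter other than \<open>w\<close> is invariant under right multiplication by \<open>w\<close> and has finite coboundary in the
  Cayley tree, whereas a graph without cut vertices would force such a set to be finite or cofinite.

  If many edges join \<open>v\<close> to \<open>Z\<close>, a Whitehead automorphism shortens \<open>w\<close> by a positive proportion, so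
  these words are few by induction.  Otherwise the Whitehead graph has a sparse cut with at least two
  vertices on both sides, so that up to rare exceptions each letter has at most \<open>2 k - 3\<close> successors;
  this gives the upper bound for the growth rate.  The rate is strictly smaller if the smaller side
  \<open>U\<close> of the cut is visited a positive proportion of the time, because the letters entering \<open>U\<close> have at
  most \<open>2 k - 4\<close> successors when \<open>k \<ge> 3\<close>.  Otherwise some generator \<open>t\<close> is rare.  If some two-letter
  word without \<open>t\<close> does not occur in \<open>w\<close>, the rate is again smaller.  If all of them occur, then the cut
  vertex lemma shows that \<open>w\<close> is obtained from a shorter word by a substitution of \<open>p t q\<close> for \<open>t\<close>; if \<open>t\<close>
  occurs at least twice, then the number of choices of \<open>p\<close> and \<open>q\<close> is outweighed by the loss of length.
  What remains are the words in which \<open>t\<close> occurs exactly once, all of which are primitive.\<close>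

section \<open>Normal forms of words\<close>

text \<open>If a cut of the 2k letters has at least two letters on both sides and is seldom crossed,
  the next letter usually lies on the side of the inverse of the present one and differs from that
  inverse; this leaves at most 2k - 3 choices. A side with at most k letters leaves at most k - 1,
  which is smaller than 2k - 3 only from k = 3 on. Such comparisons are made by weighting two-letter
  subwords and exhibiting a vector that the weighted transition matrix stretches by a bounded
  factor. Induction on the length works because a cyclic word is determined by its shortening and
  one of boundedly many automorphisms. The substitution step is delicate: each letter of p and q can
  be chosen in about 2k - 3 ways, the very rate to be beaten, so losing one letter per choice would
  prove nothing. Two occurrences of t make the loss two letters, and the square of the rate
  available for the shorter words exceeds 2k - 3. The leading constant counts 2k single letters,
  each followed by one of (2k-2)(2k-3)^(N-2) reduced words in the other generators; words counted
  for two generators are exponentially rarer.\<close>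

definition winv :: "'a letter list \<Rightarrow> 'a letter list" where
  "winv u = rev (map inv_letter u)"

definition nf :: "'a letter list \<Rightarrow> 'a letter list" where
  "nf u = foldr cancel_cons u []"

lemma winv_simps [simp]: "winv [] = []" "winv (a # u) = winv u @ [inv_letter a]"
  "winv (u @ v) = winv v @ winv u" "winv (winv u) = u" "length (winv u) = length u"
  by (auto simp: winv_def rev_map o_def)

lemma inv_letter_eq_iff [simp]: "inv_letter a = inv_letter b \<longleftrightarrow> a = b"
  by (metis inv_letter_inv_letter)

lemma inv_letter_neq [simp]: "inv_letter a \<noteq> a" "a \<noteq> inv_letter a"
  by (metis inv_letter_def snd_conv)+

lemma fst_set_winv [simp]: "fst ` set (winv u) = fst ` set u"
  by (auto simp: winv_def image_image)

lemma nf_simps [simp]: "nf [] = []" "nf (a # u) = cancel_cons a (nf u)"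
  by (auto simp: nf_def)

lemma reduced_Nil [simp]: "reduced []"
  by (simp add: reduced_def)

lemma reduced_Cons: "reduced (a # u) \<longleftrightarrow> reduced u \<and> (u \<noteq> [] \<longrightarrow> a \<noteq> inv_letter (hd u))"
  by (cases u) (auto simp: reduced_def)

lemma reduced_append: "reduced (u @ v) \<longleftrightarrow>
    reduced u \<and> reduced v \<and> (u \<noteq> [] \<and> v \<noteq> [] \<longrightarrow> last u \<noteq> inv_letter (hd v))"
  by (auto simp: reduced_def successively_append_iff)

lemma reduced_nf [simp]: "reduced (nf u)"
  by (simp add: nf_def reduced_foldr_cancel_cons)

lemma nf_append: "nf (u @ v) = foldr cancel_cons u (nf v)"
  by (simp add: nf_def)

lemma nf_reduced: "reduced u \<Longrightarrow> nf u = u"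
  by (induction u) (auto simp: cancel_cons_def reduced_Cons split: list.splits)

lemma nf_nf [simp]: "nf (nf u) = nf u"
  by (simp add: nf_reduced)

lemma foldr_cancel_cons_eq_nf: "reduced w \<Longrightarrow> foldr cancel_cons u w = nf (u @ w)"
  by (simp add: nf_append nf_reduced)

text \<open>This is associativity in another form. It allows group identities to be checked on
  unreduced concatenations, with \<open>nf\<close> applied once at the end.\<close>

lemma nf_append_nf: "nf (nf u @ v) = nf (u @ v)" "nf (u @ nf v) = nf (u @ v)"
  using foldr_cancel_cons_assoc[of "nf v" u "[]"] by (auto simp: nf_append nf_reduced simp flip: nf_def)

lemma nf_cong: "nf u = nf u' \<Longrightarrow> nf (x @ u @ y) = nf (x @ u' @ y)"
  by (metis nf_append_nf)

lemma nf_cong2: "nf u = nf u' \<Longrightarrow> nf v = nf v' \<Longrightarrow> nf (u @ v) = nf (u' @ v')"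
  by (metis nf_append_nf)

lemma nf_inv_letter: "nf (x @ a # inv_letter a # y) = nf (x @ y)"
proof -
  have "nf (a # inv_letter a # y) = nf y"
    using cancel_cons_inv_letter[of "nf y" a] by simp
  then show ?thesis by (metis nf_append_nf(2))
qed

lemma nf_inv_letter': "nf (x @ inv_letter a # a # y) = nf (x @ y)"
  using nf_inv_letter[of x "inv_letter a" y] by simp

lemma nf_winv_self: "nf (winv u @ u) = []"
proof (induction u)
  case (Cons a u)
  then show ?case using nf_inv_letter'[of "winv u" a u] by simp
qed simp

lemma nf_self_winv: "nf (u @ winv u) = []"
  using nf_winv_self[of "winv u"] by simp

lemma nf_cancel: "nf (x @ winv u @ u @ y) = nf (x @ y)" "nf (x @ u @ winv u @ y) = nf (x @ y)"
  using nf_cong[of "winv u @ u" "[]" x y] nf_cong[of "u @ winv u" "[]" x y]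
  by (simp_all add: nf_winv_self nf_self_winv)

lemma reduced_winv: "reduced u \<Longrightarrow> reduced (winv u)"
  by (simp add: reduced_rev_map_inv_letter winv_def)

lemma nf_winv: "nf (winv u) = winv (nf u)"
proof -
  have "nf (winv u) = nf (winv u @ nf u @ winv (nf u))"
    using nf_cancel(2)[of "winv u" "nf u" "[]"] by simp
  also have "\<dots> = nf (winv u @ u @ winv (nf u))"
    by (metis nf_cong nf_nf)
  also have "\<dots> = winv (nf u)"
    using nf_cancel(1)[of "[]" u "winv (nf u)"] by (simp add: nf_reduced reduced_winv)
  finally show ?thesis .
qed

lemma mset_cancel_cons: "mset (cancel_cons a w) \<subseteq># add_mset a (mset w)"
  by (cases w) (auto simp: cancel_cons_def subseteq_mset_def)

text \<open>Inclusion of multisets is the convenient invariant because it bounds the length, the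
  alphabet and the number of occurrences of each generator at the same time.\<close>

lemma mset_nf: "mset (nf u) \<subseteq># mset u"
proof (induction u)
  case (Cons a u)
  have "mset (nf (a # u)) \<subseteq># add_mset a (mset (nf u))"
    using mset_cancel_cons by simp
  also have "\<dots> \<subseteq># mset (a # u)" using Cons by simp
  finally show ?case .
qed simp

lemma mset_subset_length: "mset u \<subseteq># mset v \<Longrightarrow> length u \<le> length v"
  by (metis size_mset size_mset_mono)

lemma mset_subset_set: "mset u \<subseteq># mset v \<Longrightarrow> set u \<subseteq> set v"
  by (metis set_mset_mono set_mset_mset)

lemma mset_subset_filter:
  assumes "mset u \<subseteq># mset v"
  shows "length (filter P u) \<le> length (filter P v)"
proof -
  have "filter_mset P (mset u) \<subseteq># filter_mset P (mset v)"
    by (rule multiset_filter_mono[OF assms])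
  then show ?thesis by (metis mset_filter mset_subset_length)
qed

lemma set_nf: "set (nf u) \<subseteq> set u"
  using mset_subset_set[OF mset_nf] .

lemma length_nf: "length (nf u) \<le> length u"
  using mset_subset_length[OF mset_nf] .

lemma nf_in_reduced_words: "fst ` set u \<subseteq> S \<Longrightarrow> nf u \<in> reduced_words S"
  using set_nf[of u] by (force simp: reduced_words_def)

lemma reduced_wordsD: "w \<in> reduced_words S \<Longrightarrow> reduced w" "w \<in> reduced_words S \<Longrightarrow> fst ` set w \<subseteq> S"
  by (auto simp: reduced_words_def)

lemma winv_in_reduced_words: "u \<in> reduced_words S \<Longrightarrow> winv u \<in> reduced_words S"
  by (simp add: reduced_words_def reduced_winv)

lemma carrier_free_group [simp]: "carrier (free_group S) = reduced_words S"
  by (simp add: free_group_def)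

lemma one_free_group [simp]: "\<one>\<^bsub>free_group S\<^esub> = []"
  by (simp add: free_group_def)

lemma mult_free_group: "v \<in> reduced_words T \<Longrightarrow> u \<otimes>\<^bsub>free_group S\<^esub> v = nf (u @ v)"
  by (simp add: free_group_def reduced_words_def foldr_cancel_cons_eq_nf)

lemma inv_free_group:
  assumes "u \<in> reduced_words S"
  shows "inv\<^bsub>free_group S\<^esub> u = winv u"
proof -
  interpret group "free_group S" by (rule group_free_group)
  show ?thesis
    using assms by (intro inv_equality) (auto simp: mult_free_group winv_in_reduced_words nf_winv_self)
qed

abbreviation cls :: "'a set \<Rightarrow> 'a letter list \<Rightarrow> 'a letter list set" where
  "cls S \<equiv> conj_class (free_group S)"

lemma conj_class_free_group:
  assumes "w \<in> reduced_words S"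
  shows "cls S w = {nf (h @ w @ winv h) |h. h \<in> reduced_words S}"
proof -
  have "h \<otimes>\<^bsub>free_group S\<^esub> w \<otimes>\<^bsub>free_group S\<^esub> inv\<^bsub>free_group S\<^esub> h = nf (h @ w @ winv h)"
    if "h \<in> reduced_words S" for h
    using that assms by (simp add: inv_free_group mult_free_group[OF winv_in_reduced_words, of _ S]
        mult_free_group[of _ S] nf_append_nf)
  then show ?thesis unfolding conj_class_def carrier_free_group by (intro Collect_cong) metis
qed

lemma conj_class_memI:
  assumes "w \<in> reduced_words S" "fst ` set h \<subseteq> S" "u = nf (h @ w @ winv h)"
  shows "u \<in> cls S w"
proof -
  have "nf (h @ w @ winv h) = nf (nf h @ w @ winv (nf h))"
    by (metis nf_append_nf nf_winv append.assoc)
  then show ?thesis using assms nf_in_reduced_words[of h S] by (auto simp: conj_class_free_group)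
qed

lemma conj_class_subset: "w \<in> reduced_words S \<Longrightarrow> cls S w \<subseteq> reduced_words S"
proof -
  assume w: "w \<in> reduced_words S"
  have "nf (h @ w @ winv h) \<in> reduced_words S" if "h \<in> reduced_words S" for h
  proof -
    have "fst ` set (h @ w @ winv h) \<subseteq> S"
      using w that unfolding reduced_words_def by (simp add: image_Un)
    then show ?thesis by (rule nf_in_reduced_words)
  qed
  then show ?thesis using w by (auto simp: conj_class_free_group)
qed

lemma conj_class_refl: "w \<in> reduced_words S \<Longrightarrow> w \<in> cls S w"
  by (rule conj_class_memI[of _ _ "[]"]) (auto simp: nf_reduced reduced_words_def)

lemma conj_class_mono:
  assumes w: "w \<in> reduced_words S" and u: "u \<in> cls S w"
  shows "cls S u \<subseteq> cls S w"
proof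
  fix x assume x: "x \<in> cls S u"
  have uS: "u \<in> reduced_words S" using conj_class_subset[OF w] u by blast
  obtain h where h: "h \<in> reduced_words S" "u = nf (h @ w @ winv h)"
    using u w by (auto simp: conj_class_free_group)
  obtain g where g: "g \<in> reduced_words S" "x = nf (g @ u @ winv g)"
    using x uS by (auto simp: conj_class_free_group)
  have "x = nf ((g @ h) @ w @ winv (g @ h))"
    using nf_cong[of u "h @ w @ winv h" g "winv g"] g h by simp
  moreover have "fst ` set (g @ h) \<subseteq> S" using g(1) h(1) by (auto simp: reduced_words_def)
  ultimately show "x \<in> cls S w" using w by (intro conj_class_memI)
qed

lemma conj_class_eqI:
  assumes w: "w \<in> reduced_words S" and u: "u \<in> cls S w"
  shows "cls S u = cls S w"
proof -
  have uS: "u \<in> reduced_words S" using conj_class_subset[OF w] u by blast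
  obtain h where h: "h \<in> reduced_words S" "u = nf (h @ w @ winv h)"
    using u w by (auto simp: conj_class_free_group)
  have "nf (winv h @ u @ winv (winv h)) = nf (winv h @ (h @ w @ winv h) @ h)"
    using nf_cong[of u "h @ w @ winv h" "winv h" h] h by simp
  also have "\<dots> = w"
    using nf_cancel(1)[of "[]" h "w @ winv h @ h"] nf_cancel(1)[of w h "[]"] w
    by (simp add: nf_reduced reduced_words_def)
  finally have eq: "nf (winv h @ u @ winv (winv h)) = w" .
  have "fst ` set (winv h) \<subseteq> S" using reduced_wordsD(2)[OF h(1)] by simp
  then have "w \<in> cls S u" by (rule conj_class_memI[OF uS _ eq[symmetric]])
  then show ?thesis using conj_class_mono[OF w u] conj_class_mono[OF uS] by blast
qed

lemma conj_class_nf_conj: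
  assumes "fst ` set u \<subseteq> S" "fst ` set h \<subseteq> S"
  shows "cls S (nf (h @ u @ winv h)) = cls S (nf u)"
proof (rule conj_class_eqI)
  show "nf u \<in> reduced_words S" using assms by (simp add: nf_in_reduced_words)
  then show "nf (h @ u @ winv h) \<in> cls S (nf u)"
    using assms nf_cong[of u "nf u" h "winv h"] by (intro conj_class_memI[where h = h]) simp_all
qed


section \<open>Cyclic reduction\<close>

lemma not_reduced_obtain:
  assumes "\<not> reduced u"
  obtains x a y where "u = x @ a # inv_letter a # y"
proof -
  have "\<exists>x a y. u = x @ a # inv_letter a # y" using assms
  proof (induction u)
    case (Cons b u)
    show ?case
    proof (cases "reduced u")
      case True
      then have "u \<noteq> []" "b = inv_letter (hd u)" using Cons.prems by (auto simp: reduced_Cons)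
      then have "b # u = [] @ b # inv_letter b # tl u" by auto
      then show ?thesis by blast
    next
      case False
      then show ?thesis using Cons.IH by (metis append_Cons)
    qed
  qed simp
  then show ?thesis using that by blast
qed

text \<open>Delete an adjacent inverse pair, or move inverse end letters into the conjugator
  \<open>h\<close>. Both operations only remove letters from the word, whence the multiset
  bound.\<close>

lemma cyclic_reduction:
  "\<exists>h u'. cyclically_reduced u' \<and> nf u = nf (h @ u' @ winv h) \<and> mset u' \<subseteq># mset u \<and> set h \<subseteq> set u"
proof (induction "length u" arbitrary: u rule: less_induct)
  case less
  consider (nr) "\<not> reduced u" | (cr) "cyclically_reduced u"
    | (nc) "reduced u" "u \<noteq> []" "hd u = inv_letter (last u)"
    by (auto simp: cyclically_reduced_def)
  then show ?case
  proof cases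
    case cr
    then show ?thesis by (intro exI[of _ "[]"] exI[of _ u]) auto
  next
    case nr
    then obtain x a y where u: "u = x @ a # inv_letter a # y" by (rule not_reduced_obtain)
    obtain h u' where *: "cyclically_reduced u'" "nf (x @ y) = nf (h @ u' @ winv h)"
      "mset u' \<subseteq># mset (x @ y)" "set h \<subseteq> set (x @ y)"
      using less[of "x @ y"] u by auto
    have "mset (x @ y) \<subseteq># mset u" using u by (simp add: subset_mset.add_increasing2 subset_mset.add_mono)
    then have "mset u' \<subseteq># mset u" using *(3) by (rule subset_mset.order_trans[rotated])
    moreover have "nf u = nf (x @ y)" using u nf_inv_letter by simp
    ultimately show ?thesis using * u by (intro exI[of _ h] exI[of _ u']) auto
  next
    case nc
    obtain a m where u: "u = a # m @ [inv_letter a]"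
    proof -
      obtain b v where bv: "u = b # v" using nc by (cases u) auto
      then have "v \<noteq> []" using nc by auto
      then have "v = butlast v @ [last v]" by simp
      moreover have "last v = inv_letter b" using nc bv \<open>v \<noteq> []\<close> by simp
      ultimately show ?thesis using that bv by metis
    qed
    obtain h u' where *: "cyclically_reduced u'" "nf m = nf (h @ u' @ winv h)"
      "mset u' \<subseteq># mset m" "set h \<subseteq> set m"
      using less[of m] u by auto
    have "mset m \<subseteq># mset u" using u by (simp add: subset_mset.add_increasing2)
    then have "mset u' \<subseteq># mset u" using *(3) by (rule subset_mset.order_trans[rotated])
    moreover have "nf u = nf ((a # h) @ u' @ winv (a # h))"
      using nf_cong[OF *(2), of "[a]" "[inv_letter a]"] u by simp
    moreover have "set (a # h) \<subseteq> set u" using *(4) u by auto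
    ultimately show ?thesis using *(1) by (intro exI[of _ "a # h"] exI[of _ u']) auto
  qed
qed

lemma cyclically_reduced_Nil [simp]: "cyclically_reduced []"
  by (simp add: cyclically_reduced_def)

lemma cyclically_reduced_append_commute:
  assumes "cyclically_reduced (u @ v)"
  shows "cyclically_reduced (v @ u)"
  using assms by (cases "u = []"; cases "v = []")
    (auto simp: cyclically_reduced_def reduced_append)

lemma cyclically_reduced_rotate: "cyclically_reduced w \<Longrightarrow> cyclically_reduced (rotate n w)"
  by (metis cyclically_reduced_append_commute append_take_drop_id rotate_drop_take)

text \<open>Peel off the last letter \<open>a\<close> of the conjugator. If it cancels against an
  end of \<open>u\<close>, then \<open>u\<close> is merely rotated and the induction continues; if
  not, the whole conjugate is reduced as it stands and its end letters are inverse to each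
  other.\<close>

lemma conj_cyclically_reduced_aux:
  assumes "reduced h" "cyclically_reduced u" "u \<noteq> []"
  shows "(\<exists>n. nf (h @ u @ winv h) = rotate n u) \<or> \<not> cyclically_reduced (nf (h @ u @ winv h))"
  using assms
proof (induction h arbitrary: u rule: rev_induct)
  case Nil
  then show ?case by (intro disjI1 exI[of _ 0]) (simp add: nf_reduced cyclically_reduced_def)
next
  case (snoc a h)
  have rh: "reduced h" using snoc.prems by (simp add: reduced_append)
  have ru: "reduced u" using snoc.prems by (simp add: cyclically_reduced_def)
  consider (hd) "hd u = inv_letter a" | (last) "last u = a" | (none) "hd u \<noteq> inv_letter a" "last u \<noteq> a"
    by blast
  then show ?case
  proof cases
    case hd
    then obtain v where u: "u = inv_letter a # v" using snoc.prems by (cases u) auto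
    have *: "nf ((h @ [a]) @ u @ winv (h @ [a])) = nf (h @ (rotate 1 u) @ winv h)"
      using nf_inv_letter[of h a "v @ [inv_letter a] @ winv h"] u by simp
    have "cyclically_reduced (rotate 1 u)" "rotate 1 u \<noteq> []"
      using snoc.prems cyclically_reduced_rotate[of u 1] by auto
    from snoc.IH[OF rh this] show ?thesis unfolding * by (metis rotate_rotate)
  next
    case last
    then obtain v where u: "u = v @ [a]" using snoc.prems by (cases u rule: rev_cases) auto
    have *: "nf ((h @ [a]) @ u @ winv (h @ [a])) = nf (h @ (a # v) @ winv h)"
      using nf_inv_letter[of "h @ a # v" a "winv h"] u by simp
    have "cyclically_reduced (a # v)" "a # v \<noteq> []"
      using snoc.prems cyclically_reduced_append_commute[of v "[a]"] u by auto
    note IH = snoc.IH[OF rh this]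
    have "a # v = rotate (length v) u" using u by (simp add: rotate_append)
    then show ?thesis using IH unfolding * by (metis rotate_rotate)
  next
    case none
    have last_inv: "last (winv x) = inv_letter (hd x)" "hd (winv x) = inv_letter (last x)" if "x \<noteq> []" for x :: "'a letter list"
      using that by (auto simp: winv_def last_rev hd_rev last_map hd_map)
    have ne: "h @ [a] \<noteq> []" by simp
    have hdw: "hd (winv (h @ [a])) = inv_letter a" by simp
    have "reduced (u @ winv (h @ [a]))"
      using none ru reduced_winv[OF snoc.prems(1)] unfolding reduced_append[of u] hdw by simp
    moreover have "a \<noteq> inv_letter (hd u)" using none(1) by (metis inv_letter_inv_letter)
    ultimately have r: "reduced ((h @ [a]) @ u @ winv (h @ [a]))"
      using snoc.prems unfolding reduced_append[of "h @ [a]"] by simp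
    have "hd ((h @ [a]) @ u @ winv (h @ [a])) = hd (h @ [a])"
      by (metis hd_append2 ne)
    moreover have "last ((h @ [a]) @ u @ winv (h @ [a])) = inv_letter (hd (h @ [a]))"
      using last_inv(1)[OF ne] by (metis last_appendR append_is_Nil_conv ne length_0_conv winv_simps(5))
    ultimately have "\<not> cyclically_reduced ((h @ [a]) @ u @ winv (h @ [a]))"
      by (auto simp: cyclically_reduced_def)
    then show ?thesis using r by (metis nf_reduced)
  qed
qed

lemma conj_class_cyclically_reduced:
  assumes "w \<in> reduced_words S" "u \<in> cls S w" "v \<in> cls S w"
    and "cyclically_reduced u" "cyclically_reduced v"
  obtains n where "v = rotate n u"
proof -
  have uS: "u \<in> reduced_words S" using assms conj_class_subset by blast
  have "v \<in> cls S u" using assms conj_class_eqI[OF assms(1,2)] by simp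
  then obtain h where h: "h \<in> reduced_words S" "v = nf (h @ u @ winv h)"
    using uS by (auto simp: conj_class_free_group)
  show ?thesis
  proof (cases "u = []")
    case True
    then show ?thesis using that[of 0] h by (simp add: nf_self_winv)
  next
    case False
    then show ?thesis
      using conj_cyclically_reduced_aux[of h u] that assms h by (auto simp: reduced_words_def)
  qed
qed

lemma rotate_in_conj_class:
  assumes "w \<in> reduced_words S"
  shows "nf (rotate n w) \<in> cls S w"
proof -
  define m where "m = n mod length w"
  have eq: "rotate n w = drop m w @ take m w" by (simp add: m_def rotate_drop_take)
  have "nf (winv (take m w) @ w @ take m w) = nf (rotate n w)"
    using nf_cancel(1)[of "[]" "take m w" "drop m w @ take m w"]
    by (metis append.assoc append_Nil append_take_drop_id eq)
  moreover have "fst ` set (take m w) \<subseteq> S"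
    using assms set_take_subset[of m w] by (auto simp: reduced_words_def)
  ultimately show ?thesis
    using conj_class_memI[of w S "winv (take m w)"] assms by simp
qed

lemma cyclic_length_eq:
  assumes "w \<in> reduced_words S" "u \<in> cls S w" "cyclically_reduced u"
  shows "cyclic_length S w = length u"
  unfolding cyclic_length_def
proof (rule the_equality)
  fix n assume "\<exists>v\<in>cls S w. cyclically_reduced v \<and> length v = n"
  then obtain v where "v \<in> cls S w" "cyclically_reduced v" "length v = n" by blast
  then show "n = length u"
    using conj_class_cyclically_reduced[OF assms(1,2) _ assms(3)] by (metis length_rotate)
qed (use assms in blast)

lemma cyclic_reduction_class:
  assumes "fst ` set u \<subseteq> S"
  obtains w where "w \<in> reduced_words S" "cyclically_reduced w" "mset w \<subseteq># mset u"
    "cls S w = cls S (nf u)"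
proof -
  obtain h w where *: "cyclically_reduced w" "nf u = nf (h @ w @ winv h)" "mset w \<subseteq># mset u" "set h \<subseteq> set u"
    using cyclic_reduction by blast
  have S: "fst ` set w \<subseteq> S" "fst ` set h \<subseteq> S"
    using assms *(4) mset_subset_set[OF *(3)] by auto
  have "nf w = w" using *(1) by (simp add: nf_reduced cyclically_reduced_def)
  moreover have "w \<in> reduced_words S" using S *(1) by (simp add: reduced_words_def cyclically_reduced_def)
  ultimately show ?thesis
    using that[of w] * conj_class_nf_conj[OF S] by metis
qed

declare split_paired_All [simp del] split_paired_Ex [simp del]

section \<open>Automorphisms and primitive elements\<close>

definition subst :: "('a letter \<Rightarrow> 'b letter list) \<Rightarrow> 'a letter list \<Rightarrow> 'b letter list" where
  "subst f u = concat (map f u)"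

text \<open>Homomorphisms are given on letters rather than on generators. The images of inverse
  letters have to be inverse only after reduction, so that unreduced products are admissible
  images.\<close>

definition letter_hom :: "('a letter \<Rightarrow> 'b letter list) \<Rightarrow> bool" where
  "letter_hom f \<longleftrightarrow> (\<forall>a. nf (f (inv_letter a) @ f a) = [])"

lemma subst_simps [simp]: "subst f [] = []" "subst f (a # u) = f a @ subst f u"
  "subst f (u @ v) = subst f u @ subst f v"
  by (auto simp: subst_def)

lemma subst_subst: "subst f (subst g u) = subst (\<lambda>a. subst f (g a)) u"
  by (induction u) auto

lemma nf_subst_cong: "(\<And>a. a \<in> set u \<Longrightarrow> nf (f a) = nf (g a)) \<Longrightarrow> nf (subst f u) = nf (subst g u)"
  by (induction u) (auto intro: nf_cong2)

lemma subst_single [simp]: "subst (\<lambda>a. [a]) u = u"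
  by (induction u) auto

lemma letter_homD:
  assumes "letter_hom f"
  shows "nf (f (inv_letter a) @ f a @ y) = nf y" "nf (f a @ f (inv_letter a) @ y) = nf y"
proof -
  have *: "nf (f (inv_letter b) @ f b @ y) = nf y" for b
  proof -
    have "nf (f (inv_letter b) @ f b) = nf []" using assms unfolding letter_hom_def by simp
    from nf_cong2[OF this refl, of y] show ?thesis by simp
  qed
  show "nf (f (inv_letter a) @ f a @ y) = nf y" "nf (f a @ f (inv_letter a) @ y) = nf y"
    using *[of a] *[of "inv_letter a"] by simp_all
qed

lemma nf_subst_cancel_cons:
  assumes "letter_hom f"
  shows "nf (subst f (cancel_cons a v)) = nf (f a @ subst f v)"
proof (cases v)
  case (Cons b w)
  then show ?thesis using letter_homD(1)[OF assms, of b "subst f w"] by (auto simp: cancel_cons_def)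
qed (simp add: cancel_cons_def)

lemma nf_subst_nf:
  assumes "letter_hom f"
  shows "nf (subst f (nf u)) = nf (subst f u)"
  by (induction u) (use nf_subst_cancel_cons[OF assms] in \<open>auto intro: nf_cong2\<close>)

lemma nf_eq_winvI: "nf (x @ y) = [] \<Longrightarrow> nf x = nf (winv y)"
  using nf_cancel(2)[of x y "[]"] nf_cong2[of "x @ y" "[]" "winv y" "winv y"] by simp

lemma nf_subst_winv:
  assumes "letter_hom f"
  shows "nf (subst f (winv u)) = nf (winv (subst f u))"
proof (rule nf_eq_winvI)
  have "nf (subst f (winv u) @ subst f u) = nf (subst f (winv u @ u))" by simp
  also have "\<dots> = []" using nf_subst_nf[OF assms, of "winv u @ u"] by (simp add: nf_winv_self)
  finally show "nf (subst f (winv u) @ subst f u) = []" .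
qed

text \<open>Carrying the inverse along, given on letters, makes bijectivity a check on single
  letters.\<close>

definition is_aut :: "'a set \<Rightarrow> ('a letter \<Rightarrow> 'a letter list) \<Rightarrow> ('a letter \<Rightarrow> 'a letter list) \<Rightarrow> bool" where
  "is_aut S f g \<longleftrightarrow> letter_hom f \<and> letter_hom g \<and>
     (\<forall>a. fst a \<in> S \<longrightarrow> fst ` set (f a) \<subseteq> S \<and> fst ` set (g a) \<subseteq> S \<and>
        nf (subst g (f a)) = [a] \<and> nf (subst f (g a)) = [a])"

lemma is_aut_sym: "is_aut S f g \<Longrightarrow> is_aut S g f"
  by (auto simp: is_aut_def)

lemma is_aut_set: "is_aut S f g \<Longrightarrow> fst ` set u \<subseteq> S \<Longrightarrow> fst ` set (subst f u) \<subseteq> S"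
proof (induction u)
  case (Cons a u)
  then have "fst ` set (f a) \<subseteq> S" by (auto simp: is_aut_def simp del: split_paired_All)
  then show ?case using Cons by (simp add: image_Un)
qed simp

lemma is_aut_inverse:
  assumes "is_aut S f g" "u \<in> reduced_words S"
  shows "nf (subst g (nf (subst f u))) = u"
proof -
  have "nf (subst g (nf (subst f u))) = nf (subst (\<lambda>a. subst g (f a)) u)"
    using assms by (simp add: nf_subst_nf is_aut_def subst_subst)
  also have "\<dots> = nf (subst (\<lambda>a. [a]) u)"
    using assms by (intro nf_subst_cong) (auto simp: is_aut_def reduced_words_def cancel_cons_def)
  finally show ?thesis using assms by (simp add: nf_reduced reduced_words_def)
qed

lemma is_aut_reduced_words:
  assumes "is_aut S f g" "u \<in> reduced_words S"
  shows "nf (subst f u) \<in> reduced_words S"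
  using is_aut_set[OF assms(1)] assms(2) by (intro nf_in_reduced_words) (auto simp: reduced_words_def)

lemma is_aut_iso:
  assumes "is_aut S f g"
  shows "(\<lambda>u. nf (subst f u)) \<in> iso (free_group S) (free_group S)"
proof -
  have "nf (subst f (nf (u @ v))) = nf (nf (subst f u) @ nf (subst f v))" for u v
    using assms by (simp add: nf_subst_nf is_aut_def nf_append_nf)
  then have "(\<lambda>u. nf (subst f u)) \<in> hom (free_group S) (free_group S)"
    using is_aut_reduced_words[OF assms] by (auto simp: hom_def mult_free_group[of _ S])
  moreover have "bij_betw (\<lambda>u. nf (subst f u)) (reduced_words S) (reduced_words S)"
    by (rule bij_betw_byWitness[where f' = "\<lambda>u. nf (subst g u)"])
      (use assms is_aut_sym[OF assms] in \<open>auto simp: is_aut_inverse is_aut_reduced_words\<close>)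
  ultimately show ?thesis by (simp add: iso_def)
qed

section \<open>Action of automorphisms on conjugacy classes\<close>

definition act :: "('a letter \<Rightarrow> 'b letter list) \<Rightarrow> 'a letter list set \<Rightarrow> 'b letter list set" where
  "act f c = (\<lambda>u. nf (subst f u)) ` c"

lemma act_conj_class:
  assumes "is_aut S f g" "w \<in> reduced_words S"
  shows "act f (cls S w) = cls S (nf (subst f w))"
proof -
  have lf: "letter_hom f" "letter_hom g" using assms by (auto simp: is_aut_def)
  have eq: "nf (subst f (nf (h @ w @ winv h))) = nf (nf (subst f h) @ nf (subst f w) @ winv (nf (subst f h)))" for h
  proof -
    have "nf (subst f (nf (h @ w @ winv h))) = nf (subst f h @ subst f w @ subst f (winv h))"
      using nf_subst_nf[OF lf(1), of "h @ w @ winv h"] by simp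
    also have "\<dots> = nf (subst f h @ subst f w @ winv (subst f h))"
      using nf_subst_winv[OF lf(1), of h] by (intro nf_cong2) auto
    also have "\<dots> = nf (nf (subst f h) @ nf (subst f w) @ nf (winv (subst f h)))"
      by (intro nf_cong2) auto
    finally show ?thesis by (simp add: nf_winv)
  qed
  \<comment> \<open>By surjectivity every conjugator is the image of a conjugator, so the image of a
    class is a whole class.\<close>
  have "\<exists>h\<in>reduced_words S. x = nf (subst f h)" if "x \<in> reduced_words S" for x
    using is_aut_inverse[OF is_aut_sym[OF assms(1)] that] is_aut_reduced_words[OF is_aut_sym[OF assms(1)] that]
    by metis
  then have "{nf (nf (subst f h) @ nf (subst f w) @ winv (nf (subst f h))) |h. h \<in> reduced_words S}
      = {nf (h @ nf (subst f w) @ winv h) |h. h \<in> reduced_words S}"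
    using is_aut_reduced_words[OF assms(1)] by blast
  moreover have "act f (cls S w) = {nf (subst f (nf (h @ w @ winv h))) |h. h \<in> reduced_words S}"
    unfolding act_def conj_class_free_group[OF assms(2)] by blast
  ultimately show ?thesis
    unfolding eq conj_class_free_group[OF is_aut_reduced_words[OF assms]] by simp
qed

lemma act_act:
  assumes "letter_hom f"
  shows "act f (act g c) = act (\<lambda>a. subst f (g a)) c"
  unfolding act_def image_image by (simp add: nf_subst_nf[OF assms] subst_subst)

lemma act_cong:
  assumes "c \<subseteq> reduced_words S" "\<And>a. fst a \<in> S \<Longrightarrow> nf (f a) = nf (g a)"
  shows "act f c = act g c"
  unfolding act_def using assms by (intro image_cong refl nf_subst_cong) (auto simp: reduced_words_def)

lemma act_inverse:
  assumes "is_aut S f g" "c \<subseteq> reduced_words S"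
  shows "act g (act f c) = c"
  unfolding act_def image_image using is_aut_inverse[OF assms(1)] assms(2) by (force simp: image_def)

section \<open>Renaming letters and transporting free bases\<close>

lemma map_cancel_cons:
  assumes "\<And>b. b \<in> set w \<Longrightarrow> m a = inv_letter (m b) \<longleftrightarrow> a = inv_letter b"
  shows "cancel_cons (m a) (map m w) = map m (cancel_cons a w)"
  using assms by (cases w) (auto simp: cancel_cons_def)

lemma nf_map_letter:
  assumes "inj_on \<phi> B" "fst ` set u \<subseteq> B"
  shows "nf (map (map_prod \<phi> id) u) = map (map_prod \<phi> id) (nf u)"
  using assms(2)
proof (induction u)
  case (Cons a u)
  have "set (nf u) \<subseteq> set u" by (rule set_nf)
  then have fB: "fst ` set (nf u) \<subseteq> B" using Cons.prems by auto
  have eq: "map_prod \<phi> id a = inv_letter (map_prod \<phi> id b) \<longleftrightarrow> a = inv_letter b" if "b \<in> set (nf u)" for b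
    using that fB Cons.prems assms(1)
    by (cases a; cases b) (auto simp: inv_letter_def inj_on_eq_iff)
  have IH: "nf (map (map_prod \<phi> id) u) = map (map_prod \<phi> id) (nf u)"
    by (rule Cons.IH) (use Cons.prems in auto)
  have "nf (map (map_prod \<phi> id) (a # u)) = cancel_cons (map_prod \<phi> id a) (map (map_prod \<phi> id) (nf u))"
    by (simp only: list.map nf_simps IH)
  also have "\<dots> = map (map_prod \<phi> id) (nf (a # u))"
    unfolding nf_simps using eq by (rule map_cancel_cons)
  finally show ?case .
qed simp

lemma map_letter_bij:
  assumes "inj_on \<phi> B"
  shows "bij_betw (map (map_prod \<phi> id)) (reduced_words B) (reduced_words (\<phi> ` B))"
proof (rule bij_betw_byWitness[where f' = "map (map_prod (inv_into B \<phi>) id)"])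
  have *: "map (map_prod \<phi> id) u \<in> reduced_words (\<phi> ` B)"
    if "inj_on \<phi> B" "u \<in> reduced_words B" for u \<phi> and B :: "'c set"
  proof -
    have u: "reduced u" "fst ` set u \<subseteq> B" using that(2) by (auto simp: reduced_words_def)
    have "reduced (map (map_prod \<phi> id) u)"
      using nf_map_letter[OF that(1) u(2)] u(1) by (metis nf_reduced reduced_nf)
    then show ?thesis using u(2) by (auto simp: reduced_words_def)
  qed
  show "map (map_prod \<phi> id) ` reduced_words B \<subseteq> reduced_words (\<phi> ` B)" using * assms by auto
  have "inj_on (inv_into B \<phi>) (\<phi> ` B)" by (simp add: inj_on_inv_into)
  moreover have "inv_into B \<phi> ` \<phi> ` B = B" using assms by (simp add: inv_into_image_cancel)
  ultimately show "map (map_prod (inv_into B \<phi>) id) ` reduced_words (\<phi> ` B) \<subseteq> reduced_words B"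
    using *[of "inv_into B \<phi>" "\<phi> ` B"] by auto
  show "\<forall>u\<in>reduced_words B. map (map_prod (inv_into B \<phi>) id) (map (map_prod \<phi> id) u) = u"
    using assms by (force simp: reduced_words_def intro!: map_idI)
  show "\<forall>u\<in>reduced_words (\<phi> ` B). map (map_prod \<phi> id) (map (map_prod (inv_into B \<phi>) id) u) = u"
    by (force simp: reduced_words_def f_inv_into_f intro!: map_idI)
qed

lemma map_letter_hom:
  assumes "inj_on \<phi> B" "u \<in> reduced_words B" "v \<in> reduced_words B"
  shows "map (map_prod \<phi> id) u \<otimes>\<^bsub>free_group (\<phi> ` B)\<^esub> map (map_prod \<phi> id) v
    = map (map_prod \<phi> id) (u \<otimes>\<^bsub>free_group B\<^esub> v)"
proof -
  have "map (map_prod \<phi> id) v \<in> reduced_words (\<phi> ` B)"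
    using map_letter_bij[OF assms(1)] assms(3) by (auto simp: bij_betw_def)
  moreover have "fst ` set (u @ v) \<subseteq> B" using assms by (auto simp: reduced_words_def)
  ultimately show ?thesis
    using nf_map_letter[OF assms(1), of "u @ v"] assms by (simp add: mult_free_group)
qed

text \<open>In \<open>free_basis\<close> the group elements themselves serve as generators. Here a
  basis is parametrised by an arbitrary index set through an injection \<open>\<phi>\<close>, and
  the isomorphism is transported along the renaming of letters.\<close>

lemma free_basisI:
  assumes "inj_on \<phi> B" "\<phi> ` B \<subseteq> carrier G"
    and "(\<lambda>u. word_eval G (map (map_prod \<phi> id) u)) \<in> iso (free_group B) G"
  shows "free_basis G (\<phi> ` B)"
proof -
  let ?m = "map (map_prod \<phi> id)"
  have bij: "bij_betw ?m (reduced_words B) (reduced_words (\<phi> ` B))"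
    by (rule map_letter_bij[OF assms(1)])
  have hom: "(\<lambda>u. word_eval G (?m u)) \<in> hom (free_group B) G"
    and "bij_betw (word_eval G \<circ> ?m) (reduced_words B) (carrier G)"
    using assms(3) by (auto simp: iso_def o_def)
  then have "bij_betw (word_eval G) (reduced_words (\<phi> ` B)) (carrier G)"
    using bij_betw_comp_iff[OF bij] by blast
  moreover have "word_eval G \<in> hom (free_group (\<phi> ` B)) G"
  proof (rule homI)
    fix x y assume "x \<in> carrier (free_group (\<phi> ` B))" "y \<in> carrier (free_group (\<phi> ` B))"
    then obtain u v where uv: "x = ?m u" "y = ?m v" "u \<in> reduced_words B" "v \<in> reduced_words B"
      using bij unfolding bij_betw_def carrier_free_group by blast
    then show "word_eval G (x \<otimes>\<^bsub>free_group (\<phi> ` B)\<^esub> y) = word_eval G x \<otimes>\<^bsub>G\<^esub> word_eval G y"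
      using hom by (auto simp: map_letter_hom[OF assms(1)] hom_def)
  qed (use calculation in \<open>auto simp: bij_betw_def\<close>)
  ultimately show ?thesis using assms(2) by (simp add: free_basis_def iso_def)
qed

lemma word_eval_map_iso:
  assumes "group G" "\<phi> \<in> hom G G" "B \<subseteq> carrier G" "fst ` set u \<subseteq> B"
  shows "word_eval G u \<in> carrier G \<and> word_eval G (map (map_prod \<phi> id) u) = \<phi> (word_eval G u)"
  using assms(4)
proof (induction u)
  case Nil
  then show ?case using assms(1,2) by (simp add: word_eval_def group.is_monoid monoid.one_closed hom_one)
next
  case (Cons a u)
  interpret group_hom G G \<phi> using assms by (simp add: group_hom_def group_hom_axioms_def)
  have "fst a \<in> carrier G" using Cons.prems assms by auto
  then show ?case using Cons by (auto simp: word_eval_def)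
qed

lemma free_basis_iso:
  assumes "group G" "\<phi> \<in> iso G G" "free_basis G B"
  shows "free_basis G (\<phi> ` B)"
proof (rule free_basisI)
  have B: "B \<subseteq> carrier G" "word_eval G \<in> iso (free_group B) G" using assms by (auto simp: free_basis_def)
  have inj: "inj_on \<phi> (carrier G)" using assms(2) by (auto simp: iso_def bij_betw_def)
  show "inj_on \<phi> B" using inj B(1) by (rule inj_on_subset)
  show "\<phi> ` B \<subseteq> carrier G" using assms(2) B by (auto simp: iso_def hom_def)
  have eq: "word_eval G (map (map_prod \<phi> id) u) = \<phi> (word_eval G u)" if "u \<in> reduced_words B" for u
    using word_eval_map_iso[of G \<phi> B u] assms B that by (auto simp: iso_def reduced_words_def)
  have c: "(\<phi> \<circ> word_eval G) \<in> iso (free_group B) G"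
    using B(2) assms(2) by (rule iso_set_trans)
  show "(\<lambda>u. word_eval G (map (map_prod \<phi> id) u)) \<in> iso (free_group B) G"
    by (rule group.iso_eq[OF group_free_group c]) (simp add: eq)
qed

abbreviation prim :: "'a set \<Rightarrow> 'a letter list \<Rightarrow> bool" where
  "prim S w \<equiv> primitive_elem (free_group S) w"

lemma prim_iso: "\<phi> \<in> iso (free_group S) (free_group S) \<Longrightarrow> prim S w \<Longrightarrow> prim S (\<phi> w)"
  unfolding primitive_elem_def using free_basis_iso[OF group_free_group] by blast

lemma prim_aut: "is_aut S f g \<Longrightarrow> prim S w \<Longrightarrow> prim S (nf (subst f w))"
  using prim_iso[OF is_aut_iso] .

text \<open>Conjugation by \<open>h\<close> is an automorphism and maps bases to bases. This makes
  primitivity a property of the cyclic word.\<close>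

lemma prim_conj:
  assumes "w \<in> reduced_words S" "prim S w" "u \<in> cls S w"
  shows "prim S u"
proof -
  obtain h where h: "h \<in> reduced_words S" "u = nf (h @ w @ winv h)"
    using assms by (auto simp: conj_class_free_group)
  let ?c = "\<lambda>h u. nf (h @ u @ winv h)"
  have closed: "?c h x \<in> reduced_words S" if "h \<in> reduced_words S" "x \<in> reduced_words S" for h x
    using that conj_class_subset[of x S] by (auto simp: conj_class_free_group)
  have inv: "?c (winv h) (?c h x) = x" if "x \<in> reduced_words S" for h x
  proof -
    have "?c (winv h) (?c h x) = nf (winv h @ (h @ x @ winv h) @ winv (winv h))"
      by (intro nf_cong) simp
    also have "\<dots> = x"
      using nf_cancel(1)[of "[]" h "x @ winv h @ h"] nf_cancel(1)[of x h "[]"] that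
      by (simp add: nf_reduced reduced_words_def)
    finally show ?thesis .
  qed
  have hom: "?c h (nf (x @ y)) = nf (?c h x @ ?c h y)" for x y
  proof -
    have "nf (?c h x @ ?c h y) = nf (h @ x @ winv h @ h @ y @ winv h)"
      by (simp add: nf_append_nf)
    also have "\<dots> = nf (h @ (x @ y) @ winv h)"
      using nf_cancel(1)[of "h @ x" h "y @ winv h"] by simp
    also have "\<dots> = ?c h (nf (x @ y))" by (intro nf_cong) simp
    finally show ?thesis by simp
  qed
  have "?c h \<in> iso (free_group S) (free_group S)"
  proof -
    have "?c h \<in> hom (free_group S) (free_group S)"
      using closed[OF h(1)] by (auto simp: hom_def mult_free_group[of _ S] hom)
    moreover have "bij_betw (?c h) (reduced_words S) (reduced_words S)"
      by (rule bij_betw_byWitness[where f' = "?c (winv h)"])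
        (use h closed[of h] closed[of "winv h"] inv[of _ h] inv[of _ "winv h"] winv_in_reduced_words[OF h(1)] in auto)
    ultimately show ?thesis by (simp add: iso_def)
  qed
  from prim_iso[OF this assms(2)] show ?thesis using h by simp
qed

lemma free_basis_standard: "free_basis (free_group S) ((\<lambda>x. [(x, True)]) ` S)"
proof (rule free_basisI)
  show "inj_on (\<lambda>x. [(x, True)]) S" by (auto simp: inj_on_def)
  have s: "[a] \<in> reduced_words S" if "fst a \<in> S" for a
    using that by (simp add: reduced_words_def reduced_Cons)
  show "(\<lambda>x. [(x, True)]) ` S \<subseteq> carrier (free_group S)" using s by auto
  have ev: "word_eval (free_group S) (map (map_prod (\<lambda>x. [(x, True)]) id) u) = nf u" if "fst ` set u \<subseteq> S" for u
    using that
  proof (induction u)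
    case (Cons a u)
    obtain x b where a: "a = (x, b)" by (cases a)
    have *: "nf u \<in> reduced_words S" using Cons.prems by (intro nf_in_reduced_words) auto
    have "inv\<^bsub>free_group S\<^esub> [(x, True)] = [(x, False)]"
      using s[of "(x, True)"] Cons.prems a by (simp add: inv_free_group inv_letter_def)
    then show ?case using Cons a * by (cases b) (auto simp: word_eval_def mult_free_group)
  qed (simp add: word_eval_def)
  then have ev': "word_eval (free_group S) (map (map_prod (\<lambda>x. [(x, True)]) id) u) = u" if "u \<in> reduced_words S" for u
    using that by (simp add: reduced_words_def nf_reduced)
  have cl: "nf (u @ v) \<in> reduced_words S" if "u \<in> reduced_words S" "v \<in> reduced_words S" for u v
    using that by (intro nf_in_reduced_words) (auto simp: reduced_words_def)
  show "(\<lambda>u. word_eval (free_group S) (map (map_prod (\<lambda>x. [(x, True)]) id) u)) \<in> iso (free_group S) (free_group S)"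
    unfolding iso_def hom_def using cl
    by (auto simp: mult_free_group[of _ S] ev' bij_betw_def inj_on_def image_def simp del: list.map)
qed

section \<open>Transvections, inversions and Whitehead automorphisms\<close>

definition tv :: "'a \<Rightarrow> 'a letter list \<Rightarrow> 'a letter list \<Rightarrow> 'a letter \<Rightarrow> 'a letter list" where
  "tv t p q a = (if a = (t, True) then p @ [a] @ q else if a = (t, False) then winv q @ [a] @ winv p else [a])"

lemma tv_other: "fst a \<noteq> t \<Longrightarrow> tv t p q a = [a]"
  by (auto simp: tv_def)

lemma subst_tv_other: "t \<notin> fst ` set u \<Longrightarrow> subst (tv t p q) u = u"
  by (induction u) (auto simp: tv_other)

lemma fst_eq_cases: "fst a = t \<longleftrightarrow> a = (t, True) \<or> a = (t, False)"
  by (cases a) auto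

lemma inv_letter_pair [simp]: "inv_letter (t, b) = (t, \<not> b)"
  by (simp add: inv_letter_def)

lemma letter_hom_tv: "letter_hom (tv t p q)"
  unfolding letter_hom_def
proof
  fix a :: "'a letter"
  show "nf (tv t p q (inv_letter a) @ tv t p q a) = []"
  proof (cases "fst a = t")
    case True
    have "winv (tv t p q a) = tv t p q (inv_letter a)"
      using True by (auto simp: tv_def fst_eq_cases)
    then show ?thesis using nf_winv_self by metis
  next
    case False
    then show ?thesis using nf_winv_self[of "[a]"] by (simp add: tv_other)
  qed
qed

lemma is_aut_tv:
  assumes "t \<in> S" "fst ` set p \<subseteq> S - {t}" "fst ` set q \<subseteq> S - {t}"
  shows "is_aut S (tv t p q) (tv t (winv p) (winv q))"
proof -
  have *: "nf (subst (tv t (winv p) (winv q)) (tv t p q a)) = [a]"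
    if "fst a \<in> S" "t \<notin> fst ` set p" "t \<notin> fst ` set q" for a p q
  proof (cases "fst a = t")
    case True
    have n: "subst (tv t (winv p) (winv q)) p = p" "subst (tv t (winv p) (winv q)) q = q"
      "subst (tv t (winv p) (winv q)) (winv p) = winv p" "subst (tv t (winv p) (winv q)) (winv q) = winv q"
      using that by (simp_all add: subst_tv_other)
    show ?thesis
      using True nf_cancel(2)[of "[]" p "[(t, True)] @ winv q @ q"] nf_cancel(1)[of "[(t, True)]" q "[]"]
        nf_cancel(1)[of "[]" q "[(t, False)] @ p @ winv p"] nf_cancel(2)[of "[(t, False)]" p "[]"]
      unfolding fst_eq_cases tv_def[of t p q]
      by (auto simp: n) (auto simp: tv_def cancel_cons_def)
  qed (simp add: tv_other cancel_cons_def)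
  have set_tv: "fst ` set (tv t p q a) \<subseteq> S" if "fst a \<in> S" "fst ` set p \<subseteq> S - {t}" "fst ` set q \<subseteq> S - {t}" for a p q
    using that by (cases "fst a = t") (use fst_set_winv[of p] fst_set_winv[of q] in \<open>auto simp: tv_def fst_eq_cases image_Un simp del: fst_set_winv\<close>)
  have t: "t \<notin> fst ` set p" "t \<notin> fst ` set q" using assms by auto
  show ?thesis
    unfolding is_aut_def
  proof (intro conjI allI impI letter_hom_tv)
    fix a :: "'a letter" assume a: "fst a \<in> S"
    show "fst ` set (tv t p q a) \<subseteq> S" by (rule set_tv[OF a assms(2,3)])
    show "fst ` set (tv t (winv p) (winv q) a) \<subseteq> S" by (rule set_tv[OF a]) (simp_all add: assms)
    show "nf (subst (tv t (winv p) (winv q)) (tv t p q a)) = [a]" by (rule *[OF a t])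
    show "nf (subst (tv t p q) (tv t (winv p) (winv q) a)) = [a]"
      using *[OF a, of "winv p" "winv q"] t by simp
  qed
qed

definition flip :: "'a \<Rightarrow> 'a letter \<Rightarrow> 'a letter list" where
  "flip t a = (if fst a = t then [inv_letter a] else [a])"

lemma is_aut_flip: "is_aut S (flip t) (flip t)"
  by (auto simp: is_aut_def letter_hom_def flip_def cancel_cons_def)

text \<open>An automorphism that multiplies the generator by \<open>u\<close> on the right carries a
  standard basis element to the word; composing with the inversion of the generator covers the
  negative exponent.\<close>

lemma prim_single:
  assumes "fst a \<in> S" "u \<in> reduced_words (S - {fst a})"
  shows "prim S (a # u)"
proof -
  obtain x b where a: "a = (x, b)" by (cases a)
  have uS: "fst ` set u \<subseteq> S - {x}" "reduced u" using assms a by (auto simp: reduced_words_def)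
  have xu: "x \<notin> fst ` set u" using uS by auto
  have x: "x \<in> S" using assms a by simp
  have r: "reduced (a # u)"
  proof (cases u)
    case (Cons c v)
    then have "fst c \<noteq> x" using xu by auto
    then have "a \<noteq> inv_letter c" using a by (metis fst_conv fst_inv_letter)
    then show ?thesis unfolding reduced_Cons[of a] using uS(2) Cons by simp
  qed (simp add: reduced_Cons)
  have "prim S [(x, True)]"
    unfolding primitive_elem_def using free_basis_standard[of S] x by blast
  from prim_aut[OF is_aut_tv[of x S "[]" u] this]
  have p1: "prim S (nf ((x, True) # u))" using x uS by (simp add: tv_def)
  show ?thesis
  proof (cases b)
    case True
    then show ?thesis using p1 r a by (simp add: nf_reduced del: nf_simps)
  next
    case False
    have fu: "subst (flip x) u = u" using xu by (induction u) (auto simp: flip_def)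
    have "nf (subst (flip x) (nf ((x, True) # u))) = nf (subst (flip x) ((x, True) # u))"
      using nf_subst_nf[of "flip x"] is_aut_flip[of S x] unfolding is_aut_def by blast
    also have "\<dots> = nf (a # u)" using False a by (simp add: fu flip_def)
    finally show ?thesis using prim_aut[OF is_aut_flip p1] r by (metis nf_reduced)
  qed
qed

text \<open>The Whitehead automorphism with multiplier \<open>v\<close>: a letter in
  \<open>Z\<close> receives \<open>v\<close> on its left, and its inverse accordingly
  \<open>inv_letter v\<close> on the right.\<close>

definition wh :: "'a letter \<Rightarrow> 'a letter set \<Rightarrow> 'a letter \<Rightarrow> 'a letter list" where
  "wh v Z a = (if fst a = fst v then [a] else
     (if a \<in> Z then [v] else []) @ [a] @ (if inv_letter a \<in> Z then [inv_letter v] else []))"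

lemma is_aut_wh:
  assumes "fst v \<in> S"
  shows "is_aut S (wh v Z) (wh (inv_letter v) Z)"
proof -
  have ne: "a \<noteq> v" "a \<noteq> inv_letter v" "v \<noteq> a" "inv_letter v \<noteq> a" if "fst a \<noteq> fst v" for a
    using that by auto
  have "letter_hom (wh v Z)" for v
    unfolding letter_hom_def wh_def by (auto simp: cancel_cons_def)
  moreover have "nf (subst (wh (inv_letter v) Z) (wh v Z a)) = [a]" for v a
    by (auto simp: wh_def cancel_cons_def)
  moreover from this[of "inv_letter v" for v] have "nf (subst (wh v Z) (wh (inv_letter v) Z a)) = [a]" for v a
    by simp
  ultimately show ?thesis unfolding is_aut_def using assms by (auto simp: wh_def)
qed

section \<open>Cyclic junctions and Whitehead automorphisms\<close>

text \<open>A junction \<open>(a, b)\<close> is the edge between \<open>inv_letter a\<close> and \<open>b\<close> of the Whitehead graph.\<close>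

definition junctions :: "'a list \<Rightarrow> ('a \<times> 'a) list" where
  "junctions w = zip w (rotate1 w)"

text \<open>The number of edges of the Whitehead graph between \<open>U\<close> and its complement,
  with multiplicity.\<close>

definition crossings :: "'a letter set \<Rightarrow> 'a letter list \<Rightarrow> nat" where
  "crossings U w = length (filter (\<lambda>(a, b). (inv_letter a \<in> U) \<noteq> (b \<in> U)) (junctions w))"

lemma map_junctions: "map fst (junctions w) = w" "map snd (junctions w) = rotate1 w"
  by (simp_all add: junctions_def)

lemma junctions_in_set: "(a, b) \<in> set (junctions w) \<Longrightarrow> a \<in> set w \<and> b \<in> set w"
  unfolding junctions_def by (metis set_rotate1 set_zip_leftD set_zip_rightD)

lemma junctions_Cons: "junctions (a # x) = zip (a # x) (x @ [a])"
  by (simp add: junctions_def)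

lemma zip_rotate1: "length xs = length ys \<Longrightarrow> zip (rotate1 xs) (rotate1 ys) = rotate1 (zip xs ys)"
  by (cases xs; cases ys) auto

lemma junctions_rotate: "set (junctions (rotate n w)) = set (junctions w)"
proof (induction n)
  case (Suc n)
  then show ?case by (simp add: junctions_def zip_rotate1)
qed simp

lemma mset_rotate1: "mset (rotate1 xs) = mset xs"
  by (cases xs) auto

lemma junction_split:
  assumes "(a, b) \<in> set (junctions w)"
  obtains y z where "w = y @ z" "y \<noteq> []" "last y = a" "hd (z @ y) = b"
proof -
  obtain i where i: "i < length w" "w ! i = a" "rotate1 w ! i = b"
    using assms by (auto simp: junctions_def in_set_zip)
  have ne: "w \<noteq> []" using i by auto
  have "hd (rotate (Suc i) w) = b"
    using i ne by (simp add: hd_rotate_conv_nth nth_rotate1 del: rotate_Suc)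
  moreover have "rotate (Suc i) w = drop (Suc i) w @ take (Suc i) w"
    using i by (cases "Suc i = length w") (auto simp: rotate_drop_take simp del: rotate_Suc)
  ultimately have "hd (drop (Suc i) w @ take (Suc i) w) = b" by simp
  moreover have "last (take (Suc i) w) = a" using i by (simp add: take_Suc_conv_app_nth)
  ultimately show ?thesis using that[of "take (Suc i) w" "drop (Suc i) w"] ne by auto
qed

lemma junction_reduced:
  assumes "cyclically_reduced w" "(a, b) \<in> set (junctions w)"
  shows "b \<noteq> inv_letter a"
proof -
  obtain y z where yz: "w = y @ z" "y \<noteq> []" "last y = a" "hd (z @ y) = b"
    using junction_split[OF assms(2)] .
  then have "cyclically_reduced (z @ y)" using assms cyclically_reduced_append_commute by blast
  then show ?thesis using yz by (auto simp: cyclically_reduced_def)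
qed

lemma filter_fst_snd:
  "length (filter P (map fst xs)) + length (filter (\<lambda>(a, b). \<not> P a \<and> P b) xs)
   = length (filter P (map snd xs)) + length (filter (\<lambda>(a, b). P a \<and> \<not> P b) xs)"
  by (induction xs) auto

lemma junctions_flow:
  "length (filter (\<lambda>(a, b). P a \<and> \<not> P b) (junctions w)) = length (filter (\<lambda>(a, b). \<not> P a \<and> P b) (junctions w))"
proof -
  have "length (filter P (rotate1 w)) = length (filter P w)"
    by (metis mset_rotate1 mset_filter size_mset)
  then show ?thesis using filter_fst_snd[of P "junctions w"] by (simp add: map_junctions)
qed

text \<open>A closed walk leaves a set as often as it enters it. If it never leaves, it never enters
  either and stays on one side.\<close>

lemma junctions_const:
  assumes "\<And>a b. (a, b) \<in> set (junctions w) \<Longrightarrow> P a \<Longrightarrow> P b" "x \<in> set w" "P x" "y \<in> set w"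
  shows "P y"
proof -
  have "filter (\<lambda>(a, b). P a \<and> \<not> P b) (junctions w) = []"
    using assms(1) by (auto simp: filter_empty_conv)
  then have "filter (\<lambda>(a, b). \<not> P a \<and> P b) (junctions w) = []"
    using junctions_flow[of P w] by simp
  then have eq: "P a \<longleftrightarrow> P b" if "(a, b) \<in> set (junctions w)" for a b
    using assms(1) that by (auto simp: filter_empty_conv)
  have *: "P (w ! i) \<longleftrightarrow> P (w ! 0)" if "i < length w" for i
    using that
  proof (induction i)
    case (Suc i)
    have "(w ! i, w ! Suc i) \<in> set (junctions w)"
      using Suc.prems by (auto simp: junctions_def in_set_zip nth_rotate1 intro!: exI[of _ i])
    then show ?case using eq Suc by auto
  qed simp
  then show ?thesis using assms(2-4) by (metis in_set_conv_nth)
qed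

lemma length_filter_disjoint:
  assumes "\<And>x. x \<in> set xs \<Longrightarrow> P x \<longleftrightarrow> Q x \<or> R x" "\<And>x. x \<in> set xs \<Longrightarrow> \<not> (Q x \<and> R x)"
  shows "length (filter P xs) = length (filter Q xs) + length (filter R xs)"
  using assms by (induction xs) auto

text \<open>The edge between \<open>inv_letter a\<close> and \<open>b\<close> may leave
  \<open>Z\<close> only towards \<open>v\<close>. If all junctions satisfy this, \<open>v\<close>
  separates \<open>Z\<close> from the other vertices.\<close>

definition cut_at :: "'a letter \<Rightarrow> 'a letter set \<Rightarrow> 'a letter \<Rightarrow> 'a letter \<Rightarrow> bool" where
  "cut_at v Z a b \<longleftrightarrow> (inv_letter a \<in> Z \<longrightarrow> b \<in> Z \<or> b = v) \<and> (b \<in> Z \<longrightarrow> inv_letter a \<in> Z \<or> inv_letter a = v)"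

text \<open>If the Whitehead graph has the cut vertex \<open>v\<close> with \<open>Z\<close> on one side, then the effect of the
  Whitehead automorphism on a cyclic word is to delete one letter \<open>v\<close> or \<open>inv_letter v\<close>
  for each edge between \<open>v\<close> and \<open>Z\<close>.\<close>

fun del :: "'a letter \<Rightarrow> 'a letter set \<Rightarrow> 'a letter \<Rightarrow> 'a letter list \<Rightarrow> 'a letter \<Rightarrow> 'a letter list" where
  "del v Z p [] q = []"
| "del v Z p (a # u) q =
    (if a = v \<and> inv_letter p \<in> Z \<or> a = inv_letter v \<and> hd (u @ [q]) \<in> Z then [] else [a]) @ del v Z a u q"

text \<open>The potential that makes the automorphism telescope: up to reduction,
  \<open>wh v Z a\<close> is the \<open>gauge\<close> of the preceding junction, then
  \<open>a\<close> or nothing, then the inverse of the \<open>gauge\<close> of the following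
  junction. Along a cyclic word only deletions and one conjugation remain.\<close>

definition gauge :: "'a letter \<Rightarrow> 'a letter set \<Rightarrow> 'a letter \<Rightarrow> 'a letter \<Rightarrow> 'a letter list" where
  "gauge v Z a b = (if inv_letter a \<in> Z \<or> b \<in> Z then [v] else [])"

lemma wh_gauge:
  assumes "v \<notin> Z" "inv_letter v \<notin> Z" "cut_at v Z p a" "cut_at v Z a b"
  shows "nf (wh v Z a @ gauge v Z a b)
    = nf (gauge v Z p a @ (if a = v \<and> inv_letter p \<in> Z \<or> a = inv_letter v \<and> b \<in> Z then [] else [a]))"
proof -
  consider "a = v" | "a = inv_letter v" | "fst a \<noteq> fst v"
    by (cases a; cases v) auto
  then show ?thesis
  proof cases
    case 3
    then have "a \<noteq> v" "a \<noteq> inv_letter v" "inv_letter a \<noteq> v" "inv_letter a \<noteq> inv_letter v"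
      by (metis fst_inv_letter)+
    then have *: "inv_letter p \<in> Z \<longleftrightarrow> a \<in> Z \<and> inv_letter p \<in> Z" "b \<in> Z \<longleftrightarrow> inv_letter a \<in> Z \<and> b \<in> Z"
      using assms unfolding cut_at_def by blast+
    have "wh v Z a = (if a \<in> Z then [v] else []) @ [a] @ (if inv_letter a \<in> Z then [inv_letter v] else [])"
      using 3 by (simp add: wh_def)
    moreover have "gauge v Z a b = (if inv_letter a \<in> Z then [v] else [])"
      using * by (auto simp: gauge_def)
    moreover have "gauge v Z p a = (if a \<in> Z then [v] else [])"
      using * by (auto simp: gauge_def)
    ultimately show ?thesis
      using \<open>a \<noteq> v\<close> \<open>a \<noteq> inv_letter v\<close> nf_inv_letter'[of "[v, a]" v "[]"] nf_inv_letter'[of "[a]" v "[]"]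
      by (simp del: nf_simps)
  next
    case 1
    then have "b \<notin> Z" using assms by (auto simp: cut_at_def)
    then show ?thesis using 1 assms by (auto simp: wh_def gauge_def cancel_cons_def)
  next
    case 2
    then have "inv_letter p \<notin> Z" using assms by (auto simp: cut_at_def)
    then show ?thesis using 2 assms by (auto simp: wh_def gauge_def cancel_cons_def)
  qed
qed

lemma subst_wh_del:
  assumes "v \<notin> Z" "inv_letter v \<notin> Z"
    and "\<And>a b. (a, b) \<in> set (zip (p # u) u) \<Longrightarrow> cut_at v Z a b"
    and "\<And>a b. (a, b) \<in> set (zip u (tl u @ [q])) \<Longrightarrow> cut_at v Z a b"
  shows "nf (subst (wh v Z) u) = nf (gauge v Z p (hd (u @ [q])) @ del v Z p u q @ winv (gauge v Z (last (p # u)) q))"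
  using assms(3,4)
proof (induction u arbitrary: p)
  case Nil
  then show ?case by (simp add: nf_self_winv)
next
  case (Cons a u)
  define b where "b = hd (u @ [q])"
  let ?r = "winv (gauge v Z (last (a # u)) q)"
  have sub: "set (zip u (tl u @ [q])) \<subseteq> set (zip (a # u) (u @ [q]))"
    by (cases u) auto
  have "nf (subst (wh v Z) u) = nf (gauge v Z a b @ del v Z a u q @ ?r)"
    unfolding b_def by (rule Cons.IH) (use Cons.prems sub in auto)
  from nf_cong2[OF refl this, of "wh v Z a"]
  have "nf (subst (wh v Z) (a # u)) = nf ((wh v Z a @ gauge v Z a b) @ del v Z a u q @ ?r)"
    by (simp only: subst_simps append_assoc)
  also have "\<dots> = nf ((gauge v Z p a @ (if a = v \<and> inv_letter p \<in> Z \<or> a = inv_letter v \<and> b \<in> Z then [] else [a]))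
      @ del v Z a u q @ ?r)"
  proof (rule nf_cong2[OF wh_gauge[OF assms(1,2)] refl])
    show "cut_at v Z p a" using Cons.prems(1) by simp
    have "(a, b) \<in> set (zip (a # u) (tl (a # u) @ [q]))" unfolding b_def by (cases u) auto
    then show "cut_at v Z a b" by (rule Cons.prems(2))
  qed
  finally show ?case by (simp add: b_def)
qed

lemma length_del:
  "length (del v Z p u q) + length (filter (\<lambda>(a, b). inv_letter a \<in> Z \<and> b = v) (zip (p # u) u))
    + length (filter (\<lambda>(a, b). a = inv_letter v \<and> b \<in> Z) (zip u (tl u @ [q]))) = length u"
proof (induction u arbitrary: p)
  case (Cons a u)
  have "zip (a # u) (tl (a # u) @ [q]) = (a, hd (u @ [q])) # zip u (tl u @ [q])"
    by (cases u) auto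
  then show ?case using Cons.IH[of a] by auto
qed simp

lemma mset_del: "mset (del v Z p u q) \<subseteq># mset u"
proof (induction u arbitrary: p)
  case (Cons a u)
  from Cons[of a] show ?case by (auto simp: subseteq_mset_def intro: le_SucI)
qed simp

lemma zip_last_junctions:
  assumes "w \<noteq> []"
  shows "mset (zip (last w # w) w) = mset (junctions w)"
proof -
  have "zip (last w # w) w = zip (last w # butlast w) w"
  proof -
    have "last w # w = (last w # butlast w) @ [last w]" using assms by simp
    moreover have "length (last w # butlast w) = length w" using assms by simp
    ultimately show ?thesis using zip_append1[of "last w # butlast w" "[last w]" w] by simp
  qed
  moreover have "rotate1 (zip (last w # butlast w) w) = junctions w"
    using assms zip_rotate1[of "last w # butlast w" w] by (simp add: junctions_def)
  ultimately show ?thesis by (metis mset_rotate1)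
qed

lemma whitehead_shorten:
  assumes "w \<noteq> []" "v \<notin> Z" "inv_letter v \<notin> Z"
    and cut: "\<And>a b. (a, b) \<in> set (junctions w) \<Longrightarrow> cut_at v Z a b"
  defines "w' \<equiv> del v Z (last w) w (hd w)"
  shows "nf (subst (wh v Z) w) = nf (gauge v Z (last w) (hd w) @ w' @ winv (gauge v Z (last w) (hd w)))"
    and "length w' + crossings Z w = length w"
proof -
  \<comment> \<open>Deletions of \<open>v\<close> look at the preceding letter and deletions of its
    inverse at the following one, so the junctions are listed once starting from the last letter and
    once ending in the first.\<close>
  have j1: "mset (zip (last w # w) w) = mset (junctions w)" by (rule zip_last_junctions[OF assms(1)])
  have j2: "zip w (tl w @ [hd w]) = junctions w" using assms(1) by (cases w) (auto simp: junctions_def)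
  have "nf (subst (wh v Z) w) = nf (gauge v Z (last w) (hd (w @ [hd w])) @ w' @ winv (gauge v Z (last (last w # w)) (hd w)))"
    unfolding w'_def by (rule subst_wh_del) (use assms mset_eq_setD[OF j1] j2 in auto)
  then show "nf (subst (wh v Z) w) = nf (gauge v Z (last w) (hd w) @ w' @ winv (gauge v Z (last w) (hd w)))"
    using assms(1) by simp
  have "length (filter P (zip (last w # w) w)) = length (filter P (junctions w))" for P
    using j1 by (metis mset_filter size_mset)
  then have "length w' + (length (filter (\<lambda>(a, b). inv_letter a \<in> Z \<and> b = v) (junctions w))
     + length (filter (\<lambda>(a, b). a = inv_letter v \<and> b \<in> Z) (junctions w))) = length w"
    using length_del[of v Z "last w" w "hd w"] unfolding w'_def j2 by simp
  \<comment> \<open>Every edge leaving \<open>Z\<close> ends in \<open>v\<close>; its two possible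
    orientations are the two kinds of deleted letters.\<close>
  moreover have "crossings Z w = length (filter (\<lambda>(a, b). inv_letter a \<in> Z \<and> b = v) (junctions w))
     + length (filter (\<lambda>(a, b). a = inv_letter v \<and> b \<in> Z) (junctions w))"
    unfolding crossings_def
  proof (rule length_filter_disjoint)
    fix x assume "x \<in> set (junctions w)"
    then show "(case x of (a, b) \<Rightarrow> (inv_letter a \<in> Z) \<noteq> (b \<in> Z)) \<longleftrightarrow>
       (case x of (a, b) \<Rightarrow> inv_letter a \<in> Z \<and> b = v) \<or> (case x of (a, b) \<Rightarrow> a = inv_letter v \<and> b \<in> Z)"
      using cut[of "fst x" "snd x"] assms(2,3) unfolding cut_at_def
      by (cases x) (auto simp flip: inv_letter_eq_iff[of "inv_letter (fst x)" v])
  qed (use assms in auto)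
  ultimately show "length w' + crossings Z w = length w" by simp
qed

text \<open>The representative \<open>w'\<close> is left open: for words with two adjacent
  occurrences of \<open>t\<close> a particular one is chosen later, so as to keep these occurrences
  in place.\<close>

lemma whitehead_shorten_class:
  assumes "w \<in> reduced_words S" "prim S w" "w \<noteq> []" "fst v \<in> S" "v \<notin> Z" "inv_letter v \<notin> Z"
    and cut: "\<And>a b. (a, b) \<in> set (junctions w) \<Longrightarrow> cut_at v Z a b"
    and w': "w' \<in> reduced_words S"
      "cls S w' = cls S (nf (del v Z (last w) w (hd w)))"
  shows "prim S w'" "cls S w = act (wh (inv_letter v) Z) (cls S w')"
proof -
  let ?u = "del v Z (last w) w (hd w)" and ?g = "gauge v Z (last w) (hd w)"
  have aut: "is_aut S (wh v Z) (wh (inv_letter v) Z)" by (rule is_aut_wh[OF assms(4)])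
  have uS: "fst ` set ?u \<subseteq> S"
    using mset_subset_set[OF mset_del[of v Z "last w" w "hd w"]] assms(1) by (auto simp: reduced_words_def)
  have gS: "fst ` set ?g \<subseteq> S" using assms(4) by (auto simp: gauge_def)
  have "cls S (nf (subst (wh v Z) w)) = cls S (nf ?u)"
  proof -
    have "nf (subst (wh v Z) w) = nf (?g @ ?u @ winv ?g)"
      by (rule whitehead_shorten(1)[OF assms(3,5,6)]) (rule cut)
    then show ?thesis using conj_class_nf_conj[OF uS gS] by simp
  qed
  then have c: "cls S w' = act (wh v Z) (cls S w)"
    using act_conj_class[OF aut assms(1)] w' by simp
  show "cls S w = act (wh (inv_letter v) Z) (cls S w')"
    unfolding c by (rule act_inverse[OF aut conj_class_subset[OF assms(1)], symmetric])
  have "prim S (nf (subst (wh v Z) w))" by (rule prim_aut[OF aut assms(2)])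
  moreover have "w' \<in> cls S (nf (subst (wh v Z) w))"
    using c conj_class_refl[OF w'(1)] act_conj_class[OF aut assms(1)] by simp
  ultimately show "prim S w'" using prim_conj is_aut_reduced_words[OF aut assms(1)] by blast
qed

lemma whitehead_descent:
  assumes "w \<in> reduced_words S" "prim S w" "w \<noteq> []" "fst v \<in> S" "v \<notin> Z" "inv_letter v \<notin> Z"
    and cut: "\<And>a b. (a, b) \<in> set (junctions w) \<Longrightarrow> cut_at v Z a b"
  obtains w' where "w' \<in> reduced_words S" "cyclically_reduced w'" "prim S w'"
    "mset w' \<subseteq># mset w" "length w' + crossings Z w \<le> length w"
    "cls S w = act (wh (inv_letter v) Z) (cls S w')"
proof -
  let ?u = "del v Z (last w) w (hd w)"
  have uS: "fst ` set ?u \<subseteq> S"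
    using mset_subset_set[OF mset_del[of v Z "last w" w "hd w"]] assms(1) by (auto simp: reduced_words_def)
  obtain w' where w': "w' \<in> reduced_words S" "cyclically_reduced w'" "mset w' \<subseteq># mset ?u"
    "cls S w' = cls S (nf ?u)"
    using cyclic_reduction_class[OF uS] by metis
  note c = whitehead_shorten_class[OF assms w'(1,4)]
  have "mset w' \<subseteq># mset w" using w'(3) mset_del subset_mset.order_trans by blast
  moreover have "length w' + crossings Z w \<le> length w"
    using whitehead_shorten(2)[OF assms(3,5,6) cut] mset_subset_length[OF w'(3)] by simp
  ultimately show ?thesis using that w' c by blast
qed

section \<open>Whitehead's cut vertex lemma\<close>

lemma nf_snoc:
  assumes "reduced u"
  shows "nf (u @ [b]) = (if u \<noteq> [] \<and> last u = inv_letter b then butlast u else u @ [b])"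
proof (cases "u \<noteq> [] \<and> last u = inv_letter b")
  case True
  then obtain v where v: "u = v @ [inv_letter b]" by (metis append_butlast_last_id)
  then have "nf (u @ [b]) = nf v" using nf_inv_letter'[of v b "[]"] by simp
  moreover have "reduced v" using assms v by (simp add: reduced_append)
  ultimately show ?thesis using v by (simp add: nf_reduced)
next
  case False
  then have "reduced (u @ [b])" using assms by (auto simp: reduced_append reduced_Cons)
  then show ?thesis using False by (auto simp: nf_reduced)
qed

lemma nf_left_cancel: "nf (u @ x) = nf (u @ y) \<Longrightarrow> nf x = nf y"
proof -
  assume "nf (u @ x) = nf (u @ y)"
  then have "nf (winv u @ u @ x) = nf (winv u @ u @ y)" by (rule nf_cong2[OF refl])
  then show ?thesis using nf_cancel(1)[of "[]" u x] nf_cancel(1)[of "[]" u y] by simp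
qed

lemma nf_right_cancel: "nf (x @ u) = nf (y @ u) \<Longrightarrow> nf x = nf y"
proof -
  assume "nf (x @ u) = nf (y @ u)"
  then have "nf ((x @ u) @ winv u) = nf ((y @ u) @ winv u)" by (rule nf_cong2) simp
  then show ?thesis using nf_cancel(2)[of x u "[]"] nf_cancel(2)[of y u "[]"] by simp
qed

lemma nf_letter_commute:
  assumes "set p \<subseteq> {a, inv_letter a}"
  shows "nf (a # p) = nf (p @ [a])"
  using assms
proof (induction p)
  case (Cons b p)
  then have IH: "nf (a # p) = nf (p @ [a])" by simp
  consider "b = a" | "b = inv_letter a" using Cons.prems by auto
  then show ?case
  proof cases
    case 1
    then show ?thesis using nf_cong2[OF refl IH, of "[a]"] by simp
  next
    case 2
    have "nf (b # p @ [a]) = nf (b # a # p)" using nf_cong2[OF refl IH, of "[b]"] by simp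
    then show ?thesis
      using nf_inv_letter[of "[]" a p] nf_inv_letter'[of "[]" a p] 2 by (simp del: nf_simps)
  qed
qed simp

text \<open>Powers of one generator commute. Below this prevents the whole subgroup on two or more
  generators from consisting of powers of \<open>w\<close>.\<close>

lemma nf_power_commute:
  assumes "fst ` set p \<subseteq> {x}" "fst ` set q \<subseteq> {x}"
  shows "nf (p @ q) = nf (q @ p)"
  using assms(1)
proof (induction p)
  case (Cons b p)
  have "set q \<subseteq> {b, inv_letter b}"
  proof
    fix c assume "c \<in> set q"
    then have "fst c = fst b" using assms(2) Cons.prems by auto
    then show "c \<in> {b, inv_letter b}" by (cases b; cases c) auto
  qed
  from nf_letter_commute[OF this] have "nf (b # q) = nf (q @ [b])" .
  from nf_cong2[OF this refl, of p] have *: "nf (b # q @ p) = nf (q @ b # p)" by simp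
  have "nf (p @ q) = nf (q @ p)" using Cons by auto
  from nf_cong2[OF refl this, of "[b]"] show ?case using * by simp
qed simp

text \<open>Right multiplication by a letter acts at the end of a reduced word. It can affect the
  first letter only in the two exceptional words, and there only \<open>b\<close> appears or its
  inverse vanishes.\<close>

lemma start_snoc:
  assumes "reduced u" "u \<notin> {[], [inv_letter b]} \<or> c \<noteq> b \<and> c \<noteq> inv_letter b"
  shows "(nf (u @ [b]) \<noteq> [] \<and> hd (nf (u @ [b])) = c) \<longleftrightarrow> (u \<noteq> [] \<and> hd u = c)"
  unfolding nf_snoc[OF assms(1)] using assms(2)
  by (cases u rule: rev_cases; cases "butlast u") auto

text \<open>Induction on \<open>q\<close>: each further letter adds two exceptional words, and the
  exceptions for the remaining letters are pulled back along an injective map.\<close>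

lemma finite_start_change:
  "finite {u \<in> reduced_words B. (nf (u @ q) \<noteq> [] \<and> hd (nf (u @ q)) = c) \<noteq> (u \<noteq> [] \<and> hd u = c)}"
  if "fst ` set q \<subseteq> B"
  using that
proof (induction q)
  case Nil
  show ?case by (rule finite_subset[of _ "{}"]) (auto simp: reduced_words_def nf_reduced)
next
  case (Cons b q)
  let ?P = "\<lambda>u. u \<noteq> [] \<and> hd u = c"
  let ?f = "\<lambda>u. nf (u @ [b])"
  let ?X = "{u \<in> reduced_words B. ?P (nf (u @ q)) \<noteq> ?P u}"
  have IH: "finite ?X" using Cons by simp
  have "inj_on ?f (reduced_words B)"
    by (rule inj_onI) (metis nf_right_cancel nf_reduced reduced_wordsD(1))
  then have "finite {u \<in> reduced_words B. ?f u \<in> ?X}"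
    using finite_vimage_IntI[OF IH, of ?f "reduced_words B"] by (auto simp: vimage_def Collect_conj_eq Int_commute elim!: finite_subset[rotated])
  moreover have "finite {[], [inv_letter b]}" by simp
  moreover have "{u \<in> reduced_words B. ?P (nf (u @ b # q)) \<noteq> ?P u}
      \<subseteq> {u \<in> reduced_words B. ?f u \<in> ?X} \<union> {[], [inv_letter b]}"
  proof
    fix u assume u: "u \<in> {u \<in> reduced_words B. ?P (nf (u @ b # q)) \<noteq> ?P u}"
    show "u \<in> {u \<in> reduced_words B. ?f u \<in> ?X} \<union> {[], [inv_letter b]}"
    proof (cases "u \<in> {[], [inv_letter b]}")
      case False
      have ru: "reduced u" "u \<in> reduced_words B" using u by (auto simp: reduced_words_def)
      have fu: "?f u \<in> reduced_words B"
        using ru Cons.prems by (intro nf_in_reduced_words) (auto simp: reduced_words_def)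
      have "?P (?f u) \<longleftrightarrow> ?P u" using ru(1) False by (intro start_snoc) auto
      moreover have "nf (?f u @ q) = nf (u @ b # q)"
        by (simp add: nf_append_nf)
      ultimately show ?thesis using u fu by auto
    next
      case True
      then show ?thesis by blast
    qed
  qed
  ultimately show ?case by (meson finite_UnI finite_subset)
qed

text \<open>The set is constructed relative to the subgroup on \<open>S'\<close>, so that a
  primitive word that avoids a generator can be studied on the letters that remain. Membership is
  read off from the expansion in a basis containing \<open>w\<close>.\<close>

lemma primitive_separating_set:
  assumes "prim S w" "w \<in> reduced_words S'" "S' \<subseteq> S" "x \<in> S'" "y \<in> S'" "x \<noteq> y"
  shows "\<exists>A. (\<forall>g\<in>reduced_words S'. nf (g @ w) \<in> A \<longleftrightarrow> g \<in> A)
    \<and> (\<forall>a. fst a \<in> S' \<longrightarrow> finite {g \<in> reduced_words S'. (nf (g @ [a]) \<in> A) \<noteq> (g \<in> A)})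
    \<and> infinite (A \<inter> reduced_words S') \<and> infinite (reduced_words S' - A)"
proof -
  let ?G = "free_group S"
  obtain B where B: "free_basis ?G B" "w \<in> B" using assms by (auto simp: primitive_elem_def)
  have iso: "word_eval ?G \<in> iso (free_group B) ?G" and BS: "B \<subseteq> reduced_words S"
    using B by (auto simp: free_basis_def)
  define e where "e = inv_into (reduced_words B) (word_eval ?G)"
  have eiso: "e \<in> iso ?G (free_group B)"
    using group.iso_set_sym[OF group_free_group iso] by (simp add: e_def)
  have sub: "reduced_words S' \<subseteq> reduced_words S" using assms(3) by (auto simp: reduced_words_def)
  have eB: "e g \<in> reduced_words B" if "g \<in> reduced_words S" for g
    using eiso that by (auto simp: iso_def hom_def)
  have einj: "inj_on e (reduced_words S)" using eiso by (auto simp: iso_def bij_betw_def)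
  have ehom: "e (nf (g @ h)) = nf (e g @ e h)" if "g \<in> reduced_words S" "h \<in> reduced_words S" for g h
    using eiso that eB by (auto simp: iso_def hom_def mult_free_group[of _ S] mult_free_group[of _ B])
  have ev: "e (word_eval ?G u) = u" if "u \<in> reduced_words B" for u
    unfolding e_def using iso that by (intro inv_into_f_f) (auto simp: iso_def bij_betw_def)
  have cl: "nf (g @ h) \<in> reduced_words T" if "g \<in> reduced_words T" "h \<in> reduced_words T" for g h :: "'a letter list" and T
    using that by (intro nf_in_reduced_words) (auto simp: reduced_words_def)
  have wS: "w \<in> reduced_words S" using assms sub by auto
  let ?w = "(w, True)"
  have ew: "e w = [?w]"
  proof -
    have "word_eval ?G [?w] = w" using wS by (simp add: word_eval_def mult_free_group[of "[]" S] reduced_words_def nf_reduced)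
    moreover have "[?w] \<in> reduced_words B" using B(2) by (simp add: reduced_words_def reduced_Cons)
    ultimately show ?thesis using ev by metis
  qed
  have pow: "word_eval ?G p \<in> reduced_words S'" if "fst ` set p \<subseteq> {w}" for p
    using that
  proof (induction p)
    case (Cons a p)
    have "inv\<^bsub>?G\<^esub> w = winv w" by (rule inv_free_group[OF wS])
    then show ?case using Cons assms(2) cl[of _ S'] winv_in_reduced_words[OF assms(2)]
      by (auto simp: word_eval_def mult_free_group)
  qed (simp add: word_eval_def reduced_words_def)
  have nil: "e [] = []" using ev[of "[]"] by (simp add: word_eval_def reduced_words_def)
  have einv: "e (winv g) = winv (e g)" if g: "g \<in> reduced_words S" for g
  proof -
    have "nf (e (winv g) @ e g) = []"
      using ehom[OF winv_in_reduced_words[OF g] g] nil by (simp add: nf_winv_self)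
    from nf_eq_winvI[OF this] show ?thesis
      using eB[OF g] eB[OF winv_in_reduced_words[OF g]] by (simp add: nf_reduced reduced_words_def reduced_winv)
  qed
  have single: "[a] \<in> reduced_words T" if "fst a \<in> T" for a :: "'a letter" and T
    using that by (simp add: reduced_words_def reduced_Cons)
  \<comment> \<open>Otherwise all expansions would be powers of \<open>w\<close>, and the distinct
    generators \<open>x\<close> and \<open>y\<close> would commute.\<close>
  have "\<exists>h\<in>reduced_words S'. \<not> fst ` set (e h) \<subseteq> {w}"
  proof (rule ccontr)
    assume "\<not> ?thesis"
    then have *: "fst ` set (e h) \<subseteq> {w}" if "h \<in> reduced_words S'" for h using that by blast
    let ?x = "[(x, True)]" and ?y = "[(y, True)]"
    have xy: "?x \<in> reduced_words S'" "?y \<in> reduced_words S'" using assms single by auto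
    then have "nf (e ?x @ e ?y) = nf (e ?y @ e ?x)" by (intro nf_power_commute[OF *[OF xy(1)] *[OF xy(2)]])
    then have "e (nf (?x @ ?y)) = e (nf (?y @ ?x))" 
      by (simp only: ehom[OF subsetD[OF sub xy(1)] subsetD[OF sub xy(2)]]
        ehom[OF subsetD[OF sub xy(2)] subsetD[OF sub xy(1)]])
    then have "nf (?x @ ?y) = nf (?y @ ?x)"
      using einj cl[OF xy] cl[OF xy(2,1)] sub by (meson inj_onD subsetD)
    then show False using assms(6) by (auto simp: cancel_cons_def inv_letter_def)
  qed
  then obtain h where h: "h \<in> reduced_words S'" "\<not> fst ` set (e h) \<subseteq> {w}" by blast
  then obtain d where d: "d \<in> set (e h)" "fst d \<noteq> w" by auto
  then obtain p c r where split: "e h = p @ c # r" "fst c \<noteq> w" "\<forall>a\<in>set p. \<not> fst a \<noteq> w"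
    using split_list_first_prop[of "e h" "\<lambda>a. fst a \<noteq> w"] by blast
  have hS: "h \<in> reduced_words S" using h sub by auto
  have pB: "p \<in> reduced_words B" "reduced (c # r)"
    using eB[OF hS] split by (auto simp: reduced_words_def reduced_append)
  define z where "z = word_eval ?G p"
  have z: "z \<in> reduced_words S'" "e z = p" using pow[of p] split ev[OF pB(1)] by (auto simp: z_def)
  \<comment> \<open>Dividing by the initial power of \<open>w\<close> stays in the subgroup on
    \<open>S'\<close>, since \<open>w\<close> lies in it, and leaves an element whose expansion
    starts with \<open>c\<close>.\<close>
  define h' where "h' = nf (winv z @ h)"
  have h': "h' \<in> reduced_words S'" unfolding h'_def using cl winv_in_reduced_words z(1) h(1) by blast
  have eh': "e h' = c # r"
  proof -
    have "e h' = nf (winv p @ p @ c # r)"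
      unfolding h'_def using ehom[of "winv z" h] einv z winv_in_reduced_words[OF z(1)] hS sub split(1)
      by (metis subsetD)
    then show ?thesis using nf_cancel(1)[of "[]" p "c # r"] pB(2) by (simp add: nf_reduced del: nf_simps)
  qed
  define A where "A = {g. e g \<noteq> [] \<and> hd (e g) = c}"
  have cw: "c \<noteq> (w, b)" for b using split(2) by auto
  \<comment> \<open>Appending \<open>w\<close> to an expansion can create or cancel only
    \<open>w\<close> or its inverse as first letter, and \<open>c\<close> is neither.\<close>
  have A1: "nf (g @ w) \<in> A \<longleftrightarrow> g \<in> A" if g: "g \<in> reduced_words S'" for g
  proof -
    have gS: "g \<in> reduced_words S" using g sub by auto
    have r: "reduced (e g)" using eB[OF gS] by (simp add: reduced_words_def)
    have "e (nf (g @ w)) = nf (e g @ [?w])" using ehom[OF gS wS] ew by simp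
    then show ?thesis using start_snoc[OF r, of ?w c] cw by (simp add: A_def del: nf_simps)
  qed
  have A2: "finite {g \<in> reduced_words S'. (nf (g @ [a]) \<in> A) \<noteq> (g \<in> A)}" if a: "fst a \<in> S'" for a
  proof -
    have aS: "[a] \<in> reduced_words S" using single[of a S] a assms(3) by blast
    let ?X = "{u \<in> reduced_words B. (nf (u @ e [a]) \<noteq> [] \<and> hd (nf (u @ e [a])) = c) \<noteq> (u \<noteq> [] \<and> hd u = c)}"
    have "finite ?X" using eB[OF aS] by (intro finite_start_change) (auto simp: reduced_words_def)
    moreover have "e ` {g \<in> reduced_words S'. (nf (g @ [a]) \<in> A) \<noteq> (g \<in> A)} \<subseteq> ?X"
    proof
      fix u assume "u \<in> e ` {g \<in> reduced_words S'. (nf (g @ [a]) \<in> A) \<noteq> (g \<in> A)}"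
      then obtain g where g: "g \<in> reduced_words S'" "(nf (g @ [a]) \<in> A) \<noteq> (g \<in> A)" "u = e g" by blast
      then show "u \<in> ?X" using ehom[of g "[a]"] aS sub eB[of g] unfolding A_def by auto
    qed
    ultimately have "finite (e ` {g \<in> reduced_words S'. (nf (g @ [a]) \<in> A) \<noteq> (g \<in> A)})"
      by (rule rev_finite_subset)
    moreover have "inj_on e {g \<in> reduced_words S'. (nf (g @ [a]) \<in> A) \<noteq> (g \<in> A)}"
      using einj sub by (auto intro: inj_on_subset)
    ultimately show ?thesis by (rule finite_imageD)
  qed
  \<comment> \<open>Right multiplication by \<open>w\<close> has infinite orbits. The orbit of
    \<open>h'\<close> lies inside \<open>A\<close> and the orbit of the identity outside.\<close>
  have orbit: "infinite (range (\<lambda>n. ((\<lambda>g. nf (g @ w)) ^^ n) h)) \<and>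
      (\<forall>n. ((\<lambda>g. nf (g @ w)) ^^ n) h \<in> reduced_words S' \<and> (((\<lambda>g. nf (g @ w)) ^^ n) h \<in> A \<longleftrightarrow> h \<in> A))"
    if h: "h \<in> reduced_words S'" for h
  proof -
    let ?f = "\<lambda>n. ((\<lambda>g. nf (g @ w)) ^^ n) h"
    have f: "?f n \<in> reduced_words S' \<and> (?f n \<in> A \<longleftrightarrow> h \<in> A) \<and> e (?f n) = nf (e h @ replicate n ?w)" for n
    proof (induction n)
      case 0
      have "reduced (e h)" using eB[of h] h sub by (auto simp: reduced_words_def)
      then show ?case using h by (simp add: nf_reduced)
    next
      case (Suc n)
      have "e (?f (Suc n)) = nf (e (?f n) @ [?w])"
        using ehom[OF _ wS, of "?f n"] Suc sub ew by auto
      also have "\<dots> = nf (e h @ replicate (Suc n) ?w)"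
        using Suc by (simp add: nf_append_nf replicate_append_same)
      finally show ?case using Suc cl[OF _ assms(2)] A1 by auto
    qed
    have "inj ?f"
    proof (rule injI)
      fix n m assume "?f n = ?f m"
      then have "nf (e h @ replicate n ?w) = nf (e h @ replicate m ?w)" using f by metis
      then have "nf (replicate n ?w) = nf (replicate m ?w)" by (rule nf_left_cancel)
      moreover have "nf (replicate n ?w) = replicate n ?w" for n
        by (rule nf_reduced, induction n) (auto simp: reduced_Cons)
      ultimately show "n = m" by (metis length_replicate)
    qed
    then show ?thesis using f range_inj_infinite by blast
  qed
  have "h' \<in> A" "[] \<notin> A" using eh' nil by (auto simp: A_def)
  moreover have "[] \<in> reduced_words S'" by (simp add: reduced_words_def)
  ultimately have "infinite (A \<inter> reduced_words S')" "infinite (reduced_words S' - A)"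
    using orbit[OF h'] orbit[of "[]"] by (meson Int_iff finite_subset image_subsetI, meson Diff_iff finite_subset image_subsetI)
  then show ?thesis using A1 A2 by blast
qed

section \<open>Propagation along the axes of \<open>w\<close> in the Cayley tree\<close>

lemma reduced_power:
  assumes "cyclically_reduced u"
  shows "reduced (concat (replicate m u))"
proof (induction m)
  case (Suc m)
  have "hd (concat (replicate m u)) = hd u" if "concat (replicate m u) \<noteq> []"
    using that by (cases m) auto
  then show ?case
    using Suc assms by (auto simp: reduced_append cyclically_reduced_def)
qed simp

lemma cyclically_reduced_winv:
  assumes "cyclically_reduced u"
  shows "cyclically_reduced (winv u)"
proof (cases "u = []")
  case False
  then have "hd (winv u) = inv_letter (last u)" "last (winv u) = inv_letter (hd u)"
    by (auto simp: winv_def hd_rev last_rev hd_map last_map)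
  then show ?thesis using assms False
    by (auto simp: cyclically_reduced_def reduced_winv)
qed simp

lemma append_power: "y @ concat (replicate m (z @ y)) = concat (replicate m (y @ z)) @ y"
  by (induction m) auto

lemma hd_power: "m > 0 \<Longrightarrow> u \<noteq> [] \<Longrightarrow> hd (concat (replicate m u)) = hd u"
  by (cases m) auto

lemma finite_reduced_words_length: "finite S \<Longrightarrow> finite {u \<in> reduced_words S. length u \<le> n}"
  by (rule finite_subset[OF _ finite_lists_length_le[of "S \<times> UNIV" n]]) (auto simp: reduced_words_def)

lemma two_elements:
  assumes "2 \<le> card S"
  obtains x y where "x \<in> S" "y \<in> S" "x \<noteq> y"
proof -
  obtain T where "T \<subseteq> S" "card T = 2" using obtain_subset_with_card_n[OF assms] by blast
  then show ?thesis using that by (auto simp: card_2_iff)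
qed

theorem whitehead_cut_vertex:
  assumes S': "finite S'" "S' \<subseteq> S" "x \<in> S'" "y \<in> S'" "x \<noteq> y"
    and w: "prim S w" "w \<in> reduced_words S'" "cyclically_reduced w"
  obtains v Z where "fst v \<in> S'" "Z \<noteq> {}" "Z \<subseteq> S' \<times> UNIV" "v \<notin> Z" "inv_letter v \<notin> Z"
    "\<And>a b. (a, b) \<in> set (junctions w) \<Longrightarrow> cut_at v Z a b"
proof (rule ccontr)
  note obt = that
  assume "\<not> thesis"
  then have H: "\<exists>a b. (a, b) \<in> set (junctions w) \<and> \<not> cut_at v Z a b"
    if "fst v \<in> S'" "Z \<noteq> {}" "Z \<subseteq> S' \<times> UNIV" "v \<notin> Z" "inv_letter v \<notin> Z" for v Z
    using that obt[of v Z] by blast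
  let ?L = "S' \<times> (UNIV :: bool set)"
  have jL: "inv_letter a \<in> ?L \<and> b \<in> ?L" if "(a, b) \<in> set (junctions w)" for a b
    using junctions_in_set[OF that] w(2) by (force simp: reduced_words_def mem_Times_iff)
  \<comment> \<open>A nontrivial union of components of the graph without \<open>e\<close> would
    exhibit \<open>e\<close> as a cut vertex. The set cut off has to avoid
    \<open>inv_letter e\<close>, so the complement is used when \<open>U\<close> contains that
    letter.\<close>
  have closed: "U = {} \<or> U = ?L - {e}"
    if e: "e \<in> ?L" and U: "U \<subseteq> ?L - {e}"
      and cl: "\<And>a b. (a, b) \<in> set (junctions w) \<Longrightarrow> inv_letter a \<noteq> e \<Longrightarrow> b \<noteq> e \<Longrightarrow> inv_letter a \<in> U \<longleftrightarrow> b \<in> U"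
    for e U
  proof (cases "inv_letter e \<in> U")
    case False
    have "U = {}"
    proof (rule ccontr)
      assume "U \<noteq> {}"
      have "\<exists>a b. (a, b) \<in> set (junctions w) \<and> \<not> cut_at e U a b"
        by (rule H) (use \<open>U \<noteq> {}\<close> False U e in \<open>auto simp: mem_Times_iff\<close>)
      then obtain a b where ab: "(a, b) \<in> set (junctions w)" "\<not> cut_at e U a b" by blast
      then show False using cl[OF ab(1)] U unfolding cut_at_def by blast
    qed
    then show ?thesis by simp
  next
    case True
    have "?L - {e} - U = {}"
    proof (rule ccontr)
      assume "?L - {e} - U \<noteq> {}"
      have "\<exists>a b. (a, b) \<in> set (junctions w) \<and> \<not> cut_at e (?L - {e} - U) a b"
        by (rule H) (use \<open>?L - {e} - U \<noteq> {}\<close> True U e in \<open>auto simp: mem_Times_iff\<close>)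
      then obtain a b where ab: "(a, b) \<in> set (junctions w)" "\<not> cut_at e (?L - {e} - U) a b" by blast
      then show False using cl[OF ab(1)] jL[OF ab(1)] unfolding cut_at_def by blast
    qed
    then show ?thesis using U by blast
  qed
  obtain A where A: "\<And>g. g \<in> reduced_words S' \<Longrightarrow> nf (g @ w) \<in> A \<longleftrightarrow> g \<in> A"
    "\<And>a. fst a \<in> S' \<Longrightarrow> finite {g \<in> reduced_words S'. (nf (g @ [a]) \<in> A) \<noteq> (g \<in> A)}"
    "infinite (A \<inter> reduced_words S')" "infinite (reduced_words S' - A)"
    using primitive_separating_set[OF w(1,2) S'(2-5)] by blast
  have clos: "nf (g @ h) \<in> reduced_words S'" if "g \<in> reduced_words S'" "fst ` set h \<subseteq> S'" for g h
    using that by (intro nf_in_reduced_words) (auto simp: reduced_words_def)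
  have wset: "fst ` set w \<subseteq> S'" "fst ` set (winv w) \<subseteq> S'"
    using reduced_wordsD(2)[OF w(2)] by simp_all
  have A_pow: "nf (g @ concat (replicate m w)) \<in> A \<longleftrightarrow> g \<in> A"
    and A_pow': "nf (g @ concat (replicate m (winv w))) \<in> A \<longleftrightarrow> g \<in> A"
    if g: "g \<in> reduced_words S'" for g m
  proof -
    have A': "nf (g @ winv w) \<in> A \<longleftrightarrow> g \<in> A" if "g \<in> reduced_words S'" for g
    proof -
      have "nf (nf (g @ winv w) @ w) = g"
        using nf_cancel(1)[of g w "[]"] that by (simp add: nf_append_nf nf_reduced reduced_words_def)
      then show ?thesis using A(1)[OF clos[OF that wset(2)]] by simp
    qed
    have gen: "nf (g @ concat (replicate m v)) \<in> A \<longleftrightarrow> g \<in> A"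
      if "g \<in> reduced_words S'" "fst ` set v \<subseteq> S'" "\<And>g. g \<in> reduced_words S' \<Longrightarrow> nf (g @ v) \<in> A \<longleftrightarrow> g \<in> A" for g v
      using that(1)
    proof (induction m arbitrary: g)
      case 0
      then show ?case by (simp add: nf_reduced reduced_words_def)
    next
      case (Suc m)
      have "nf (g @ concat (replicate (Suc m) v)) = nf (nf (g @ v) @ concat (replicate m v))"
        by (simp add: nf_append_nf)
      then show ?case using Suc.IH[OF clos[OF Suc.prems that(2)]] that(3)[OF Suc.prems] by simp
    qed
    show "nf (g @ concat (replicate m w)) \<in> A \<longleftrightarrow> g \<in> A" by (rule gen[OF g wset(1) A(1)])
    show "nf (g @ concat (replicate m (winv w))) \<in> A \<longleftrightarrow> g \<in> A" by (rule gen[OF g wset(2) A'])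
  qed
  define F where "F = (\<Union>a\<in>?L. {g \<in> reduced_words S'. (nf (g @ [a]) \<in> A) \<noteq> (g \<in> A)})"
  have "finite F" unfolding F_def using S'(1) A(2) by (intro finite_UN_I) auto
  \<comment> \<open>Every element of the coboundary \<open>F\<close> is shorter than
    \<open>N\<close>, so beyond this length membership in \<open>A\<close> is constant along edges
    of the tree.\<close>
  define N where "N = Suc (Max (insert 0 (length ` F)))"
  have stable: "nf (g @ [a]) \<in> A \<longleftrightarrow> g \<in> A" if "g \<in> reduced_words S'" "N \<le> length g" "fst a \<in> S'" for g a
  proof (rule ccontr)
    assume "\<not> ?thesis"
    moreover have "a \<in> ?L" using that(3) by (simp add: mem_Times_iff)
    ultimately have "g \<in> F" unfolding F_def using that(1) by blast
    then have "length g \<le> Max (insert 0 (length ` F))" using \<open>finite F\<close> by (intro Max_ge) auto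
    then show False using that(2) by (simp add: N_def)
  qed
  have stable1: "nf (h @ y) \<in> A \<longleftrightarrow> h \<in> A"
    if "h \<in> reduced_words S'" "N + length y \<le> length h" "fst ` set y \<subseteq> S'" for h y
    using that
  proof (induction y arbitrary: h)
    case Nil
    then show ?case by (simp add: nf_reduced reduced_words_def)
  next
    case (Cons a y)
    have r: "reduced h" using Cons.prems by (simp add: reduced_words_def)
    have "length h \<le> Suc (length (nf (h @ [a])))" by (auto simp: nf_snoc[OF r])
    then have "nf (nf (h @ [a]) @ y) \<in> A \<longleftrightarrow> nf (h @ [a]) \<in> A"
      using Cons.prems clos[of h "[a]"] by (intro Cons.IH) auto
    moreover have "nf (h @ [a]) \<in> A \<longleftrightarrow> h \<in> A" using Cons.prems by (intro stable) auto
    ultimately show ?case by (simp add: nf_append_nf)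
  qed
  have stable2: "g @ y \<in> A \<longleftrightarrow> g \<in> A" if "g @ y \<in> reduced_words S'" "N \<le> length g" for g y
    using that
  proof (induction y rule: rev_induct)
    case (snoc a y)
    have *: "g @ y \<in> reduced_words S'" "fst a \<in> S'"
      using snoc.prems reduced_append[of "g @ y" "[a]"] by (auto simp: reduced_words_def)
    have "nf ((g @ y) @ [a]) = g @ y @ [a]" using snoc.prems by (simp add: nf_reduced reduced_words_def)
    then show ?case using stable[of "g @ y" a] * snoc by simp
  qed simp
  \<comment> \<open>Long words with a common prefix of length \<open>n\<close> agree about
    \<open>A\<close>. Stability gives this for \<open>n = N\<close>, and it is pushed down to the
    empty prefix, where it contradicts that \<open>A\<close> and its complement are both
    infinite.\<close>
  let ?P = "\<lambda>n. \<forall>g\<in>reduced_words S'. length g = n \<longrightarrow> (\<forall>y1 y2. g @ y1 \<in> reduced_words S' \<longrightarrow> g @ y2 \<in> reduced_words S'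
    \<longrightarrow> N \<le> length (g @ y1) \<longrightarrow> N \<le> length (g @ y2) \<longrightarrow> (g @ y1 \<in> A \<longleftrightarrow> g @ y2 \<in> A))"
  have "?P 0"
  proof (rule inc_induct[of 0 N])
    show "?P N" using stable2 by auto
  next
    fix n assume n: "n < N" and PS: "?P (Suc n)"
    show "?P n"
    proof (intro ballI impI allI)
      fix g y1 y2
      assume g: "g \<in> reduced_words S'" "length g = n"
        and y: "g @ y1 \<in> reduced_words S'" "g @ y2 \<in> reduced_words S'"
          "N \<le> length (g @ y1)" "N \<le> length (g @ y2)"
      define D where "D = {b \<in> ?L. reduced (g @ [b])}"
      \<comment> \<open>By the induction hypothesis the status of a long word depends only on the
        letter after \<open>g\<close>; repeating that letter gives a word to test it on.\<close>
      define \<chi> where "\<chi> b \<longleftrightarrow> g @ replicate N b \<in> A" for b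
      have Npos: "N > 0" by (simp add: N_def)
      have \<chi>: "g @ b # z \<in> A \<longleftrightarrow> \<chi> b" if "g @ b # z \<in> reduced_words S'" "N \<le> length (g @ b # z)" for b z
      proof -
        have r: "reduced (g @ b # z)" "fst ` set (g @ b # z) \<subseteq> S'" using that by (auto simp: reduced_words_def)
        have "reduced (replicate m b)" for m by (induction m) (auto simp: reduced_Cons)
        then have "reduced (g @ b # replicate (N - 1) b)" using r(1)
          by (auto simp: reduced_append reduced_Cons)
        then have "(g @ [b]) @ replicate (N - 1) b \<in> reduced_words S'"
          using r(2) by (auto simp: reduced_words_def)
        moreover have "g @ [b] \<in> reduced_words S'" using r by (auto simp: reduced_words_def reduced_append reduced_Cons)
        ultimately have "(g @ [b]) @ z \<in> A \<longleftrightarrow> (g @ [b]) @ replicate (N - 1) b \<in> A"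
          using PS[rule_format, of "g @ [b]" z "replicate (N - 1) b"] g(2) that Npos by simp
        moreover have "replicate N b = b # replicate (N - 1) b" using Npos by (cases N) auto
        ultimately show ?thesis by (simp add: \<chi>_def)
      qed
      \<comment> \<open>A translate of the axis of \<open>w\<close> passes through \<open>g\<close>,
        leaving it by \<open>b\<close> in one direction and by \<open>inv_letter a\<close> in the
        other. Up to the bounded tail \<open>winv p\<close>, moving along it is right multiplication
        by powers of \<open>w\<close>, which preserves \<open>A\<close>; so both ends have the same
        status.\<close>
      have adj: "\<chi> (inv_letter a) \<longleftrightarrow> \<chi> b"
        if ab: "(a, b) \<in> set (junctions w)" "inv_letter a \<in> D" "b \<in> D" for a b
      proof -
        obtain p q where pq: "w = p @ q" "p \<noteq> []" "last p = a" "hd (q @ p) = b"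
          using junction_split[OF ab(1)] .
        define u where "u = q @ p"
        have u: "cyclically_reduced u" "u \<noteq> []" "last u = a" "hd u = b"
          using pq w(3) cyclically_reduced_append_commute by (auto simp: u_def)
        have hdwu: "hd (winv u) = inv_letter a" "winv u \<noteq> []" "cyclically_reduced (winv u)"
          using u cyclically_reduced_winv by (auto simp: winv_def hd_rev last_map)
        have pS: "fst ` set p \<subseteq> S'" "fst ` set u \<subseteq> S'" "fst ` set (winv u) \<subseteq> S'" "fst ` set (winv p) \<subseteq> S'"
        proof -
          show 1: "fst ` set p \<subseteq> S'" "fst ` set u \<subseteq> S'" using wset(1) pq(1) by (auto simp: u_def)
          show "fst ` set (winv u) \<subseteq> S'" "fst ` set (winv p) \<subseteq> S'" using 1 by (simp_all only: fst_set_winv)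
        qed
        define m where "m = N + length p"
        have m: "m > 0" using Npos by (simp add: m_def)
        have ext: "g @ concat (replicate m t) \<in> reduced_words S' \<and> N + length p \<le> length (g @ concat (replicate m t))
            \<and> (g @ concat (replicate m t) \<in> A \<longleftrightarrow> \<chi> (hd t))"
          if t: "cyclically_reduced t" "t \<noteq> []" "hd t \<in> D" "fst ` set t \<subseteq> S'" for t
        proof -
          let ?c = "concat (replicate m t)"
          have hdc: "hd ?c = hd t" "?c \<noteq> []" using hd_power[OF m t(2)] m t(2) by auto
          have "set ?c \<subseteq> set t" by auto
          then have "fst ` set (g @ ?c) \<subseteq> S'" using t(4) reduced_wordsD(2)[OF g(1)]
            unfolding set_append image_Un by blast
          moreover have "reduced (g @ ?c)"
            using reduced_power[OF t(1), of m] t(3) hdc unfolding D_def by (auto simp: reduced_append)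
          ultimately have 1: "g @ ?c \<in> reduced_words S'" by (simp add: reduced_words_def)
          have "length ?c = m * length t" by (simp add: length_concat sum_list_replicate)
          moreover have "m * 1 \<le> m * length t" using t(2) by (intro mult_le_mono) (auto simp: Suc_le_eq)
          ultimately have 2: "N + length p \<le> length (g @ ?c)"
            unfolding length_append m_def[symmetric] by linarith
          have "?c = hd t # tl ?c" using hdc by (metis list.collapse)
          then have "g @ ?c \<in> A \<longleftrightarrow> \<chi> (hd t)" using \<chi>[of "hd t" "tl ?c"] 1 2 by simp
          then show ?thesis using 1 2 by blast
        qed
        have E: "nf ((g @ concat (replicate m t)) @ winv p) \<in> A \<longleftrightarrow> \<chi> (hd t)"
          if t: "cyclically_reduced t" "t \<noteq> []" "hd t \<in> D" "fst ` set t \<subseteq> S'" for t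
          using ext[OF t] stable1[of "g @ concat (replicate m t)" "winv p"] pS(4) by simp
        have g0: "nf (g @ winv p) \<in> reduced_words S'" by (rule clos[OF g(1) pS(4)])
        have "nf ((g @ concat (replicate m u)) @ winv p) = nf (nf (g @ winv p) @ concat (replicate m w))"
        proof -
          have "nf ((g @ concat (replicate m u)) @ winv p) = nf ((g @ winv p) @ p @ concat (replicate m (q @ p)) @ winv p)"
            using nf_cancel(1)[of g p "concat (replicate m u) @ winv p"] by (simp add: u_def)
          also have "\<dots> = nf (((g @ winv p) @ concat (replicate m w)) @ p @ winv p)"
            using append_power[of p m q] pq(1) by (metis append.assoc)
          also have "\<dots> = nf ((g @ winv p) @ concat (replicate m w))"
            using nf_cancel(2)[of "(g @ winv p) @ concat (replicate m w)" p "[]"] by simp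
          finally show ?thesis by (simp add: nf_append_nf)
        qed
        then have 1: "\<chi> b \<longleftrightarrow> nf (g @ winv p) \<in> A"
          using E[OF u(1,2)] u(4) ab(3) pS(2) A_pow[OF g0] by simp
        have "concat (replicate m (winv u)) @ winv p = winv p @ concat (replicate m (winv w))"
          using append_power[of "winv p" m "winv q"] pq(1) by (simp add: u_def)
        then have "nf ((g @ concat (replicate m (winv u))) @ winv p) = nf (nf (g @ winv p) @ concat (replicate m (winv w)))"
          by (simp add: nf_append_nf)
        then have 2: "\<chi> (inv_letter a) \<longleftrightarrow> nf (g @ winv p) \<in> A"
          using E[OF hdwu(3,2)] hdwu(1) ab(2) pS(3) A_pow'[OF g0] by simp
        show ?thesis using 1 2 by simp
      qed
      \<comment> \<open>The letters that can follow \<open>g\<close> are all vertices except the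
        inverse of its last letter, which acts as the removed vertex. By \<open>adj\<close>, no edge
        among them leaves \<open>U\<close>.\<close>
      define U where "U = {b \<in> D. \<chi> b}"
      have "U = {} \<or> U = D"
      proof (cases "g = []")
        case False
        let ?e = "inv_letter (last g)"
        have "last g \<in> set g" using False by simp
        then have e: "?e \<in> ?L" using g(1) by (auto simp: reduced_words_def mem_Times_iff)
        have D: "D = ?L - {?e}"
          using g(1) False unfolding D_def by (auto simp: reduced_words_def reduced_append reduced_Cons)
        show ?thesis unfolding D
        proof (rule closed[OF e])
          show "U \<subseteq> ?L - {?e}" by (auto simp: U_def D)
        next
          fix a b assume "(a, b) \<in> set (junctions w)" "inv_letter a \<noteq> ?e" "b \<noteq> ?e"
          then show "inv_letter a \<in> U \<longleftrightarrow> b \<in> U" using adj[of a b] jL[of a b] by (auto simp: U_def D)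
        qed
      next
        case True
        have D: "D = ?L" unfolding D_def True by (auto simp: reduced_Cons)
        show ?thesis
        proof (rule ccontr)
          assume "\<not> ?thesis"
          then obtain s t where st: "s \<in> U" "t \<in> D" "t \<notin> U" by (auto simp: U_def)
          \<comment> \<open>For the empty prefix no vertex is removed, so an auxiliary one is taken
            away; two generators supply enough letters to avoid both \<open>s\<close> and
            \<open>t\<close>.\<close>
          have "\<exists>e\<in>?L. e \<noteq> s \<and> e \<noteq> t"
          proof (rule ccontr)
            assume "\<not> ?thesis"
            then have "{(x, True), (x, False), (y, True)} \<subseteq> {s, t}" using S'(3,4) by auto
            then have "card {(x, True), (x, False), (y, True)} \<le> card {s, t}" by (intro card_mono) auto
            also have "\<dots> \<le> 2" by (simp add: card_insert_if)
            finally show False using S'(5) by simp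
          qed
          then obtain e where e: "e \<in> ?L" "e \<noteq> s" "e \<noteq> t" by blast
          have "U - {e} = {} \<or> U - {e} = ?L - {e}"
          proof (rule closed[OF e(1)])
            show "U - {e} \<subseteq> ?L - {e}" by (auto simp: U_def D)
          next
            fix a b assume "(a, b) \<in> set (junctions w)" "inv_letter a \<noteq> e" "b \<noteq> e"
            then show "inv_letter a \<in> U - {e} \<longleftrightarrow> b \<in> U - {e}"
              using adj[of a b] jL[of a b] by (auto simp: U_def D)
          qed
          then show False using st e D by blast
        qed
      qed
      then have all: "\<chi> b \<longleftrightarrow> \<chi> b'" if "b \<in> D" "b' \<in> D" for b b' using that by (auto simp: U_def)
      have "y1 \<noteq> []" "y2 \<noteq> []" using y(3,4) g(2) n by auto
      then obtain b1 z1 b2 z2 where yz: "y1 = b1 # z1" "y2 = b2 # z2" by (meson neq_Nil_conv)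
      have "b1 \<in> D" "b2 \<in> D" using y(1,2) unfolding yz D_def
        by (auto simp: reduced_words_def reduced_append reduced_Cons mem_Times_iff)
      then show "g @ y1 \<in> A \<longleftrightarrow> g @ y2 \<in> A" using \<chi> y all unfolding yz by blast
    qed
  qed simp
  then have same: "u \<in> A \<longleftrightarrow> u' \<in> A"
    if "u \<in> reduced_words S'" "u' \<in> reduced_words S'" "N \<le> length u" "N \<le> length u'" for u u'
  proof -
    have "[] \<in> reduced_words S'" by (simp add: reduced_words_def)
    from \<open>?P 0\<close>[rule_format, OF this, of u u'] show ?thesis using that by simp
  qed
  have fin: "finite {u \<in> reduced_words S'. length u \<le> N}" by (rule finite_reduced_words_length[OF S'(1)])
  obtain u where u: "u \<in> A \<inter> reduced_words S'" "N < length u"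
  proof -
    have "\<not> A \<inter> reduced_words S' \<subseteq> {u \<in> reduced_words S'. length u \<le> N}" using fin A(3) finite_subset by blast
    then show ?thesis using that by force
  qed
  obtain u' where u': "u' \<in> reduced_words S' - A" "N < length u'"
  proof -
    have "\<not> reduced_words S' - A \<subseteq> {u \<in> reduced_words S'. length u \<le> N}" using fin A(4) finite_subset by blast
    then show ?thesis using that by force
  qed
  show False using same[of u u'] u u' by auto
qed

section \<open>Counting words by weights\<close>

fun walk_weight :: "('b \<Rightarrow> 'b \<Rightarrow> real) \<Rightarrow> 'b \<Rightarrow> 'b list \<Rightarrow> real" where
  "walk_weight \<omega> a [] = 1"
| "walk_weight \<omega> a (b # u) = \<omega> a b * walk_weight \<omega> b u"

lemma lists_Suc: "{u. set u \<subseteq> \<Sigma> \<and> length u = Suc n} = (\<lambda>(b, u). b # u) ` (\<Sigma> \<times> {u. set u \<subseteq> \<Sigma> \<and> length u = n})"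
  by (auto simp: length_Suc_conv image_iff)

text \<open>Split off the first step. The vector \<open>r\<close> is only a supersolution for the
  transfer matrix: an inequality in each row suffices, and no eigenvalue has to be computed.\<close>

lemma sum_walk_weight:
  assumes "finite \<Sigma>" "\<And>a b. 0 \<le> \<omega> a b" "0 \<le> \<rho>" "\<And>a. a \<in> \<Sigma> \<Longrightarrow> (\<Sum>b\<in>\<Sigma>. \<omega> a b * r b) \<le> \<rho> * r a" "a \<in> \<Sigma>"
  shows "(\<Sum>u | set u \<subseteq> \<Sigma> \<and> length u = n. walk_weight \<omega> a u * r (last (a # u))) \<le> \<rho> ^ n * r a"
  using assms(5)
proof (induction n arbitrary: a)
  case 0
  have "{u. set u \<subseteq> \<Sigma> \<and> length u = 0} = {[]}" by auto
  then show ?case by simp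
next
  case (Suc n)
  let ?X = "{u. set u \<subseteq> \<Sigma> \<and> length u = n}"
  have "(\<Sum>u | set u \<subseteq> \<Sigma> \<and> length u = Suc n. walk_weight \<omega> a u * r (last (a # u)))
      = (\<Sum>(b, u)\<in>\<Sigma> \<times> ?X. \<omega> a b * (walk_weight \<omega> b u * r (last (b # u))))"
    unfolding lists_Suc by (subst sum.reindex) (auto simp: inj_on_def case_prod_beta intro!: sum.cong)
  also have "\<dots> = (\<Sum>b\<in>\<Sigma>. \<omega> a b * (\<Sum>u\<in>?X. walk_weight \<omega> b u * r (last (b # u))))"
    by (simp add: sum.cartesian_product sum_distrib_left)
  also have "\<dots> \<le> (\<Sum>b\<in>\<Sigma>. \<omega> a b * (\<rho> ^ n * r b))"
    using Suc.IH assms(2) by (intro sum_mono mult_left_mono) auto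
  also have "\<dots> = \<rho> ^ n * (\<Sum>b\<in>\<Sigma>. \<omega> a b * r b)"
    by (simp add: sum_distrib_left algebra_simps)
  also have "\<dots> \<le> \<rho> ^ n * (\<rho> * r a)"
    using assms(3,4) Suc.prems by (intro mult_left_mono) auto
  finally show ?case by (simp add: algebra_simps)
qed

lemma walk_weight_zip: "walk_weight \<omega> a u = prod_list (map (\<lambda>(a, b). \<omega> a b) (zip (a # u) u))"
  by (induction u arbitrary: a) auto

lemma walk_weight_junctions:
  "walk_weight \<omega> a (x @ [a]) = prod_list (map (\<lambda>(a, b). \<omega> a b) (junctions (a # x)))"
proof -
  have "zip (a # x @ [a]) (x @ [a]) = zip (a # x) (x @ [a])"
    using zip_append1[of "a # x" "[a]" "x @ [a]"] by simp
  then show ?thesis by (simp add: walk_weight_zip junctions_Cons)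
qed

text \<open>Appending the first letter turns a cyclic word into a closed walk, so that all
  \<open>N\<close> junctions contribute a factor, including the one from the last letter to the
  first.\<close>

lemma card_weighted_words:
  assumes "finite \<Sigma>" "\<And>a b. 0 \<le> \<omega> a b" "0 \<le> \<rho>" "\<And>a. a \<in> \<Sigma> \<Longrightarrow> (\<Sum>b\<in>\<Sigma>. \<omega> a b * r b) \<le> \<rho> * r a"
    and "0 < m" "\<And>a. a \<in> \<Sigma> \<Longrightarrow> m \<le> r a" "0 < N" "0 \<le> c"
    and T: "\<And>w. w \<in> T \<Longrightarrow> set w \<subseteq> \<Sigma> \<and> length w = N \<and> c \<le> prod_list (map (\<lambda>(a, b). \<omega> a b) (junctions w))"
  shows "real (card T) * (c * m) \<le> (\<Sum>a\<in>\<Sigma>. r a) * \<rho> ^ N"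
proof -
  let ?X = "{u. set u \<subseteq> \<Sigma> \<and> length u = N}"
  let ?g = "\<lambda>(a, u). walk_weight \<omega> a u * r (last (a # u))"
  let ?h = "\<lambda>w. (hd w, tl w @ [hd w])"
  have fX: "finite ?X" using finite_lists_length_eq[OF assms(1)] by simp
  have nonneg: "0 \<le> walk_weight \<omega> a u" for a u by (induction u arbitrary: a) (auto simp: assms(2))
  have ne: "w \<noteq> []" if "w \<in> T" for w using T[OF that] assms(7) by auto
  have inj: "inj_on ?h T"
  proof (rule inj_onI)
    fix u v assume uv: "u \<in> T" "v \<in> T" "?h u = ?h v"
    then have "hd u = hd v" "tl u = tl v" by auto
    then show "u = v" using ne uv by (metis list.collapse)
  qed
  have sub: "?h ` T \<subseteq> \<Sigma> \<times> ?X"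
  proof
    fix p assume "p \<in> ?h ` T"
    then obtain w where w: "w \<in> T" "p = ?h w" by blast
    then show "p \<in> \<Sigma> \<times> ?X" using T[of w] ne[of w] by (cases w) auto
  qed
  have "real (card T) * (c * m) = (\<Sum>w\<in>T. c * m)" by simp
  also have "\<dots> \<le> (\<Sum>w\<in>T. ?g (?h w))"
  proof (rule sum_mono)
    fix w assume w: "w \<in> T"
    obtain a x where ax: "w = a # x" using ne[OF w] by (cases w) auto
    have "a \<in> \<Sigma>" using T[OF w] ax by simp
    have "c * m \<le> walk_weight \<omega> a (x @ [a]) * r a"
    proof (intro mult_mono)
      show "c \<le> walk_weight \<omega> a (x @ [a])" using T[OF w] ax by (simp add: walk_weight_junctions)
    qed (use assms(5,6) nonneg \<open>a \<in> \<Sigma>\<close> in auto)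
    then show "c * m \<le> ?g (?h w)" using ax by simp
  qed
  also have "\<dots> = sum ?g (?h ` T)" using inj by (simp add: sum.reindex)
  also have "\<dots> \<le> sum ?g (\<Sigma> \<times> ?X)"
  proof (rule sum_mono2)
    fix p assume "p \<in> \<Sigma> \<times> ?X - ?h ` T"
    then obtain a u where p: "p = (a, u)" "a \<in> \<Sigma>" "set u \<subseteq> \<Sigma>" by auto
    then have "last (a # u) \<in> \<Sigma>" by (auto intro: subsetD)
    then have "0 \<le> r (last (a # u))" using assms(5,6) by (meson order_less_imp_le order_trans)
    then show "0 \<le> ?g p" using p nonneg[of a u] by simp
  qed (use sub fX assms(1) in auto)
  also have "\<dots> = (\<Sum>a\<in>\<Sigma>. \<Sum>u\<in>?X. walk_weight \<omega> a u * r (last (a # u)))"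
    by (simp add: sum.cartesian_product)
  also have "\<dots> \<le> (\<Sum>a\<in>\<Sigma>. \<rho> ^ N * r a)"
    by (intro sum_mono sum_walk_weight assms)
  also have "\<dots> = (\<Sum>a\<in>\<Sigma>. r a) * \<rho> ^ N"
    unfolding sum_distrib_right by (intro sum.cong) auto
  finally show ?thesis .
qed

lemma prod_list_power:
  "prod_list (map (\<lambda>x. if P x then y else (1::real)) xs) = y ^ length (filter P xs)"
  by (induction xs) auto

lemma prod_list_mult: "prod_list (map (\<lambda>x. f x * g x :: real) xs) = prod_list (map f xs) * prod_list (map g xs)"
  by (induction xs) auto

section \<open>Weights for sparse cuts and for missing junctions\<close>

definition inside :: "'a letter set \<Rightarrow> 'a letter list \<Rightarrow> nat" where
  "inside U w = length (filter (\<lambda>(a, b). inv_letter a \<in> U \<and> b \<in> U) (junctions w))"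

lemma card_letters: "card (S \<times> (UNIV :: bool set)) = 2 * card S"
  by (simp add: card_cartesian_product)

lemma reduced_words_letters: "w \<in> reduced_words S \<Longrightarrow> set w \<subseteq> S \<times> UNIV"
  by (auto simp: reduced_words_def)

text \<open>Crossings get the small weight \<open>y\<close>, junctions inside \<open>U\<close> the
  weight \<open>\<eta>\<close> and all others weight one. As inverse pairs are forbidden, a row on
  the side of \<open>U\<close> has \<open>card U - 1\<close> entries of weight
  \<open>\<eta>\<close>, and a row on the other side at most \<open>2 * card S - 3\<close> entries
  of weight one; crossings add at most \<open>2 * k * y\<close>. The room between
  \<open>card U - 1\<close> and \<open>2 * k - 3\<close> permits \<open>\<eta> > 1\<close>, so that
  frequent visits to \<open>U\<close> lower the count.\<close>

lemma card_sparse_cut: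
  fixes S :: "'a set" and y \<eta> :: real
  defines "k \<equiv> real (card S)"
  assumes "finite S" "U \<subseteq> S \<times> UNIV" "2 \<le> card U" "card U \<le> 2 * card S - 2"
    and \<eta>: "1 \<le> \<eta>" "\<eta> * (real (card U) - 1) \<le> 2 * k - 3" and y: "0 < y" "y \<le> 1" and N: "0 < N"
    and T: "\<And>w. w \<in> T \<Longrightarrow> w \<in> reduced_words S \<and> cyclically_reduced w \<and> length w = N
      \<and> crossings U w \<le> m \<and> n \<le> inside U w"
  shows "real (card T) * (y ^ m * \<eta> ^ n) \<le> 2 * k * (2 * k - 3 + 2 * k * y) ^ N"
proof -
  let ?L = "S \<times> (UNIV :: bool set)"
  have fL: "finite ?L" using assms(2) by simp
  have fU: "finite U" using fL assms(3) finite_subset by blast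
  have cL: "card ?L = 2 * card S" by (rule card_letters)
  have cU: "card (?L - U) = 2 * card S - card U" using fU assms(3) cL by (simp add: card_Diff_subset)
  define \<omega> where "\<omega> a b = (if b = inv_letter a then 0 else if (inv_letter a \<in> U) \<noteq> (b \<in> U) then y
    else if inv_letter a \<in> U \<and> b \<in> U then \<eta> else (1::real))" for a b
  have k: "real (2 * card S) = 2 * k" by (simp add: k_def)
  have kU: "2 \<le> real (card U)" "real (card U) \<le> 2 * k - 2" using assms(4,5) unfolding k_def by linarith+
  have row: "(\<Sum>b\<in>?L. \<omega> a b) \<le> 2 * k - 3 + 2 * k * y" if a: "a \<in> ?L" for a
  proof -
    have aL: "inv_letter a \<in> ?L" using a by (simp add: mem_Times_iff)
    have split: "(\<Sum>b\<in>?L. \<omega> a b) = (\<Sum>b\<in>U. \<omega> a b) + (\<Sum>b\<in>?L - U. \<omega> a b)"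
      using fL assms(3) by (simp add: sum.subset_diff add.commute)
    show ?thesis
    proof (cases "inv_letter a \<in> U")
      case True
      have "(\<Sum>b\<in>U. \<omega> a b) = (\<Sum>b\<in>U - {inv_letter a}. \<omega> a b)"
        using fU by (intro sum.mono_neutral_right) (auto simp: \<omega>_def)
      also have "\<dots> = (\<Sum>b\<in>U - {inv_letter a}. \<eta>)" by (intro sum.cong) (auto simp: \<omega>_def True)
      also have "\<dots> = \<eta> * (real (card U) - 1)" using True fU kU(1) by (simp add: of_nat_diff)
      finally have 1: "(\<Sum>b\<in>U. \<omega> a b) \<le> 2 * k - 3" using \<eta>(2) by simp
      have "(\<Sum>b\<in>?L - U. \<omega> a b) = (\<Sum>b\<in>?L - U. y)" using True by (intro sum.cong) (auto simp: \<omega>_def)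
      also have "\<dots> \<le> 2 * k * y" using cU kU k y(1) by (simp add: k_def)
      finally show ?thesis using 1 split by simp
    next
      case False
      have "(\<Sum>b\<in>U. \<omega> a b) = (\<Sum>b\<in>U. y)" using False by (intro sum.cong) (auto simp: \<omega>_def)
      also have "\<dots> \<le> 2 * k * y" using kU y(1) by simp
      finally have 1: "(\<Sum>b\<in>U. \<omega> a b) \<le> 2 * k * y" .
      have "(\<Sum>b\<in>?L - U. \<omega> a b) = (\<Sum>b\<in>?L - U - {inv_letter a}. \<omega> a b)"
        using fL by (intro sum.mono_neutral_right) (auto simp: \<omega>_def)
      also have "\<dots> = (\<Sum>b\<in>?L - U - {inv_letter a}. 1)" using False by (intro sum.cong) (auto simp: \<omega>_def)
      also have "\<dots> \<le> 2 * k - 3"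
      proof -
        have "card (?L - U - {inv_letter a}) = 2 * card S - card U - 1"
          using fL aL False cU by simp
        moreover have "3 \<le> 2 * card S" using assms(4,5) by linarith
        ultimately have "card (?L - U - {inv_letter a}) + 3 \<le> 2 * card S" using assms(4) by linarith
        then show ?thesis using k by simp
      qed
      finally show ?thesis using 1 split by simp
    qed
  qed
  have "real (card T) * (y ^ m * \<eta> ^ n * 1) \<le> (\<Sum>a\<in>?L. 1) * (2 * k - 3 + 2 * k * y) ^ N"
  proof (rule card_weighted_words[where \<omega> = \<omega> and r = "\<lambda>_. 1"])
    fix w assume w: "w \<in> T"
    have "prod_list (map (\<lambda>(a, b). \<omega> a b) (junctions w))
        = prod_list (map (\<lambda>x. (if (\<lambda>(a, b). (inv_letter a \<in> U) \<noteq> (b \<in> U)) x then y else 1) *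
            (if (\<lambda>(a, b). inv_letter a \<in> U \<and> b \<in> U) x then \<eta> else 1)) (junctions w))"
    proof (intro arg_cong[of _ _ prod_list] map_cong refl)
      fix x assume x: "x \<in> set (junctions w)"
      obtain a b where ab: "x = (a, b)" by (cases x)
      have "b \<noteq> inv_letter a" using junction_reduced[of w a b] T[OF w] x ab by simp
      then show "(case x of (a, b) \<Rightarrow> \<omega> a b) = (if (\<lambda>(a, b). (inv_letter a \<in> U) \<noteq> (b \<in> U)) x then y else 1) *
            (if (\<lambda>(a, b). inv_letter a \<in> U \<and> b \<in> U) x then \<eta> else 1)"
        by (simp add: \<omega>_def ab)
    qed
    also have "\<dots> = y ^ crossings U w * \<eta> ^ inside U w"
      by (simp only: prod_list_mult prod_list_power crossings_def inside_def)
    also have "\<dots> \<ge> y ^ m * \<eta> ^ n"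
      using T[OF w] y \<eta>(1) by (intro mult_mono power_decreasing power_increasing) auto
    finally show "set w \<subseteq> ?L \<and> length w = N \<and> y ^ m * \<eta> ^ n \<le> prod_list (map (\<lambda>(a, b). \<omega> a b) (junctions w))"
      using T[OF w] reduced_words_letters by blast
  qed (use fL row y \<eta> N kU in \<open>auto simp: \<omega>_def\<close>)
  then show ?thesis using cL by (simp add: k_def)
qed

text \<open>The weights \<open>1 - 4\<delta>\<close>, \<open>1 - \<delta>\<close>, \<open>1 - 2\<delta>\<close> approximate a Perron eigenvector of the
  transition matrix on \<open>S - {t}\<close> from which the transition from \<open>p\<close> to \<open>q\<close> has been removed: they
  certify an eigenvalue below that of all reduced words.\<close>

lemma card_missing_junction:
  fixes S :: "'a set" and t :: 'a
  defines "D \<equiv> 2 * real (card S) - 2"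
  defines "\<delta> \<equiv> 1 / (16 * D)"
  assumes "finite S" "t \<in> S" "3 \<le> card S" "fst p \<in> S - {t}" "fst q \<in> S - {t}" "q \<noteq> inv_letter p" and N: "0 < N"
    and T: "\<And>w. w \<in> T \<Longrightarrow> w \<in> reduced_words S \<and> cyclically_reduced w \<and> length w = N
      \<and> (p, q) \<notin> set (junctions w) \<and> length (filter (\<lambda>a. fst a = t) w) \<le> m"
  shows "real (card T) * ((\<delta> / 8) ^ m / 2) \<le> 4 * real (card S) * (D - 1 - \<delta> / 2) ^ N"
proof -
  let ?L = "S \<times> (UNIV :: bool set)" and ?M = "(S - {t}) \<times> (UNIV :: bool set)"
  have D4: "4 \<le> D" using assms(5) by (simp add: D_def)
  then have \<delta>: "0 < \<delta>" "\<delta> \<le> 1 / 64" "\<delta> * D = 1 / 16" by (auto simp: \<delta>_def field_simps)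
  \<comment> \<open>Naming the two products turns all row estimates into linear arithmetic.\<close>
  define X Y where "X = D * \<delta>" and "Y = \<delta> * \<delta>"
  have X: "X = 1 / 16" and Y: "0 \<le> Y" using \<delta> by (simp_all add: X_def Y_def mult.commute)
  have R': "\<delta> * (2 * D + 1) = 2 * X + \<delta>" by (simp add: X_def algebra_simps)
  \<comment> \<open>The two letters over \<open>t\<close> have weight at most \<open>y\<close> and
    value 2 in \<open>r\<close>, so together they add at most \<open>4 * y = \<delta> / 2\<close> to
    a row.\<close>
  define y where "y = \<delta> / 8"
  have y: "0 < y" "8 * y = \<delta>" "y \<le> 1" using \<delta> by (auto simp: y_def)
  have fL: "finite ?L" "finite ?M" using assms(3) by auto
  have LM: "?L = ?M \<union> {(t, True), (t, False)}" "?M \<inter> {(t, True), (t, False)} = {}" using assms(4) by auto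
  have cM: "real (card ?M) = D"
  proof -
    have "card ?M = 2 * (card S - 1)" using assms(3,4) by (simp add: card_letters)
    then show ?thesis using assms(5) by (simp add: D_def of_nat_diff)
  qed
  define r where "r c = (if fst c = t then 2 else if c = p then 1 - 4 * \<delta> else if c = inv_letter p then 1 - \<delta>
     else 1 - 2 * \<delta>)" for c
  define \<omega> where "\<omega> a b = (if b = inv_letter a \<or> (a, b) = (p, q) then 0 else if fst b = t then y else (1::real))" for a b
  have rM: "1 - 4 * \<delta> \<le> r c" "r c \<le> 1" if "c \<in> ?M" for c
  proof -
    have "fst c \<noteq> t" using that by (simp add: mem_Times_iff)
    then show "1 - 4 * \<delta> \<le> r c" "r c \<le> 1" using \<delta> by (simp_all add: r_def)
  qed
  have pM: "p \<in> ?M" "inv_letter p \<in> ?M" "q \<in> ?M" using assms(6,7) by (auto simp: mem_Times_iff)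
  have R: "(\<Sum>b\<in>?M. r b) = D - \<delta> * (2 * D + 1)"
  proof -
    have "(\<Sum>b\<in>?M. r b) = r p + (r (inv_letter p) + (\<Sum>b\<in>?M - {p} - {inv_letter p}. r b))"
      using fL(2) pM by (simp add: sum.remove[of ?M p] sum.remove[of "?M - {p}" "inv_letter p"])
    also have "(\<Sum>b\<in>?M - {p} - {inv_letter p}. r b) = (\<Sum>b\<in>?M - {p} - {inv_letter p}. 1 - 2 * \<delta>)"
      by (intro sum.cong) (auto simp: r_def)
    also have "\<dots> = (D - 2) * (1 - 2 * \<delta>)"
    proof -
      have "card (?M - {p} - {inv_letter p}) = card ?M - 2" using fL(2) pM by simp
      moreover have "2 \<le> card ?M" using cM D4 by linarith
      ultimately have "real (card (?M - {p} - {inv_letter p})) = D - 2" using cM by (simp add: of_nat_diff)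
      then show ?thesis by simp
    qed
    also have "r p = 1 - 4 * \<delta>" using assms(6) by (auto simp: r_def)
    also have "r (inv_letter p) = 1 - \<delta>" using assms(6) by (auto simp: r_def)
    finally show ?thesis by (simp add: algebra_simps)
  qed
  have tsum: "(\<Sum>b\<in>{(t, True), (t, False)}. \<omega> a b * r b) \<le> 4 * y" for a
  proof -
    have "\<omega> a b * r b \<le> y * 2" if "b \<in> {(t, True), (t, False)}" for b
    proof -
      have b: "fst b = t" using that by auto
      then have "\<omega> a b \<le> y" using y by (simp add: \<omega>_def)
      then show ?thesis using b by (simp add: r_def)
    qed
    from sum_bounded_above[of "{(t, True), (t, False)}" "\<lambda>b. \<omega> a b * r b", OF this] show ?thesis by simp
  qed
  have split: "(\<Sum>b\<in>?L. \<omega> a b * r b) \<le> (\<Sum>b\<in>?M. \<omega> a b * r b) + 4 * y" for a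
  proof -
    have "(\<Sum>b\<in>?L. \<omega> a b * r b) = (\<Sum>b\<in>?M. \<omega> a b * r b) + (\<Sum>b\<in>{(t, True), (t, False)}. \<omega> a b * r b)"
      unfolding LM(1) by (rule sum.union_disjoint[OF fL(2) _ LM(2)]) simp
    then show ?thesis using tsum[of a] by linarith
  qed
  \<comment> \<open>Since \<open>p\<close> and its inverse have total value
    \<open>2 - 5 * \<delta>\<close> instead of \<open>2 - 4 * \<delta>\<close>, a generic row gains
    \<open>\<delta>\<close>: half pays for the letters over \<open>t\<close>, half lowers the rate.
    The row of \<open>p\<close> can afford its small value because the entry for \<open>q\<close> is
    missing. The row of \<open>inv_letter p\<close> omits only that small value, which its own
    larger value compensates.\<close>
  let ?\<rho> = "D - 1 - \<delta> / 2"
  have row: "(\<Sum>b\<in>?L. \<omega> a b * r b) \<le> ?\<rho> * r a" if a: "a \<in> ?L" for a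
  proof -
    consider (t) "fst a = t" | (p) "a = p" | (np) "fst a \<noteq> t" "a \<noteq> p" by blast
    then show ?thesis
    proof cases
      case t
      have "(\<Sum>b\<in>?M. \<omega> a b * r b) \<le> (\<Sum>b\<in>?M. 1)"
      proof (rule sum_mono)
        fix b assume b: "b \<in> ?M"
        have "0 \<le> r b" using rM[OF b] \<delta> by linarith
        then show "\<omega> a b * r b \<le> 1" using rM[OF b] b by (auto simp: \<omega>_def)
      qed
      then have "(\<Sum>b\<in>?L. \<omega> a b * r b) \<le> D + 4 * y" using split[of a] cM by simp
      also have "\<dots> \<le> ?\<rho> * 2"
      proof -
        have "D + 4 * y \<le> 2 * D - 2 - \<delta>" using D4 \<delta>(1,2) y by linarith
        then show ?thesis by (simp add: algebra_simps)
      qed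
      finally show ?thesis using t by (simp add: r_def)
    next
      case p
      have "(\<Sum>b\<in>?M. \<omega> a b * r b) = (\<Sum>b\<in>?M - {inv_letter p} - {q}. r b)"
        using fL(2) by (intro sum.mono_neutral_cong_right) (auto simp: \<omega>_def p)
      also have "\<dots> = (\<Sum>b\<in>?M. r b) - r (inv_letter p) - r q"
        using fL(2) pM assms(8) by (simp add: sum_diff1)
      also have "\<dots> \<le> D - \<delta> * (2 * D + 1) - (1 - \<delta>) - (1 - 4 * \<delta>)"
      proof -
        have "r (inv_letter p) = 1 - \<delta>" using assms(6) by (auto simp: r_def)
        then show ?thesis using R rM[OF pM(3)] by linarith
      qed
      finally have "(\<Sum>b\<in>?L. \<omega> a b * r b) \<le> D - \<delta> * (2 * D + 1) - (1 - \<delta>) - (1 - 4 * \<delta>) + 4 * y" using split[of a] by simp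
      also have "\<dots> \<le> ?\<rho> * (1 - 4 * \<delta>)"
      proof -
        have eq: "?\<rho> * (1 - 4 * \<delta>) = D - 1 - \<delta> / 2 - 4 * X + 4 * \<delta> + 2 * Y"
          by (simp add: X_def Y_def field_simps)
        show ?thesis unfolding eq R' using X Y \<delta>(1,2) y by linarith
      qed
      finally show ?thesis using p assms(6) by (simp add: r_def)
    next
      case np
      then have aM: "inv_letter a \<in> ?M" using a by (simp add: mem_Times_iff)
      have "(\<Sum>b\<in>?M. \<omega> a b * r b) = (\<Sum>b\<in>?M - {inv_letter a}. r b)"
        using fL(2) np by (intro sum.mono_neutral_cong_right) (auto simp: \<omega>_def)
      also have "\<dots> = D - \<delta> * (2 * D + 1) - r (inv_letter a)"
        using fL(2) aM R by (simp add: sum_diff1)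
      finally have le: "(\<Sum>b\<in>?L. \<omega> a b * r b) \<le> D - \<delta> * (2 * D + 1) - r (inv_letter a) + 4 * y" using split[of a] by simp
      have eq: "?\<rho> * (1 - \<delta>) = D - 1 - \<delta> / 2 - X + \<delta> + Y / 2"
        "?\<rho> * (1 - 2 * \<delta>) = D - 1 - \<delta> / 2 - 2 * X + 2 * \<delta> + Y"
        by (simp_all add: X_def Y_def field_simps)
      show ?thesis
      proof (cases "a = inv_letter p")
        case True
        then have ra: "r a = 1 - \<delta>" "r (inv_letter a) = 1 - 4 * \<delta>" using assms(6) by (auto simp: r_def)
        show ?thesis using le X Y \<delta>(1,2) y unfolding ra eq R' by linarith
      next
        case False
        then have "inv_letter a \<noteq> p" by (metis inv_letter_inv_letter)
        then have ra: "r a = 1 - 2 * \<delta>" "r (inv_letter a) = 1 - 2 * \<delta>" using np False by (auto simp: r_def)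
        show ?thesis using le X Y \<delta>(1,2) y unfolding ra eq R' by linarith
      qed
    qed
  qed
  have "real (card T) * (y ^ m * (1 / 2)) \<le> (\<Sum>a\<in>?L. r a) * ?\<rho> ^ N"
  proof (rule card_weighted_words[where \<omega> = \<omega>])
    fix w assume w: "w \<in> T"
    have "prod_list (map (\<lambda>(a, b). \<omega> a b) (junctions w))
        = prod_list (map (\<lambda>x. if (\<lambda>x. fst (snd x) = t) x then y else 1) (junctions w))"
    proof (intro arg_cong[of _ _ prod_list] map_cong refl)
      fix x assume x: "x \<in> set (junctions w)"
      obtain a b where ab: "x = (a, b)" by (cases x)
      have "b \<noteq> inv_letter a" "(a, b) \<noteq> (p, q)" using junction_reduced[of w a b] T[OF w] x ab by auto
      then show "(case x of (a, b) \<Rightarrow> \<omega> a b) = (if (\<lambda>x. fst (snd x) = t) x then y else 1)"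
        unfolding \<omega>_def ab by auto
    qed
    also have "\<dots> = y ^ length (filter (\<lambda>x. fst (snd x) = t) (junctions w))"
      by (rule prod_list_power)
    also have "length (filter (\<lambda>x. fst (snd x) = t) (junctions w)) = length (filter (\<lambda>a. fst a = t) (map snd (junctions w)))"
      by (simp add: filter_map o_def)
    also have "\<dots> = length (filter (\<lambda>a. fst a = t) w)"
      unfolding map_junctions by (metis mset_rotate1 mset_filter size_mset)
    finally have "y ^ m \<le> prod_list (map (\<lambda>(a, b). \<omega> a b) (junctions w))"
      using T[OF w] y by (auto intro!: power_decreasing)
    then show "set w \<subseteq> ?L \<and> length w = N \<and> y ^ m \<le> prod_list (map (\<lambda>(a, b). \<omega> a b) (junctions w))"
      using T[OF w] reduced_words_letters by blast
  qed (use fL row y \<delta> N D4 in \<open>auto simp: \<omega>_def r_def\<close>)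
  also have "\<dots> \<le> 4 * real (card S) * ?\<rho> ^ N"
  proof (rule mult_right_mono)
    have "r a \<le> 2" for a using \<delta> by (auto simp: r_def)
    then have "(\<Sum>a\<in>?L. r a) \<le> real (card ?L) * 2" by (intro sum_bounded_above) auto
    then show "(\<Sum>a\<in>?L. r a) \<le> 4 * real (card S)" by (simp add: card_letters)
  qed (use D4 \<delta> in auto)
  finally show ?thesis by (simp add: y_def)
qed

section \<open>The number of reduced words\<close>

lemma card_UN_Cons:
  assumes "finite X" "\<And>b. b \<in> X \<Longrightarrow> finite (F b)"
  shows "card (\<Union>b\<in>X. (#) b ` F b) = (\<Sum>b\<in>X. card (F b))"
  using assms by (subst card_UN_disjoint) (auto simp: card_image inj_on_def)

lemma reduced_words_Cons:
  "b # u \<in> reduced_words S \<longleftrightarrow> fst b \<in> S \<and> u \<in> reduced_words S \<and> (u \<noteq> [] \<longrightarrow> b \<noteq> inv_letter (hd u))"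
  by (simp add: reduced_words_def reduced_Cons) blast

lemma reduced_words_Suc:
  "{u \<in> reduced_words S. length u = Suc n \<and> P (hd u)}
    = (\<Union>b\<in>{b \<in> S \<times> UNIV. P b}. (#) b ` {u \<in> reduced_words S. length u = n \<and> (u \<noteq> [] \<longrightarrow> b \<noteq> inv_letter (hd u))})"
  (is "?A = ?B")
proof (rule Set.set_eqI)
  fix u
  show "u \<in> ?A \<longleftrightarrow> u \<in> ?B"
    by (cases u) (simp_all add: reduced_words_Cons mem_Times_iff image_iff, blast)
qed

lemma card_reduced_words_after:
  assumes "finite S" "fst a \<in> S"
  shows "card {u \<in> reduced_words S. length u = n \<and> (u \<noteq> [] \<longrightarrow> a \<noteq> inv_letter (hd u))} = (2 * card S - 1) ^ n"
  using assms(2)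
proof (induction n arbitrary: a)
  case 0
  have "{u \<in> reduced_words S. length u = 0 \<and> (u \<noteq> [] \<longrightarrow> a \<noteq> inv_letter (hd u))} = {[]}"
    by (auto simp: reduced_words_def)
  then show ?case by simp
next
  case (Suc n)
  let ?L = "S \<times> (UNIV :: bool set)"
  let ?F = "\<lambda>b. {u \<in> reduced_words S. length u = n \<and> (u \<noteq> [] \<longrightarrow> b \<noteq> inv_letter (hd u))}"
  have fin: "finite (?F b)" for b
    by (rule finite_subset[OF _ finite_reduced_words_length[OF assms(1), of n]]) auto
  have "{u \<in> reduced_words S. length u = Suc n \<and> (u \<noteq> [] \<longrightarrow> a \<noteq> inv_letter (hd u))}
      = (\<Union>b\<in>?L - {inv_letter a}. (#) b ` ?F b)"
  proof -
    have "{u \<in> reduced_words S. length u = Suc n \<and> (u \<noteq> [] \<longrightarrow> a \<noteq> inv_letter (hd u))}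
       = {u \<in> reduced_words S. length u = Suc n \<and> a \<noteq> inv_letter (hd u)}" by force
    moreover have "a \<noteq> inv_letter b \<longleftrightarrow> b \<noteq> inv_letter a" for b by (metis inv_letter_inv_letter)
    then have "{b \<in> ?L. a \<noteq> inv_letter b} = ?L - {inv_letter a}" by blast
    ultimately show ?thesis using reduced_words_Suc[of S n "\<lambda>b. a \<noteq> inv_letter b"] by simp
  qed
  then have "card {u \<in> reduced_words S. length u = Suc n \<and> (u \<noteq> [] \<longrightarrow> a \<noteq> inv_letter (hd u))}
      = (\<Sum>b\<in>?L - {inv_letter a}. card (?F b))"
    using assms(1) fin by (simp only:) (rule card_UN_Cons, auto)
  also have "\<dots> = (\<Sum>b\<in>?L - {inv_letter a}. (2 * card S - 1) ^ n)"
    using Suc.IH by (intro sum.cong) auto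
  also have "\<dots> = (2 * card S - 1) ^ Suc n"
    using assms(1) Suc.prems by (simp add: card_letters mem_Times_iff)
  finally show ?case .
qed

lemma card_reduced_words:
  assumes "finite S"
  shows "card {u \<in> reduced_words S. length u = Suc n} = 2 * card S * (2 * card S - 1) ^ n"
proof -
  let ?L = "S \<times> (UNIV :: bool set)"
  let ?F = "\<lambda>b. {u \<in> reduced_words S. length u = n \<and> (u \<noteq> [] \<longrightarrow> b \<noteq> inv_letter (hd u))}"
  have fin: "finite (?F b)" for b
    by (rule finite_subset[OF _ finite_reduced_words_length[OF assms(1), of n]]) auto
  have "{u \<in> reduced_words S. length u = Suc n} = (\<Union>b\<in>?L. (#) b ` ?F b)"
    using reduced_words_Suc[of S n "\<lambda>_. True"] by simp
  then have "card {u \<in> reduced_words S. length u = Suc n} = (\<Sum>b\<in>?L. card (?F b))"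
    using assms(1) fin by (simp only:) (rule card_UN_Cons, auto)
  also have "\<dots> = (\<Sum>b\<in>?L. (2 * card S - 1) ^ n)"
    using card_reduced_words_after[OF assms] by (intro sum.cong) auto
  finally show ?thesis by (simp add: card_letters)
qed

lemma card_reduced_words_le:
  assumes "finite S" "1 \<le> card S"
  shows "card {u \<in> reduced_words S. length u = n} \<le> 2 * (2 * card S - 1) ^ n"
proof (cases n)
  case 0
  have "{u \<in> reduced_words S. length u = 0} = {[]}" by (auto simp: reduced_words_def)
  then show ?thesis using 0 by simp
next
  case (Suc m)
  have "2 * card S * (2 * card S - 1) ^ m \<le> (2 * (2 * card S - 1)) * (2 * card S - 1) ^ m"
    using assms(2) by (intro mult_right_mono) auto
  then show ?thesis using Suc card_reduced_words[OF assms(1), of m] by (simp add: mult.assoc)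
qed

section \<open>The growth rate of primitive cyclic words\<close>

definition prim_words :: "'a set \<Rightarrow> nat \<Rightarrow> 'a letter list set" where
  "prim_words S N = {w \<in> reduced_words S. cyclically_reduced w \<and> prim S w \<and> length w = N}"

definition prim_classes :: "'a set \<Rightarrow> nat \<Rightarrow> 'a letter list set set" where
  "prim_classes S N = cls S ` prim_words S N"

lemma primitive_cyclic_words_eq: "primitive_cyclic_words k N = prim_classes (gens k) N"
proof (intro equalityI subsetI)
  let ?S = "gens k"
  fix c assume "c \<in> primitive_cyclic_words k N"
  then obtain w where w: "c = cls ?S w" "w \<in> reduced_words ?S" "prim ?S w" "cyclic_length ?S w = N"
    by (auto simp: primitive_cyclic_words_def)
  have "fst ` set w \<subseteq> ?S" "nf w = w" using w(2) by (auto simp: reduced_words_def nf_reduced)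
  then obtain u where u: "u \<in> reduced_words ?S" "cyclically_reduced u" "cls ?S u = c"
    using cyclic_reduction_class[of w ?S] w(1) by metis
  have uc: "u \<in> cls ?S w" using conj_class_refl[OF u(1)] u(3) w(1) by simp
  have "u \<in> prim_words ?S N"
    using u prim_conj[OF w(2,3) uc] cyclic_length_eq[OF w(2) uc u(2)] w(4) by (simp add: prim_words_def)
  then show "c \<in> prim_classes ?S N" using u(3) unfolding prim_classes_def by blast
next
  let ?S = "gens k"
  fix c assume "c \<in> prim_classes ?S N"
  then obtain u where u: "c = cls ?S u" "u \<in> prim_words ?S N" by (auto simp: prim_classes_def)
  then have "cyclic_length ?S u = N"
    using cyclic_length_eq[of u ?S u] conj_class_refl[of u ?S] by (auto simp: prim_words_def)
  then show "c \<in> primitive_cyclic_words k N"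
    using u unfolding primitive_cyclic_words_def prim_words_def by auto
qed

lemma finite_prim_words: "finite S \<Longrightarrow> finite (prim_words S N)"
  by (rule finite_subset[OF _ finite_reduced_words_length[of S N]]) (auto simp: prim_words_def)

lemma finite_prim_classes: "finite S \<Longrightarrow> finite (prim_classes S N)"
  by (simp add: prim_classes_def finite_prim_words)

text \<open>Every occurrence of a generator, in either sign, gives one edge end at each of its two
  vertices. This identifies degrees in the Whitehead graph with numbers of occurrences.\<close>

lemma degree_eq:
  "length (filter (\<lambda>(a, b). inv_letter a = z) (junctions w)) + length (filter (\<lambda>(a, b). b = z) (junctions w))
    = length (filter (\<lambda>a. fst a = fst z) w)"
proof -
  have "length (filter (\<lambda>(a, b). inv_letter a = z) (junctions w)) = length (filter (\<lambda>a. inv_letter a = z) (map fst (junctions w)))"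
    by (simp add: filter_map o_def case_prod_unfold)
  moreover have "length (filter (\<lambda>(a, b). b = z) (junctions w)) = length (filter (\<lambda>b. b = z) (map snd (junctions w)))"
    by (simp add: filter_map o_def case_prod_unfold)
  moreover have "length (filter (\<lambda>b. b = z) (rotate1 w)) = length (filter (\<lambda>b. b = z) w)"
    by (metis mset_rotate1 mset_filter size_mset)
  moreover have "length (filter (\<lambda>a. fst a = fst z) w) = length (filter (\<lambda>a. inv_letter a = z) w) + length (filter (\<lambda>a. a = z) w)"
  proof (rule length_filter_disjoint)
    fix x
    show "fst x = fst z \<longleftrightarrow> inv_letter x = z \<or> x = z" by (cases x; cases z) auto
    show "\<not> (inv_letter x = z \<and> x = z)" by auto
  qed
  ultimately show ?thesis by (simp add: map_junctions)
qed

text \<open>Counting edge ends in \<open>U\<close>: an inner edge has two of them, a crossing edge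
  one.\<close>

lemma sides_eq:
  "length (filter (\<lambda>(a, b). inv_letter a \<in> U) (junctions w)) + length (filter (\<lambda>(a, b). b \<in> U) (junctions w))
    = 2 * inside U w + crossings U w"
proof -
  have "length (filter (\<lambda>(a, b). inv_letter a \<in> U) xs) + length (filter (\<lambda>(a, b). b \<in> U) xs)
    = 2 * length (filter (\<lambda>(a, b). inv_letter a \<in> U \<and> b \<in> U) xs)
      + length (filter (\<lambda>(a, b). (inv_letter a \<in> U) \<noteq> (b \<in> U)) xs)" for xs
    by (induction xs) auto
  then show ?thesis by (simp add: inside_def crossings_def)
qed

lemma length_filter_mono:
  "(\<And>x. P x \<Longrightarrow> Q x) \<Longrightarrow> length (filter P xs) \<le> length (filter Q xs)"
  by (induction xs) auto

lemma degree_le: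
  assumes "z \<in> U"
  shows "length (filter (\<lambda>a. fst a = fst z) w) \<le> 2 * inside U w + crossings U w"
  unfolding degree_eq[symmetric] sides_eq[symmetric]
  using assms by (intro add_mono length_filter_mono) auto

text \<open>A loop of the Whitehead graph would be a cancelling junction.\<close>

lemma inside_single:
  assumes "cyclically_reduced w"
  shows "inside {z} w = 0"
  using junction_reduced[OF assms] unfolding inside_def by (fastforce simp: filter_empty_conv)

lemma crossings_pair:
  "crossings {z, inv_letter z} w \<le> 2 * length (filter (\<lambda>a. fst a = fst z) w)"
proof -
  have iff: "a \<in> {z, inv_letter z} \<longleftrightarrow> fst a = fst z" "inv_letter a \<in> {z, inv_letter z} \<longleftrightarrow> fst a = fst z" for a
    by (cases a; cases z; auto)+
  have "length (filter (\<lambda>(a, b). inv_letter a \<in> {z, inv_letter z}) (junctions w)) = length (filter (\<lambda>a. fst a = fst z) (map fst (junctions w)))"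
    by (simp only: iff filter_map o_def case_prod_unfold length_map fst_inv_letter)
  moreover have "length (filter (\<lambda>(a, b). b \<in> {z, inv_letter z}) (junctions w)) = length (filter (\<lambda>a. fst a = fst z) (map snd (junctions w)))"
    by (simp only: iff filter_map o_def case_prod_unfold length_map fst_inv_letter)
  moreover have "length (filter (\<lambda>a. fst a = fst z) (rotate1 w)) = length (filter (\<lambda>a. fst a = fst z) w)"
    by (metis mset_rotate1 mset_filter size_mset)
  ultimately show ?thesis using sides_eq[of "{z, inv_letter z}" w] by (simp add: map_junctions)
qed

definition shortened :: "'a set \<Rightarrow> nat \<Rightarrow> nat \<Rightarrow> 'a letter list set set" where
  "shortened S m N = (\<Union>(v, Z)\<in>(S \<times> UNIV) \<times> Pow (S \<times> UNIV). \<Union>M\<in>{M. M + m \<le> N}. act (wh v Z) ` prim_classes S M)"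

lemma shortenedI:
  "v \<in> S \<times> UNIV \<Longrightarrow> Z \<in> Pow (S \<times> UNIV) \<Longrightarrow> M + m \<le> N \<Longrightarrow> c \<in> act (wh v Z) ` prim_classes S M \<Longrightarrow> c \<in> shortened S m N"
  unfolding shortened_def by blast

text \<open>If few edges join \<open>v\<close> to \<open>Z\<close>, a cut with 2 to
  \<open>card S\<close> vertices on one side is obtained from \<open>Z\<close>. A single vertex of
  small degree belongs to a rare generator and is replaced by the pair with its inverse, which
  explains the bound \<open>2 * m\<close>; a large \<open>Z\<close> is replaced by its complement,
  which contains \<open>v\<close> and \<open>inv_letter v\<close>.\<close>

lemma shorten_or_sparse:
  assumes S: "finite S" "2 \<le> card S" and w: "w \<in> prim_words S N" and N: "0 < N"
  shows "cls S w \<in> shortened S m N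
    \<or> (\<exists>U\<subseteq>S \<times> UNIV. 2 \<le> card U \<and> card U \<le> card S \<and> crossings U w \<le> 2 * m)"
proof -
  let ?L = "S \<times> (UNIV :: bool set)"
  have wd: "w \<in> reduced_words S" "cyclically_reduced w" "prim S w" "length w = N" "w \<noteq> []"
    using w N by (auto simp: prim_words_def)
  obtain x y where xy: "x \<in> S" "y \<in> S" "x \<noteq> y" by (rule two_elements[OF S(2)])
  obtain v Z where vZ: "fst v \<in> S" "Z \<noteq> {}" "Z \<subseteq> ?L" "v \<notin> Z" "inv_letter v \<notin> Z"
    and cut: "\<And>a b. (a, b) \<in> set (junctions w) \<Longrightarrow> cut_at v Z a b"
    using whitehead_cut_vertex[OF S(1) subset_refl xy wd(3,1,2)] by metis
  have finL: "finite ?L" "card ?L = 2 * card S" using S(1) by (auto simp: card_letters)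
  have finZ: "finite Z" using vZ(3) finL finite_subset by blast
  show ?thesis
  proof (cases "m \<le> crossings Z w")
    case True
    obtain w' where w': "w' \<in> reduced_words S" "cyclically_reduced w'" "prim S w'" "length w' + crossings Z w \<le> length w"
      "cls S w = act (wh (inv_letter v) Z) (cls S w')"
      using whitehead_descent[OF wd(1,3,5) vZ(1,4,5) cut] by metis
    have "cls S w' \<in> prim_classes S (length w')"
      using w' by (auto simp: prim_classes_def prim_words_def)
    moreover have "length w' + m \<le> N" using True w'(4) wd(4) by linarith
    moreover have "inv_letter v \<in> ?L" using vZ(1) by (simp add: mem_Times_iff)
    ultimately have "cls S w \<in> shortened S m N"
      unfolding w'(5) using vZ(3) by (intro shortenedI[of "inv_letter v" S Z "length w'"] imageI) auto
    then show ?thesis by simp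
  next
    case False
    have "\<exists>U\<subseteq>?L. 2 \<le> card U \<and> card U \<le> card S \<and> crossings U w \<le> 2 * m"
    proof (cases "card Z = 1")
      case True
      then obtain z where z: "Z = {z}" by (auto simp: card_1_singleton_iff)
      have "length (filter (\<lambda>a. fst a = fst z) w) \<le> crossings Z w"
        using degree_le[of z Z w] inside_single[OF wd(2), of z] z by simp
      then have "crossings {z, inv_letter z} w \<le> 2 * m" using crossings_pair[of z w] False by linarith
      moreover have "{z, inv_letter z} \<subseteq> ?L" using vZ(3) z by (simp add: mem_Times_iff)
      moreover have "card {z, inv_letter z} = 2" by simp
      ultimately show ?thesis using S(2) by (metis order_refl)
    next
      case nt: False
      then have Z2: "2 \<le> card Z" using vZ(2) finZ by (cases "card Z") auto
      show ?thesis
      proof (cases "card Z \<le> card S")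
        case True
        then show ?thesis using Z2 vZ(3) False by (intro exI[of _ Z]) auto
      next
        case big: False
        have "crossings (?L - Z) w = crossings Z w"
        proof -
          have "filter (\<lambda>(a, b). (inv_letter a \<in> ?L - Z) \<noteq> (b \<in> ?L - Z)) (junctions w)
            = filter (\<lambda>(a, b). (inv_letter a \<in> Z) \<noteq> (b \<in> Z)) (junctions w)"
          proof (rule filter_cong[OF refl])
            fix p assume p: "p \<in> set (junctions w)"
            obtain a b where ab: "p = (a, b)" by (cases p)
            have "inv_letter a \<in> ?L" "b \<in> ?L" using junctions_in_set[of a b w] p ab reduced_words_letters[OF wd(1)]
              by (auto simp: mem_Times_iff)
            then show "(case p of (a, b) \<Rightarrow> (inv_letter a \<in> ?L - Z) \<noteq> (b \<in> ?L - Z)) =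
               (case p of (a, b) \<Rightarrow> (inv_letter a \<in> Z) \<noteq> (b \<in> Z))" using ab by auto
          qed
          then show ?thesis by (simp add: crossings_def)
        qed
        moreover have "2 \<le> card (?L - Z)"
        proof -
          have "{v, inv_letter v} \<subseteq> ?L - Z" using vZ by (simp add: mem_Times_iff)
          from card_mono[OF _ this] show ?thesis using finL by simp
        qed
        moreover have "card (?L - Z) \<le> card S" using finZ finL vZ(3) big by (simp add: card_Diff_subset)
        ultimately show ?thesis using False by (intro exI[of _ "?L - Z"]) auto
      qed
    qed
    then show ?thesis by blast
  qed
qed

lemma finite_shortened: "finite S \<Longrightarrow> finite (shortened S m N)"
  unfolding shortened_def
  by (auto intro!: finite_UN_I finite_cartesian_product finite_imageI finite_prim_classes
      intro: finite_subset[of "{M. M + m \<le> N}" "{..N}"])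

lemma card_shortened:
  assumes "finite S"
  shows "card (shortened S m N) \<le> 2 * card S * 2 ^ (2 * card S) * (\<Sum>M | M + m \<le> N. card (prim_classes S M))"
proof -
  let ?L = "S \<times> (UNIV :: bool set)"
  have fin: "finite {M. M + m \<le> N}" by (rule finite_subset[of _ "{..N}"]) auto
  have "card (shortened S m N) \<le> (\<Sum>p\<in>?L \<times> Pow ?L. card (case p of (v, Z) \<Rightarrow> \<Union>M\<in>{M. M + m \<le> N}. act (wh v Z) ` prim_classes S M))"
    unfolding shortened_def using assms by (intro card_UN_le) auto
  also have "\<dots> \<le> (\<Sum>p\<in>?L \<times> Pow ?L. \<Sum>M | M + m \<le> N. card (prim_classes S M))"
  proof (rule sum_mono)
    fix p :: "'a letter \<times> 'a letter set"
    obtain v Z where p: "p = (v, Z)" by (cases p)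
    have "card (\<Union>M\<in>{M. M + m \<le> N}. act (wh v Z) ` prim_classes S M) \<le> (\<Sum>M | M + m \<le> N. card (act (wh v Z) ` prim_classes S M))"
      by (rule card_UN_le[OF fin])
    also have "\<dots> \<le> (\<Sum>M | M + m \<le> N. card (prim_classes S M))"
      by (intro sum_mono card_image_le finite_prim_classes assms)
    finally show "card (case p of (v, Z) \<Rightarrow> \<Union>M\<in>{M. M + m \<le> N}. act (wh v Z) ` prim_classes S M)
      \<le> (\<Sum>M | M + m \<le> N. card (prim_classes S M))" by (simp add: p)
  qed
  also have "\<dots> = 2 * card S * 2 ^ (2 * card S) * (\<Sum>M | M + m \<le> N. card (prim_classes S M))"
    using assms by (simp add: card_cartesian_product card_Pow)
  finally show ?thesis .
qed

section \<open>Geometric sums and the recursion on the length\<close>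

lemma sum_power_le:
  fixes \<kappa> :: real
  assumes "1 < \<kappa>" "m \<le> N"
  shows "(\<Sum>M | M + m \<le> N. \<kappa> ^ M) \<le> \<kappa> / (\<kappa> - 1) * \<kappa> ^ (N - m)"
proof -
  have "{M. M + m \<le> N} = {..N - m}" using assms(2) by auto
  then have "(\<Sum>M | M + m \<le> N. \<kappa> ^ M) = (\<kappa> ^ Suc (N - m) - 1) / (\<kappa> - 1)"
    using assms(1) geometric_sum[of \<kappa> "Suc (N - m)"] by (simp only: lessThan_Suc_atMost)
  also have "\<dots> \<le> \<kappa> ^ Suc (N - m) / (\<kappa> - 1)" using assms(1) by (intro divide_right_mono) auto
  finally show ?thesis by simp
qed

lemma sum_power_le_powr:
  fixes \<kappa> :: real
  assumes "1 < \<kappa>" "\<epsilon> * real N \<le> real m" "m \<le> N"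
  shows "(\<Sum>M | M + m \<le> N. \<kappa> ^ M) \<le> \<kappa> / (\<kappa> - 1) * (\<kappa> powr (1 - \<epsilon>)) ^ N"
proof -
  have "\<kappa> ^ (N - m) = \<kappa> powr (real N - real m)" using assms by (simp add: of_nat_diff flip: powr_realpow)
  also have "\<dots> \<le> \<kappa> powr ((1 - \<epsilon>) * real N)" using assms by (intro powr_mono) (auto simp: algebra_simps)
  also have "\<dots> = (\<kappa> powr (1 - \<epsilon>)) ^ N" using assms by (simp add: powr_powr flip: powr_realpow)
  finally have "\<kappa> / (\<kappa> - 1) * \<kappa> ^ (N - m) \<le> \<kappa> / (\<kappa> - 1) * (\<kappa> powr (1 - \<epsilon>)) ^ N"
    using assms by (intro mult_left_mono) auto
  then show ?thesis using sum_power_le[OF assms(1,3)] by linarith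
qed

text \<open>A shortening proportional to \<open>N\<close> gains an exponential factor, which
  eventually beats \<open>K\<close>. From \<open>N0\<close> on the recursive term is at most half of
  the claimed bound; \<open>D\<close> is large enough for the other half and for the initial
  values.\<close>

lemma recursion_bound:
  fixes f :: "nat \<Rightarrow> real"
  assumes "1 < \<kappa>" "0 \<le> K" "0 < \<epsilon>" "\<And>N. 0 \<le> f N" "\<And>N. \<epsilon> * real N \<le> real (m N)" "\<And>N. 0 < m N"
    and rec: "\<And>N. 0 < N \<Longrightarrow> f N \<le> K * (\<Sum>M | M + m N \<le> N. f M) + C * \<kappa> ^ N"
  shows "\<exists>D. \<forall>N. f N \<le> D * \<kappa> ^ N"
proof -
  let ?q = "\<kappa> powr (- \<epsilon>)"
  have "?q < 1" using assms by (simp add: powr_less_one)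
  then have "(\<lambda>N. K * (\<kappa> / (\<kappa> - 1)) * ?q ^ N) \<longlonglongrightarrow> K * (\<kappa> / (\<kappa> - 1)) * 0"
    by (intro tendsto_mult_left LIMSEQ_power_zero) auto
  then have "\<forall>\<^sub>F N in sequentially. K * (\<kappa> / (\<kappa> - 1)) * ?q ^ N < 1 / 2"
    by (rule order_tendstoD) simp
  then obtain N0 where N0: "\<And>N. N \<ge> N0 \<Longrightarrow> K * (\<kappa> / (\<kappa> - 1)) * ?q ^ N < 1 / 2"
    by (auto simp: eventually_sequentially)
  define D where "D = max (2 * C) (f 0 + (\<Sum>N<N0. f N))"
  have D0: "0 \<le> D" unfolding D_def using assms(4) by (intro max.coboundedI2 add_nonneg_nonneg sum_nonneg) auto
  have "f N \<le> D * \<kappa> ^ N" for N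
  proof (induction N rule: less_induct)
    case (less N)
    show ?case
    proof (cases "N = 0 \<or> N < N0")
      case True
      have "f N \<le> f 0 + (\<Sum>N<N0. f N)"
        using True member_le_sum[of N "{..<N0}" f] assms(4) sum_nonneg[of "{..<N0}" f]
        by (auto simp: add_increasing add_increasing2)
      also have "\<dots> \<le> D" by (simp add: D_def)
      also have "D * 1 \<le> D * \<kappa> ^ N" using D0 assms(1) by (intro mult_left_mono) auto
      finally show ?thesis by simp
    next
      case False
      show ?thesis
      proof (cases "m N \<le> N")
        case True
        have "(\<Sum>M | M + m N \<le> N. f M) \<le> (\<Sum>M | M + m N \<le> N. D * \<kappa> ^ M)"
          using assms(6)[of N] by (intro sum_mono less) auto
        also have "\<dots> \<le> D * (\<kappa> / (\<kappa> - 1) * (\<kappa> powr (1 - \<epsilon>)) ^ N)"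
          unfolding sum_distrib_left[symmetric]
          using sum_power_le_powr[OF assms(1,5) True] D0 by (rule mult_left_mono)
        finally have "K * (\<Sum>M | M + m N \<le> N. f M) \<le> K * (D * (\<kappa> / (\<kappa> - 1) * (\<kappa> powr (1 - \<epsilon>)) ^ N))"
          using assms(2) by (rule mult_left_mono)
        also have "(\<kappa> powr (1 - \<epsilon>)) ^ N = ?q ^ N * \<kappa> ^ N"
        proof -
          have "\<kappa> powr (1 - \<epsilon>) = ?q * \<kappa>" using assms(1) by (simp add: powr_diff powr_minus_divide)
          then show ?thesis by (simp add: power_mult_distrib)
        qed
        also have "K * (D * (\<kappa> / (\<kappa> - 1) * (?q ^ N * \<kappa> ^ N))) = (K * (\<kappa> / (\<kappa> - 1)) * ?q ^ N) * (D * \<kappa> ^ N)"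
          by simp
        also have "\<dots> \<le> 1 / 2 * (D * \<kappa> ^ N)"
          using N0[of N] False D0 assms(1) by (intro mult_right_mono) auto
        finally have "K * (\<Sum>M | M + m N \<le> N. f M) \<le> D / 2 * \<kappa> ^ N" by simp
        moreover have "C * \<kappa> ^ N \<le> D / 2 * \<kappa> ^ N" using assms(1) by (intro mult_right_mono) (auto simp: D_def)
        ultimately show ?thesis using rec[of N] False by (simp add: field_simps)
      next
        case nm: False
        then have "{M. M + m N \<le> N} = {}" by auto
        then have "f N \<le> C * \<kappa> ^ N" using rec[of N] False by simp
        also have "\<dots> \<le> D * \<kappa> ^ N"
        proof (rule mult_right_mono)
          have "2 * C \<le> D" by (simp add: D_def)
          then show "C \<le> D" using D0 by linarith
        qed (use assms(1) in auto)
        finally show ?thesis .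
      qed
    qed
  qed
  then show ?thesis by blast
qed

text \<open>A union bound over the sets \<open>U\<close>. Taking the smaller side of the cut pays
  here: a single \<open>\<eta>\<close>, adapted to \<open>card S\<close>, serves for all
  \<open>U\<close>.\<close>

lemma card_sparse_words:
  assumes S: "finite S" "2 \<le> card S" and y: "0 < y" "y \<le> 1" and N: "0 < N"
    and \<eta>: "1 \<le> \<eta>" "\<eta> * (real (card S) - 1) \<le> 2 * real (card S) - 3"
  shows "real (card {w \<in> prim_words S N. \<exists>U\<subseteq>S \<times> UNIV. 2 \<le> card U \<and> card U \<le> card S
      \<and> crossings U w \<le> m \<and> n \<le> inside U w}) * (y ^ m * \<eta> ^ n)
    \<le> 2 ^ (2 * card S) * (2 * real (card S) * (2 * real (card S) - 3 + 2 * real (card S) * y) ^ N)"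
proof -
  let ?L = "S \<times> (UNIV :: bool set)"
  let ?A = "\<lambda>U. {w \<in> prim_words S N. 2 \<le> card U \<and> card U \<le> card S \<and> crossings U w \<le> m \<and> n \<le> inside U w}"
  let ?W = "{w \<in> prim_words S N. \<exists>U\<subseteq>?L. 2 \<le> card U \<and> card U \<le> card S \<and> crossings U w \<le> m \<and> n \<le> inside U w}"
  let ?B = "2 * real (card S) * (2 * real (card S) - 3 + 2 * real (card S) * y) ^ N"
  have B0: "0 \<le> ?B" using S(2) y by (intro mult_nonneg_nonneg zero_le_power) auto
  have "?W = (\<Union>U\<in>Pow ?L. ?A U)" by auto
  then have "card ?W \<le> (\<Sum>U\<in>Pow ?L. card (?A U))"
    using card_UN_le[of "Pow ?L" ?A] S(1) by simp
  then have "real (card ?W) * (y ^ m * \<eta> ^ n) \<le> real (\<Sum>U\<in>Pow ?L. card (?A U)) * (y ^ m * \<eta> ^ n)"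
    using y \<eta>(1) by (intro mult_right_mono) (simp only: of_nat_le_iff, simp)
  also have "\<dots> = (\<Sum>U\<in>Pow ?L. real (card (?A U)) * (y ^ m * \<eta> ^ n))" by (simp only: sum_distrib_right of_nat_sum)
  also have "\<dots> \<le> (\<Sum>U\<in>Pow ?L. ?B)"
  proof (rule sum_mono)
    fix U assume U: "U \<in> Pow ?L"
    show "real (card (?A U)) * (y ^ m * \<eta> ^ n) \<le> ?B"
    proof (cases "2 \<le> card U \<and> card U \<le> card S")
      case True
      have "\<eta> * (real (card U) - 1) \<le> \<eta> * (real (card S) - 1)" using True \<eta>(1) by (intro mult_left_mono) auto
      then have "\<eta> * (real (card U) - 1) \<le> 2 * real (card S) - 3" using \<eta>(2) by linarith
      then show ?thesis
        by (intro card_sparse_cut[where U = U])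
          (use S U True y N \<eta>(1) in \<open>auto simp: prim_words_def\<close>)
    next
      case False
      then have "?A U = {}" by auto
      then show ?thesis using B0 by (simp only: card.empty of_nat_0 mult_zero_left)
    qed
  qed
  also have "\<dots> = 2 ^ (2 * card S) * ?B" using S(1) by (simp add: card_Pow card_letters)
  finally show ?thesis .
qed

text \<open>Controls the price of a penalty \<open>y\<close>: if it is paid for a small proportion
  of the letters, the cost is a constant and an exponential factor with base close to one.\<close>

lemma power_ge_powr_power:
  fixes y :: real
  assumes "0 < y" "y \<le> 1" "real n \<le> \<epsilon> * real N + c"
  shows "y powr c * (y powr \<epsilon>) ^ N \<le> y ^ n"
proof -
  have "y powr c * (y powr \<epsilon>) ^ N = y powr (\<epsilon> * real N + c)"
    using assms by (simp add: powr_add powr_powr flip: powr_realpow)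
  also have "\<dots> \<le> y powr real n" using assms by (intro powr_mono') auto
  finally show ?thesis using assms by (simp add: powr_realpow)
qed

theorem prim_classes_upper_bound:
  fixes S :: "'a set" and \<kappa> :: real
  assumes S: "finite S" "2 \<le> card S" and \<kappa>: "2 * real (card S) - 3 < \<kappa>"
  shows "\<exists>D. \<forall>N. real (card (prim_classes S N)) \<le> D * \<kappa> ^ N"
proof -
  let ?k = "real (card S)"
  have k: "1 \<le> 2 * ?k - 3" using S(2) by linarith
  define \<mu> where "\<mu> = (2 * ?k - 3 + \<kappa>) / 2"
  have \<mu>: "2 * ?k - 3 < \<mu>" "\<mu> < \<kappa>" "0 < \<mu>" using \<kappa> k by (auto simp: \<mu>_def)
  \<comment> \<open>Small enough to keep the row sums of the weighted count at most
    \<open>\<mu>\<close>.\<close>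
  define y where "y = min (1 / 2) ((\<mu> - (2 * ?k - 3)) / (2 * ?k))"
  have y: "0 < y" "y < 1" using \<mu> S(2) by (auto simp: y_def)
  have "2 * ?k * y \<le> \<mu> - (2 * ?k - 3)"
    using S(2) by (auto simp: y_def min_def field_simps)
  then have row: "2 * ?k - 3 + 2 * ?k * y \<le> \<mu>" "0 \<le> 2 * ?k - 3 + 2 * ?k * y" using k y by auto
  \<comment> \<open>Chosen so that paying \<open>y\<close> for up to \<open>2 * m N\<close>
    crossings raises the rate from \<open>\<mu>\<close> to exactly \<open>\<kappa>\<close>, apart
    from a constant.\<close>
  define \<epsilon> where "\<epsilon> = ln (\<mu> / \<kappa>) / (2 * ln y)"
  have lny: "ln y < 0" using y by simp
  have \<epsilon>: "0 < \<epsilon>" unfolding \<epsilon>_def using \<mu> lny by (intro divide_neg_neg) auto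
  have ypow: "y powr (2 * \<epsilon>) = \<mu> / \<kappa>"
    using y \<mu> lny by (simp add: powr_def \<epsilon>_def)
  define m where "m N = Suc (nat \<lfloor>\<epsilon> * real N\<rfloor>)" for N
  have m: "\<epsilon> * real N \<le> real (m N)" "real (m N) \<le> \<epsilon> * real N + 1" for N
  proof -
    have "0 \<le> \<lfloor>\<epsilon> * real N\<rfloor>" using \<epsilon> by simp
    then show "\<epsilon> * real N \<le> real (m N)" "real (m N) \<le> \<epsilon> * real N + 1"
      unfolding m_def by (simp_all add: of_nat_nat) linarith+
  qed
  let ?f = "\<lambda>N. real (card (prim_classes S N))"
  define K where "K = 2 * ?k * 2 ^ (2 * card S)"
  define C where "C = 2 ^ (2 * card S) * (2 * ?k) / y powr 2"
  have "?f N \<le> K * (\<Sum>M | M + m N \<le> N. ?f M) + C * \<kappa> ^ N" if N: "0 < N" for N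
  proof -
    let ?P = "{w \<in> prim_words S N. \<exists>U\<subseteq>S \<times> UNIV. 2 \<le> card U \<and> card U \<le> card S \<and> crossings U w \<le> 2 * m N}"
    have "prim_classes S N \<subseteq> shortened S (m N) N \<union> cls S ` ?P"
    proof
      fix c assume "c \<in> prim_classes S N"
      then obtain w where w: "c = cls S w" "w \<in> prim_words S N" by (auto simp: prim_classes_def)
      then show "c \<in> shortened S (m N) N \<union> cls S ` ?P"
        using shorten_or_sparse[OF S w(2) N, of "m N"] by blast
    qed
    moreover have "finite (shortened S (m N) N \<union> cls S ` ?P)"
      using finite_shortened[OF S(1)] finite_prim_words[OF S(1)] by auto
    ultimately have "card (prim_classes S N) \<le> card (shortened S (m N) N \<union> cls S ` ?P)"
      by (intro card_mono)
    also have "\<dots> \<le> card (shortened S (m N) N) + card (cls S ` ?P)" by (rule card_Un_le)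
    also have "\<dots> \<le> card (shortened S (m N) N) + card ?P"
      using finite_prim_words[OF S(1)] by (intro add_left_mono card_image_le) auto
    finally have "?f N \<le> real (card (shortened S (m N) N)) + real (card ?P)" by linarith
    moreover have "real (card (shortened S (m N) N)) \<le> K * (\<Sum>M | M + m N \<le> N. ?f M)"
    proof -
      have "real (card (shortened S (m N) N)) \<le> real (2 * card S * 2 ^ (2 * card S) * (\<Sum>M | M + m N \<le> N. card (prim_classes S M)))"
        using card_shortened[OF S(1)] by (simp only: of_nat_le_iff)
      then show ?thesis by (simp add: K_def)
    qed
    moreover have "real (card ?P) \<le> C * \<kappa> ^ N"
    proof -
      have ym: "y powr 2 * (\<mu> / \<kappa>) ^ N \<le> y ^ (2 * m N)"
        unfolding ypow[symmetric] using m(2)[of N] y by (intro power_ge_powr_power) auto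
      have "real (card ?P) * (y powr 2 * (\<mu> / \<kappa>) ^ N) \<le> real (card ?P) * y ^ (2 * m N)"
        using ym by (intro mult_left_mono) auto
      also have "\<dots> \<le> 2 ^ (2 * card S) * (2 * ?k * (2 * ?k - 3 + 2 * ?k * y) ^ N)"
        using card_sparse_words[OF S _ _ N, of y 1 "2 * m N" 0] y k by simp
      also have "\<dots> \<le> 2 ^ (2 * card S) * (2 * ?k * \<mu> ^ N)"
        using row by (intro mult_left_mono power_mono) auto
      finally show ?thesis using \<mu> \<kappa> y by (simp add: C_def field_simps power_divide)
    qed
    ultimately show ?thesis by linarith
  qed
  then show ?thesis
    by (intro recursion_bound[where m = m and \<epsilon> = \<epsilon> and K = K and C = C])
      (use k \<kappa> \<epsilon> m(1) in \<open>auto simp: K_def m_def\<close>)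
qed

section \<open>Primitive words in which a generator is rare\<close>

abbreviation occ :: "'a \<Rightarrow> 'a letter list \<Rightarrow> nat" where
  "occ t w \<equiv> length (filter (\<lambda>a. fst a = t) w)"

lemma occ_mset_mono: "mset u \<subseteq># mset v \<Longrightarrow> occ t u \<le> occ t v"
  by (rule mset_subset_filter)

lemma occ_rotate: "occ t (rotate n w) = occ t w"
proof (induction n)
  case (Suc n)
  then show ?case by (metis rotate_Suc mset_rotate1 mset_filter size_mset)
qed simp

text \<open>Cyclic reduction only deletes letters, and the cyclically reduced words of a class are
  rotations of each other.\<close>

lemma occ_class_min:
  assumes "u \<in> reduced_words S" "cyclically_reduced u" "fst ` set v \<subseteq> S"
    "cls S (nf v) = cls S u"
  shows "occ t u \<le> occ t v"
proof -
  obtain x where x: "x \<in> reduced_words S" "cyclically_reduced x" "mset x \<subseteq># mset v"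
    "cls S x = cls S u"
    using cyclic_reduction_class[OF assms(3)] assms(4) by metis
  have "x \<in> cls S u" "u \<in> cls S u"
    using x(4) conj_class_refl[OF x(1)] conj_class_refl[OF assms(1)] by auto
  then obtain n where "u = rotate n x"
    using conj_class_cyclically_reduced[OF assms(1) _ _ x(2) assms(2)] by metis
  then show ?thesis using occ_mset_mono[OF x(3), of t] by (simp add: occ_rotate)
qed

lemma occ_subst_tv:
  assumes "t \<notin> fst ` set p" "t \<notin> fst ` set q"
  shows "occ t (subst (tv t p q) w) = occ t w"
proof -
  have "occ t x = 0" if "t \<notin> fst ` set x" for x using that by (auto simp: filter_empty_conv)
  then have *: "occ t p = 0" "occ t q = 0" "occ t (winv p) = 0" "occ t (winv q) = 0"
    using assms by simp_all
  have "occ t (tv t p q a) = occ t [a]" for a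
    by (simp add: tv_def * del: length_0_conv)
  then show ?thesis by (induction w) auto
qed

text \<open>The substitution preserves occurrences of \<open>t\<close>, and cyclic reduction can
  only remove some. Read from \<open>u\<close> to the shorter word \<open>x\<close>, the descent
  loses no occurrence, so the assumption of at least two is inherited.\<close>

lemma occ_tv_class:
  assumes "t \<in> S" "fst ` set p \<subseteq> S - {t}" "fst ` set q \<subseteq> S - {t}"
    "u \<in> reduced_words S" "cyclically_reduced u" "x \<in> reduced_words S"
    "cls S u = act (tv t p q) (cls S x)"
  shows "occ t u \<le> occ t x"
proof -
  have aut: "is_aut S (tv t p q) (tv t (winv p) (winv q))" by (rule is_aut_tv[OF assms(1-3)])
  have "fst ` set (subst (tv t p q) x) \<subseteq> S"
    by (rule is_aut_set[OF aut]) (use assms(6) in \<open>simp add: reduced_words_def\<close>)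
  then have "occ t u \<le> occ t (subst (tv t p q) x)"
    by (rule occ_class_min[OF assms(4,5)]) (use assms(7) act_conj_class[OF aut assms(6)] in simp)
  moreover have "t \<notin> fst ` set p" "t \<notin> fst ` set q" using assms(2,3) by auto
  ultimately show ?thesis by (simp add: occ_subst_tv)
qed

lemma act_tv_Nil: "c \<subseteq> reduced_words S \<Longrightarrow> act (tv t [] []) c = c"
proof -
  assume c: "c \<subseteq> reduced_words S"
  have "tv t [] [] = (\<lambda>a. [a])" by (auto simp: tv_def fun_eq_iff)
  then show ?thesis using c unfolding act_def by (force simp: reduced_words_def nf_reduced image_def)
qed

text \<open>The second substitution acts on the letter \<open>t\<close> in the middle of
  \<open>p t q\<close>, so its words end up next to \<open>t\<close>.\<close>

lemma act_tv_tv: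
  assumes "t \<notin> fst ` set p0" "t \<notin> fst ` set q0" "t \<notin> fst ` set p" "t \<notin> fst ` set q" "c \<subseteq> reduced_words S"
  shows "act (tv t p0 q0) (act (tv t p q) c) = act (tv t (nf (p @ p0)) (nf (q0 @ q))) c"
  unfolding act_act[OF letter_hom_tv]
proof (rule act_cong[OF assms(5)])
  fix a :: "'a letter"
  have n: "subst (tv t p0 q0) p = p" "subst (tv t p0 q0) q = q"
    "subst (tv t p0 q0) (winv p) = winv p" "subst (tv t p0 q0) (winv q) = winv q"
    using assms by (simp_all add: subst_tv_other)
  consider "a = (t, True)" | "a = (t, False)" | "fst a \<noteq> t" by (cases a) auto
  then show "nf (subst (tv t p0 q0) (tv t p q a)) = nf (tv t (nf (p @ p0)) (nf (q0 @ q)) a)"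
  proof cases
    case 1
    have "nf (p @ p0 @ (t, True) # q0 @ q) = nf (nf (p @ p0) @ [(t, True)] @ nf (q0 @ q))"
      by (metis append_assoc append_Cons append_Nil nf_append_nf)
    then show ?thesis using 1 n by (simp add: tv_def)
  next
    case 2
    have "nf (winv q @ winv q0 @ (t, False) # winv p0 @ winv p) = nf (nf (winv q @ winv q0) @ [(t, False)] @ nf (winv p0 @ winv p))"
      by (metis append_assoc append_Cons append_Nil nf_append_nf)
    then show ?thesis using 2 n by (simp add: tv_def flip: nf_winv)
  qed (simp add: tv_other)
qed

lemma wh_eq_tv:
  assumes "fst v \<noteq> t" "Z \<subseteq> {(t, True), (t, False)}"
  shows "wh (inv_letter v) Z
    = tv t (if (t, True) \<in> Z then [inv_letter v] else []) (if (t, False) \<in> Z then [v] else [])"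
proof
  fix a
  have ne: "t \<noteq> fst v" using assms(1) by simp
  consider "a = (t, True)" | "a = (t, False)" | "fst a \<noteq> t" by (cases a) auto
  then show "wh (inv_letter v) Z a
    = tv t (if (t, True) \<in> Z then [inv_letter v] else []) (if (t, False) \<in> Z then [v] else []) a"
  proof cases
    case 3
    have "fst c = t" if "c \<in> Z" for c using that assms(2) by auto
    from this[of a] this[of "inv_letter a"] 3 have "a \<notin> Z" "inv_letter a \<notin> Z" by auto
    then show ?thesis using 3 by (simp add: wh_def tv_other)
  qed (simp_all add: wh_def tv_def ne)
qed

section \<open>Cuts of words that contain all junctions away from \<open>t\<close>\<close>

definition misses :: "'a set \<Rightarrow> 'a letter list \<Rightarrow> bool" where
  "misses S w \<longleftrightarrow> (\<exists>a b. fst a \<in> S \<and> fst b \<in> S \<and> b \<noteq> inv_letter a \<and> (a, b) \<notin> set (junctions w))"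

text \<open>A vertex of \<open>Z\<close> and \<open>inv_letter v\<close> lie on different sides of
  the cut and neither is \<open>v\<close>, so no edge joins them.\<close>

lemma cut_misses:
  assumes "fst v \<in> S" "Z \<noteq> {}" "Z \<subseteq> S \<times> UNIV" "v \<notin> Z" "inv_letter v \<notin> Z"
    and cut: "\<And>a b. (a, b) \<in> set (junctions w) \<Longrightarrow> cut_at v Z a b"
  shows "misses S w"
proof -
  obtain z where z: "z \<in> Z" using assms(2) by blast
  have "(inv_letter z, inv_letter v) \<notin> set (junctions w)"
    using cut[of "inv_letter z" "inv_letter v"] z assms(5) by (auto simp: cut_at_def)
  moreover have "inv_letter v \<noteq> z" using z assms(5) by auto
  moreover have "fst z \<in> S" using z assms(3) by auto
  ultimately show ?thesis unfolding misses_def using assms(1)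
    by (intro exI[of _ "inv_letter z"] exI[of _ "inv_letter v"]) auto
qed

text \<open>The Whitehead graph contains a complete graph on the letters over
  \<open>S - {t}\<close>. If \<open>v\<close> were over \<open>t\<close>, then \<open>Z\<close>
  would contain all of these letters; but then \<open>v\<close> could be followed only by
  \<open>v\<close>, and its inverse preceded only by itself, although other letters occur. If
  \<open>v\<close> is not over \<open>t\<close>, then \<open>inv_letter v\<close> is adjacent to all
  letters of the complete graph, and none of them can be cut off.\<close>

lemma full_cut:
  assumes w: "w \<in> reduced_words S" "cyclically_reduced w" and t: "t \<in> S" and S: "2 \<le> card (S - {t})"
    and full: "\<not> misses (S - {t}) w" and occ: "0 < occ t w"
    and vZ: "fst v \<in> S" "Z \<noteq> {}" "Z \<subseteq> S \<times> UNIV" "v \<notin> Z" "inv_letter v \<notin> Z"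
    and cut: "\<And>a b. (a, b) \<in> set (junctions w) \<Longrightarrow> cut_at v Z a b"
  shows "fst v \<noteq> t" "Z \<subseteq> {(t, True), (t, False)}"
proof -
  let ?K = "(S - {t}) \<times> (UNIV :: bool set)"
  have edge: "(inv_letter d, e) \<in> set (junctions w)" if "d \<in> ?K" "e \<in> ?K" "d \<noteq> e" for d e
  proof -
    have "\<not> (fst (inv_letter d) \<in> S - {t} \<and> fst e \<in> S - {t} \<and> e \<noteq> inv_letter (inv_letter d)
      \<and> (inv_letter d, e) \<notin> set (junctions w))"
      using full unfolding misses_def by blast
    then show ?thesis using that by (auto simp: mem_Times_iff)
  qed
  obtain x y where xy: "x \<in> S - {t}" "y \<in> S - {t}" "x \<noteq> y" by (rule two_elements[OF S])
  have yw: "(y, True) \<in> set w"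
    using edge[of "(x, True)" "(y, True)"] xy junctions_in_set by fastforce
  obtain c where c: "c \<in> set w" "fst c = t" using occ by (auto simp: filter_empty_conv)
  have wL: "a \<in> S \<times> UNIV" if "a \<in> set w" for a using reduced_words_letters[OF w(1)] that by blast
  have t1: "\<exists>z\<in>Z. z \<in> ?K \<Longrightarrow> fst v = t \<Longrightarrow> False"
  proof -
    assume v: "fst v = t" and "\<exists>z\<in>Z. z \<in> ?K"
    then obtain z where z: "z \<in> Z" "z \<in> ?K" by blast
    have KZ: "e \<in> Z" if "e \<in> ?K" for e
    proof (cases "e = z")
      case False
      then have "cut_at v Z (inv_letter z) e" using cut edge[OF z(2) that] by auto
      then show ?thesis using z v that by (auto simp: cut_at_def)
    qed (use z in simp)
    have nZ: "fst a = t" if "a \<in> S \<times> UNIV" "a \<notin> Z" for a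
      using KZ[of a] that by (auto simp: mem_Times_iff)
    have vv: "a = v \<or> a = inv_letter v" if "fst a = t" for a
      using that v by (cases a; cases v) auto
    have fwd: "b = v" if ab: "(a, b) \<in> set (junctions w)" "a = v" for a b
    proof -
      have "b \<notin> Z" using cut[OF ab(1)] ab(2) vZ(5) by (auto simp: cut_at_def)
      then have "fst b = t" using nZ wL junctions_in_set[OF ab(1)] by blast
      then show ?thesis using vv[of b] junction_reduced[OF w(2) ab(1)] ab(2) by metis
    qed
    have bwd: "b \<noteq> inv_letter v" if ab: "(a, b) \<in> set (junctions w)" "a \<noteq> inv_letter v" for a b
    proof
      assume b: "b = inv_letter v"
      have "inv_letter a \<notin> Z" using cut[OF ab(1)] b vZ(5) by (auto simp: cut_at_def)
      moreover have "inv_letter a \<in> S \<times> UNIV" using wL[of a] junctions_in_set[OF ab(1)] by (simp add: mem_Times_iff)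
      ultimately have "fst a = t" using nZ[of "inv_letter a"] by simp
      then have "a = v" using vv ab(2) by blast
      then show False using junction_reduced[OF w(2) ab(1)] b by simp
    qed
    from vv[OF c(2)] show False
    proof
      assume "c = v"
      then have "(y, True) = v" using junctions_const[of w "\<lambda>a. a = v" c "(y, True)", OF fwd c(1)] yw by simp
      then show False using v xy(2) by auto
    next
      assume ci: "c = inv_letter v"
      have "(y, True) \<noteq> inv_letter v"
      proof
        assume "(y, True) = inv_letter v"
        then have "y = fst (inv_letter v)" by (metis fst_conv)
        then show False using v xy(2) by simp
      qed
      then have "c \<noteq> inv_letter v" using junctions_const[of w "\<lambda>a. a \<noteq> inv_letter v" "(y, True)" c, OF bwd yw] c(1) by simp
      then show False using ci by simp
    qed
  qed
  show v: "fst v \<noteq> t"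
  proof
    assume v: "fst v = t"
    obtain z where z: "z \<in> Z" using vZ(2) by blast
    have "fst z \<noteq> t"
    proof
      assume "fst z = t"
      then have "z = v \<or> z = inv_letter v" using v by (cases z; cases v) auto
      then show False using z vZ by auto
    qed
    then have "z \<in> ?K" using z vZ(3) by (auto simp: mem_Times_iff)
    then show False using t1 z v by blast
  qed
  show "Z \<subseteq> {(t, True), (t, False)}"
  proof
    fix z assume z: "z \<in> Z"
    show "z \<in> {(t, True), (t, False)}"
    proof (rule ccontr)
      assume "z \<notin> {(t, True), (t, False)}"
      then have "fst z \<noteq> t" by (cases z) auto
      then have zK: "z \<in> ?K" using z vZ(3) by (auto simp: mem_Times_iff)
      have vK: "inv_letter v \<in> ?K" using v vZ(1) by (simp add: mem_Times_iff)
      have "z \<noteq> inv_letter v" using z vZ(5) by auto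
      from cut[OF edge[OF zK vK this]] show False using z vZ(5) by (auto simp: cut_at_def)
    qed
  qed
qed

text \<open>A closed walk that visits letters over \<open>t\<close> and other letters has to leave
  the former and come back.\<close>

lemma crossings_letter_ge_2:
  assumes "x \<in> set w" "fst x = t" "y \<in> set w" "fst y \<noteq> t"
  shows "2 \<le> crossings {(t, True), (t, False)} w"
proof -
  let ?P = "\<lambda>a. fst a = t"
  have iff: "a \<in> {(t, True), (t, False)} \<longleftrightarrow> ?P a" "inv_letter a \<in> {(t, True), (t, False)} \<longleftrightarrow> ?P a" for a :: "'a letter"
    by (cases a; auto)+
  have "crossings {(t, True), (t, False)} w = length (filter (\<lambda>(a, b). ?P a \<and> \<not> ?P b) (junctions w))
      + length (filter (\<lambda>(a, b). \<not> ?P a \<and> ?P b) (junctions w))"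
    unfolding crossings_def iff by (rule length_filter_disjoint) auto
  also have "\<dots> = 2 * length (filter (\<lambda>(a, b). ?P a \<and> \<not> ?P b) (junctions w))"
    using junctions_flow[of ?P w] by simp
  also have "length (filter (\<lambda>(a, b). ?P a \<and> \<not> ?P b) (junctions w)) \<noteq> 0"
  proof
    assume "length (filter (\<lambda>(a, b). ?P a \<and> \<not> ?P b) (junctions w)) = 0"
    then have "?P b" if "(a, b) \<in> set (junctions w)" "?P a" for a b
      using that by (auto simp: filter_empty_conv)
    then show False using junctions_const[of w ?P x y] assms by blast
  qed
  ultimately show ?thesis by linarith
qed

section \<open>Adjacent occurrences of \<open>t\<close>\<close>

definition square :: "'a \<Rightarrow> 'a letter list \<Rightarrow> bool" where
  "square t w \<longleftrightarrow> (\<exists>a b. (a, b) \<in> set (junctions w) \<and> fst a = t \<and> fst b = t)"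

lemma square_rotation:
  assumes "square t w" "cyclically_reduced w" "2 \<le> length w"
  obtains n a z where "rotate n w = a # a # z" "fst a = t"
proof -
  obtain a b where ab: "(a, b) \<in> set (junctions w)" "fst a = t" "fst b = t"
    using assms(1) by (auto simp: square_def)
  have "b \<noteq> inv_letter a" by (rule junction_reduced[OF assms(2) ab(1)])
  then have "b = a" using ab by (cases a; cases b) auto
  obtain y z where yz: "w = y @ z" "y \<noteq> []" "last y = a" "hd (z @ y) = a"
    using junction_split[OF ab(1)] \<open>b = a\<close> by metis
  obtain y' where y': "y = y' @ [a]" using yz(2,3) by (metis append_butlast_last_id)
  have "rotate (length y') w = a # z @ y'" using yz(1) y' rotate_append[of y' "a # z"] by simp
  moreover have "z @ y' \<noteq> []" using assms(3) yz(1) y' by auto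
  moreover have "hd (z @ y') = a"
    using yz(4) y' \<open>z @ y' \<noteq> []\<close> by (metis append_assoc hd_append2)
  ultimately have "rotate (length y') w = a # a # tl (z @ y')" by (metis list.collapse)
  then show ?thesis using that ab(2) by blast
qed

lemma square_Cons: "fst a = t \<Longrightarrow> square t (a # a # z)"
  unfolding square_def junctions_Cons by auto

lemma class_mem_eq:
  assumes "w \<in> reduced_words S" "cyclically_reduced w" "u = rotate n w"
  shows "u \<in> reduced_words S" "cyclically_reduced u" "cls S u = cls S w"
proof -
  show c: "cyclically_reduced u" using assms cyclically_reduced_rotate by blast
  show "u \<in> reduced_words S" using assms c by (auto simp: reduced_words_def cyclically_reduced_def)
  have "nf u = u" using c by (simp add: cyclically_reduced_def nf_reduced)
  then have "u \<in> cls S w" using rotate_in_conj_class[OF assms(1), of n] assms(3) by simp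
  then show "cls S u = cls S w" by (rule conj_class_eqI[OF assms(1)])
qed

text \<open>A cancellation against the leading square would remove occurrences of \<open>t\<close>,
  but \<open>u\<close>, being cyclically reduced, already has the fewest in the class. Hence
  reducing \<open>D\<close> alone suffices and the square survives.\<close>

lemma square_reduction:
  assumes "fst a = t" "fst a \<in> S" "fst ` set D \<subseteq> S" "u \<in> reduced_words S" "cyclically_reduced u"
    "cls S (nf (a # a # D)) = cls S u" "occ t (a # a # D) \<le> occ t u"
  shows "cyclically_reduced (a # a # nf D)"
proof -
  let ?x = "nf D"
  have xS: "fst ` set ?x \<subseteq> S" using assms(3) set_nf[of D] by auto
  have occx: "occ t ?x \<le> occ t D" by (rule occ_mset_mono[OF mset_nf])
  have no_shorter: False if y: "fst ` set y \<subseteq> S" "occ t y \<le> occ t ?x"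
    "cls S (nf y) = cls S (nf (a # a # D))" for y
  proof -
    have "occ t u \<le> occ t y" by (rule occ_class_min[OF assms(4,5) y(1)]) (use y(3) assms(6) in simp)
    then show False using y(2) occx assms(1,7) by simp
  qed
  have nfa: "nf (a # a # D) = nf (a # a # ?x)" by simp
  have 1: "a \<noteq> inv_letter (hd ?x)" if ne: "?x \<noteq> []"
  proof
    assume "a = inv_letter (hd ?x)"
    then have x: "?x = inv_letter a # tl ?x" using ne by (metis inv_letter_inv_letter list.collapse)
    have "nf (a # a # D) = nf (a # a # inv_letter a # tl ?x)" using nfa x by metis
    also have "\<dots> = nf (a # tl ?x)" using nf_inv_letter[of "[a]" a "tl ?x"] by simp
    finally have "nf (a # tl ?x) = nf (a # a # D)" by simp
    moreover have "fst ` set (a # tl ?x) \<subseteq> S" using xS assms(2) list.set_sel(2)[OF ne] by auto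
    moreover have "occ t (a # tl ?x) \<le> occ t ?x"
    proof -
      have "occ t ?x = occ t (inv_letter a # tl ?x)" using x by metis
      then show ?thesis using assms(1) by simp
    qed
    ultimately show False using no_shorter by metis
  qed
  have 2: "last ?x \<noteq> inv_letter a" if ne: "?x \<noteq> []"
  proof
    assume "last ?x = inv_letter a"
    then have x: "?x = butlast ?x @ [inv_letter a]" using ne by (metis append_butlast_last_id)
    have set: "set (butlast ?x) \<subseteq> set ?x" by (meson in_set_butlastD subsetI)
    have "nf (a # a # D) = nf ([a] @ (a # butlast ?x) @ winv [a])" using nfa x by (metis append_Cons append_Nil winv_simps(1,2))
    then have "cls S (nf (a # a # D)) = cls S (nf (a # butlast ?x))"
      using conj_class_nf_conj[of "a # butlast ?x" S "[a]"] xS set assms(2) by auto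
    moreover have "fst ` set (a # butlast ?x) \<subseteq> S" using xS assms(2) set by auto
    moreover have "occ t (a # butlast ?x) \<le> occ t ?x"
    proof -
      have "occ t ?x = occ t (butlast ?x @ [inv_letter a])" using x by metis
      then show ?thesis using assms(1) by simp
    qed
    ultimately show False using no_shorter by metis
  qed
  show ?thesis
  proof (cases "?x = []")
    case True
    then show ?thesis by (simp add: cyclically_reduced_def reduced_Cons)
  next
    case False
    then have "a \<noteq> inv_letter (last ?x)" using 2 by (metis inv_letter_inv_letter)
    then show ?thesis using 1 False by (simp add: cyclically_reduced_def reduced_Cons)
  qed
qed

text \<open>One-sided multiplications of \<open>t\<close> are collected in \<open>p\<close> and
  \<open>q\<close>, conjugations of \<open>t\<close> in \<open>r\<close>. A conjugation puts letters
  on both sides of \<open>t\<close> but is only known to shorten the word by two; recorded in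
  \<open>r\<close>, its letter is chosen and charged once.\<close>

definition rare_normal_form :: "'a set \<Rightarrow> 'a \<Rightarrow> 'a letter list \<Rightarrow> 'a letter list \<Rightarrow> 'a letter list \<Rightarrow> 'a letter list \<Rightarrow> 'a letter list \<Rightarrow> bool" where
  "rare_normal_form S t w p q r u \<longleftrightarrow>
     p \<in> reduced_words (S - {t}) \<and> q \<in> reduced_words (S - {t}) \<and> r \<in> reduced_words (S - {t})
     \<and> u \<in> reduced_words S \<and> cyclically_reduced u \<and> prim S u \<and> u \<noteq> [] \<and> misses (S - {t}) u
     \<and> occ t u \<le> occ t w \<and> length u + 2 * (length p + length q + length r) \<le> length w
     \<and> cls S w = act (tv t p q) (act (tv t (winv r) r) (cls S u))"

lemma rare_normal_form_refl:
  assumes "w \<in> reduced_words S" "cyclically_reduced w" "prim S w" "w \<noteq> []" "misses (S - {t}) w"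
  shows "rare_normal_form S t w [] [] [] w"
  using assms act_tv_Nil[OF conj_class_subset[OF assms(1)]]
  by (auto simp: rare_normal_form_def reduced_words_def)

text \<open>As long as the word has all junctions not involving \<open>t\<close>, it arises from a shorter one by
  replacing \<open>t\<close> by \<open>v t\<close>, by \<open>t v\<close>, or by a conjugate of \<open>t\<close>; the latter only if two
  occurrences of \<open>t\<close> are adjacent, a property that is then inherited by the shorter word.  Since
  \<open>t\<close> occurs at least twice, the length drops by at least two in each step.\<close>

lemma rare_descent:
  assumes S: "finite S" "3 \<le> card S" "t \<in> S"
    and w: "w \<in> reduced_words S" "cyclically_reduced w" "prim S w" "2 \<le> occ t w"
  shows "\<exists>p q r u. rare_normal_form S t w p q r u \<and> (square t w \<longrightarrow> p = [] \<and> q = [])"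
  using w
proof (induction "length w" arbitrary: w rule: less_induct)
  case less
  note w = less.prems
  have wne: "w \<noteq> []" by (rule notI) (use w(4) in simp)
  have St: "2 \<le> card (S - {t})" using S by simp
  show ?case
  proof (cases "misses (S - {t}) w")
    case True
    then show ?thesis using rare_normal_form_refl[OF w(1,2,3) wne True] by blast
  next
    case full: False
    have "2 \<le> card S" using S(2) by simp
    then obtain x y where xy: "x \<in> S" "y \<in> S" "x \<noteq> y" by (rule two_elements)
    obtain v Z where vZ: "fst v \<in> S" "Z \<noteq> {}" "Z \<subseteq> S \<times> UNIV" "v \<notin> Z" "inv_letter v \<notin> Z"
      and cut: "\<And>a b. (a, b) \<in> set (junctions w) \<Longrightarrow> cut_at v Z a b"
      using whitehead_cut_vertex[OF S(1) subset_refl xy w(3,1,2)] by metis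
    have "0 < occ t w" using w(4) by linarith
    note fc = full_cut[OF w(1,2) S(3) St full this vZ cut]
    have vS: "fst v \<in> S - {t}" using vZ(1) fc(1) by simp
    show ?thesis
    proof (cases "square t w")
      case False
      \<comment> \<open>Without a square no edge joins the two letters over \<open>t\<close>, so
        \<open>v\<close> also cuts off a single vertex \<open>z\<close> of \<open>Z\<close>. Its
        degree is the number of occurrences of \<open>t\<close>, which is at least two.\<close>
      obtain z where z: "z \<in> Z" using vZ(2) by blast
      have zt: "fst z = t" using z fc(2) by auto
      have cut1: "cut_at v {z} a b" if ab: "(a, b) \<in> set (junctions w)" for a b
      proof -
        have "\<not> (fst a = t \<and> fst b = t)" using False ab by (auto simp: square_def)
        moreover have "inv_letter a \<in> Z \<longrightarrow> fst a = t" "b \<in> Z \<longrightarrow> fst b = t"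
          using fc(2) by (metis fst_conv fst_inv_letter insertE singletonD subsetD)+
        ultimately show ?thesis using cut[OF ab] z unfolding cut_at_def by blast
      qed
      have ne: "v \<notin> {z}" "inv_letter v \<notin> {z}" using z vZ by auto
      obtain w' where w': "w' \<in> reduced_words S" "cyclically_reduced w'" "prim S w'"
        "mset w' \<subseteq># mset w" "length w' + crossings {z} w \<le> length w"
        "cls S w = act (wh (inv_letter v) {z}) (cls S w')"
        using whitehead_descent[OF w(1,3) wne vZ(1) ne cut1] by metis
      have cr: "2 \<le> crossings {z} w"
        using degree_le[of z "{z}" w] inside_single[OF w(2), of z] zt w(4) by simp
      obtain p0 q0 where pq0: "wh (inv_letter v) {z} = tv t p0 q0" "length p0 + length q0 = 1"
        "set p0 \<subseteq> {v, inv_letter v}" "set q0 \<subseteq> {v, inv_letter v}"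
      proof -
        from z fc(2) consider "z = (t, True)" | "z = (t, False)" by auto
        then show ?thesis
        proof cases
          case 1
          then show ?thesis using that[of "[inv_letter v]" "[]"] wh_eq_tv[OF fc(1), of "{z}"] by simp
        next
          case 2
          then show ?thesis using that[of "[]" "[v]"] wh_eq_tv[OF fc(1), of "{z}"] by simp
        qed
      qed
      have pqS: "fst ` set p0 \<subseteq> S - {t}" "fst ` set q0 \<subseteq> S - {t}" using pq0(3,4) vS by auto
      have occ': "occ t w \<le> occ t w'"
        using occ_tv_class[OF S(3) pqS w(1,2) w'(1)] w'(6) pq0(1) by simp
      have "length w' < length w" using w'(5) cr by linarith
      from less.hyps[OF this w'(1-3)] occ' w(4)
      obtain p q r u where IH: "rare_normal_form S t w' p q r u" by auto
      let ?X = "act (tv t (winv r) r) (cls S u)"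
      have IHs: "p \<in> reduced_words (S - {t})" "q \<in> reduced_words (S - {t})" "r \<in> reduced_words (S - {t})"
        "u \<in> reduced_words S" "occ t u \<le> occ t w'" "length u + 2 * (length p + length q + length r) \<le> length w'"
        "cls S w' = act (tv t p q) ?X"
        using IH by (auto simp: rare_normal_form_def)
      have notin: "t \<notin> fst ` set p0" "t \<notin> fst ` set q0" "t \<notin> fst ` set p" "t \<notin> fst ` set q"
        using pqS IHs(1,2) by (auto simp: reduced_words_def)
      have rS: "fst ` set r \<subseteq> S - {t}" "fst ` set (winv r) \<subseteq> S - {t}" using reduced_wordsD(2)[OF IHs(3)] by simp_all
      have "?X = cls S (nf (subst (tv t (winv r) r) u))"
        by (rule act_conj_class[OF is_aut_tv[OF S(3) rS(2,1)] IHs(4)])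
      then have "?X \<subseteq> reduced_words S"
        using conj_class_subset[OF is_aut_reduced_words[OF is_aut_tv[OF S(3) rS(2,1)] IHs(4)]] by simp
      then have eq: "cls S w = act (tv t (nf (p @ p0)) (nf (q0 @ q))) ?X"
        using w'(6) pq0(1) IHs(7) act_tv_tv[OF notin, of ?X S] by simp
      have "fst ` set (p @ p0) \<subseteq> S - {t}" "fst ` set (q0 @ q) \<subseteq> S - {t}"
        using pqS IHs(1,2) by (auto simp: reduced_words_def)
      then have "nf (p @ p0) \<in> reduced_words (S - {t})" "nf (q0 @ q) \<in> reduced_words (S - {t})"
        by (simp_all only: nf_in_reduced_words)
      moreover have "length (nf (p @ p0)) + length (nf (q0 @ q)) \<le> length p + length q + 1"
        using length_nf[of "p @ p0"] length_nf[of "q0 @ q"] pq0(2) by simp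
      then have "length u + 2 * (length (nf (p @ p0)) + length (nf (q0 @ q)) + length r) \<le> length w"
        using IHs(6) w'(5) cr unfolding add_mult_distrib2 by linarith
      moreover have "occ t u \<le> occ t w" using IHs(5) occ_mset_mono[OF w'(4), of t] by linarith
      ultimately have "rare_normal_form S t w (nf (p @ p0)) (nf (q0 @ q)) r u"
        using IH eq by (simp add: rare_normal_form_def)
      then show ?thesis using False by blast
    next
      case sq: True
      let ?T = "{(t, True), (t, False)}"
      \<comment> \<open>A square is an edge between the two letters over \<open>t\<close>, so
        neither is cut off alone, and the automorphism conjugates \<open>t\<close>.\<close>
      have ZT: "Z = ?T"
      proof -
        obtain a b where ab: "(a, b) \<in> set (junctions w)" "fst a = t" "fst b = t"
          using sq by (auto simp: square_def)
        have "b \<noteq> inv_letter a" by (rule junction_reduced[OF w(2) ab(1)])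
        then have ba: "b = a" using ab by (cases a; cases b) auto
        have T: "?T = {a, inv_letter a}" using ab(2) by (cases a; cases "snd a") auto
        have "a \<noteq> v" "inv_letter a \<noteq> v" using ab(2) fc(1) by auto
        then have "inv_letter a \<in> Z \<longleftrightarrow> a \<in> Z" using cut[OF ab(1)] ba by (auto simp: cut_at_def)
        then show ?thesis using vZ(2) fc(2) unfolding T by blast
      qed
      have "2 \<le> length w" using w(4) length_filter_le[of "\<lambda>a. fst a = t" w] by linarith
      then obtain n a x where rot: "rotate n w = a # a # x" "fst a = t" using square_rotation[OF sq w(2)] by metis
      \<comment> \<open>With the square in front, its two letters are kept by \<open>del\<close>,
        since they are not over \<open>v\<close>, and all deletions and later reductions take place
        in \<open>x\<close>.\<close>
      define u0 where "u0 = a # a # x"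
      have u0r: "u0 = rotate n w" using rot u0_def by simp
      note u0 = class_mem_eq[OF w(1,2) u0r]
      have ju: "set (junctions u0) = set (junctions w)" unfolding u0r by (rule junctions_rotate)
      have pu0: "prim S u0" using prim_conj[OF w(1,3)] u0(3) conj_class_refl[OF u0(1)] by simp
      have occ0: "occ t u0 = occ t w" unfolding u0r by (rule occ_rotate)
      have len0: "length u0 = length w" unfolding u0r by simp
      have cut0: "cut_at v ?T c d" if "(c, d) \<in> set (junctions u0)" for c d using cut that ju ZT by simp
      have ne: "v \<notin> ?T" "inv_letter v \<notin> ?T" using vZ ZT by auto
      define D where "D = del v ?T a x a"
      have delu: "del v ?T (last u0) u0 (hd u0) = a # a # D"
      proof -
        have "a \<noteq> v" "a \<noteq> inv_letter v" using rot(2) fc(1) by auto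
        then show ?thesis by (simp add: u0_def D_def)
      qed
      have u0ne: "u0 \<noteq> []" by (simp add: u0_def)
      have lenD: "length (a # a # D) + crossings ?T u0 = length u0"
        using whitehead_shorten(2)[OF u0ne ne cut0] delu by simp
      have msD: "mset (a # a # D) \<subseteq># mset u0" using mset_del[of v ?T "last u0" u0 "hd u0"] delu by simp
      have cr: "2 \<le> crossings ?T u0"
      proof -
        obtain b where "b \<in> set u0" "fst b \<noteq> t"
        proof -
          have "\<not> (fst (inv_letter v) \<in> S - {t} \<and> fst (inv_letter v) \<in> S - {t}
              \<and> inv_letter v \<noteq> inv_letter (inv_letter v) \<and> (inv_letter v, inv_letter v) \<notin> set (junctions w))"
            using full unfolding misses_def by blast
          then have "(inv_letter v, inv_letter v) \<in> set (junctions w)" using vS by simp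
          then have "inv_letter v \<in> set u0" using junctions_in_set[of _ _ u0] ju by blast
          then show ?thesis using that[of "inv_letter v"] fc(1) by simp
        qed
        moreover have "a \<in> set u0" by (simp add: u0_def)
        ultimately show ?thesis using crossings_letter_ge_2 rot(2) by metis
      qed
      have aS: "fst a \<in> S" using rot(2) S(3) by simp
      have DS: "fst ` set D \<subseteq> S" "fst ` set (a # a # D) \<subseteq> S"
        using mset_subset_set[OF msD] reduced_wordsD(2)[OF u0(1)] by auto
      obtain u1 where u1: "u1 \<in> reduced_words S" "cyclically_reduced u1"
        "cls S u1 = cls S (nf (a # a # D))"
        using cyclic_reduction_class[OF DS(2)] by metis
      have wsc: "prim S x \<and> cls S u0 = act (tv t [inv_letter v] [v]) (cls S x)"
        if "x \<in> reduced_words S" "cls S x = cls S (nf (a # a # D))" for x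
        using whitehead_shorten_class[OF u0(1) pu0 u0ne vZ(1) ne cut0 that(1)] that(2) delu wh_eq_tv[OF fc(1), of ?T] by simp
      have vvS: "fst ` set [inv_letter v] \<subseteq> S - {t}" "fst ` set [v] \<subseteq> S - {t}" using vS by auto
      have occ1: "occ t u0 \<le> occ t x"
        if "x \<in> reduced_words S" "cls S x = cls S (nf (a # a # D))" for x
        using occ_tv_class[OF S(3) vvS u0(1,2) that(1)] wsc[OF that] by blast
      have "occ t (a # a # D) \<le> occ t u1" using occ1[OF u1(1,3)] occ_mset_mono[OF msD, of t] by linarith
      then have cyc: "cyclically_reduced (a # a # nf D)"
        by (rule square_reduction[OF rot(2) aS DS(1) u1(1,2) u1(3)[symmetric]])
      define w' where "w' = a # a # nf D"
      have w'S: "w' \<in> reduced_words S"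
        using cyc aS DS(1) set_nf[of D] by (auto simp: w'_def reduced_words_def cyclically_reduced_def)
      have "nf w' = w'" using cyc by (simp add: w'_def nf_reduced cyclically_reduced_def del: nf_simps)
      then have "w' = nf (a # a # D)" by (simp add: w'_def)
      then have w'c: "cls S w' = cls S (nf (a # a # D))" by simp
      note ws = wsc[OF w'S w'c]
      have occw': "2 \<le> occ t w'" using occ1[OF w'S w'c] occ0 w(4) by linarith
      have lenw': "length w' + 2 \<le> length w" using lenD cr len0 length_nf[of D] by (simp add: w'_def)
      have occw'2: "occ t w' \<le> occ t w"
        using occ_mset_mono[OF msD, of t] occ_mset_mono[OF mset_nf[of D], of t] occ0 rot(2) by (simp add: w'_def)
      have "length w' < length w" using lenw' by linarith
      moreover have "square t w'" unfolding w'_def by (rule square_Cons[OF rot(2)])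
      ultimately obtain r u where IH: "rare_normal_form S t w' [] [] r u"
        using less.hyps[of w'] w'S cyc ws occw' unfolding w'_def by blast
      let ?c = "cls S u"
      have IHs: "r \<in> reduced_words (S - {t})" "u \<in> reduced_words S" "occ t u \<le> occ t w'" "length u + 2 * length r \<le> length w'"
        "cls S w' = act (tv t [] []) (act (tv t (winv r) r) ?c)"
        using IH by (auto simp: rare_normal_form_def)
      have rS: "fst ` set r \<subseteq> S - {t}" "fst ` set (winv r) \<subseteq> S - {t}" using reduced_wordsD(2)[OF IHs(1)] by simp_all
      have cS: "?c \<subseteq> reduced_words S" by (rule conj_class_subset[OF IHs(2)])
      have actS: "act (tv t (winv s) s) ?c \<subseteq> reduced_words S" if "fst ` set s \<subseteq> S - {t}" for s
      proof -
        have s: "fst ` set (winv s) \<subseteq> S - {t}" using that by simp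
        show ?thesis
          using act_conj_class[OF is_aut_tv[OF S(3) s that] IHs(2)]
            conj_class_subset[OF is_aut_reduced_words[OF is_aut_tv[OF S(3) s that] IHs(2)]] by simp
      qed
      have c1: "cls S w' = act (tv t (winv r) r) ?c"
        using IHs(5) act_tv_Nil[OF actS[OF rS(1)]] by simp
      define s where "s = nf (v # r)"
      have sS: "fst ` set (v # r) \<subseteq> S - {t}" using rS(1) vS by auto
      have s: "s \<in> reduced_words (S - {t})" unfolding s_def by (rule nf_in_reduced_words[OF sS])
      have ws_eq: "winv s = nf (winv r @ [inv_letter v])" using nf_winv[of "v # r"] by (simp add: s_def)
      have notin: "t \<notin> fst ` set [inv_letter v]" "t \<notin> fst ` set [v]" "t \<notin> fst ` set (winv r)" "t \<notin> fst ` set r"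
        using vvS rS by auto
      have "cls S w = act (tv t (winv s) s) ?c"
        using ws u0(3) c1 act_tv_tv[OF notin cS] ws_eq s_def by simp
      then have "cls S w = act (tv t [] []) (act (tv t (winv s) s) ?c)"
        using act_tv_Nil[OF actS[OF reduced_wordsD(2)[OF s]]] by simp
      moreover have "length s \<le> length r + 1" using length_nf[of "v # r"] by (simp add: s_def)
      then have "length u + 2 * length s \<le> length w" using IHs(4) lenw' by linarith
      moreover have "occ t u \<le> occ t w" using IHs(3) occw'2 by linarith
      ultimately have "rare_normal_form S t w [] [] s u"
        using IH s by (simp add: rare_normal_form_def)
      then show ?thesis by blast
    qed
  qed
qed

text \<open>If \<open>t\<close> does not occur, the cut vertex lemma is applied on the alphabet
  \<open>S - {t}\<close>, where the cut itself yields a missing junction. Otherwise \<open>t\<close>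
  occurs at least twice and the descent applies.\<close>

lemma rare_normal_form_exists:
  assumes S: "finite S" "3 \<le> card S" "t \<in> S"
    and w: "w \<in> prim_words S N" "0 < N" "occ t w \<noteq> 1"
  shows "\<exists>p q r u. rare_normal_form S t w p q r u"
proof -
  have wd: "w \<in> reduced_words S" "cyclically_reduced w" "prim S w" "w \<noteq> []" using w by (auto simp: prim_words_def)
  show ?thesis
  proof (cases "occ t w = 0")
    case True
    have "w \<in> reduced_words (S - {t})" using wd(1) True by (auto simp: reduced_words_def filter_empty_conv)
    moreover have "2 \<le> card (S - {t})" using S by simp
    then obtain x y where xy: "x \<in> S - {t}" "y \<in> S - {t}" "x \<noteq> y" by (rule two_elements)
    ultimately obtain v Z where vZ: "fst v \<in> S - {t}" "Z \<noteq> {}" "Z \<subseteq> (S - {t}) \<times> UNIV" "v \<notin> Z" "inv_letter v \<notin> Z"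
      and cut: "\<And>a b. (a, b) \<in> set (junctions w) \<Longrightarrow> cut_at v Z a b"
      using whitehead_cut_vertex[of "S - {t}" S x y w] S(1) wd(2,3) by (metis Diff_subset finite_Diff)
    have "misses (S - {t}) w" by (rule cut_misses[OF vZ cut])
    then show ?thesis using rare_normal_form_refl[OF wd] by blast
  next
    case False
    then have "2 \<le> occ t w" using w(3) by linarith
    then show ?thesis using rare_descent[OF S wd(1,2,3)] by blast
  qed
qed

section \<open>All but exponentially few primitive cyclic words have a generator occurring once\<close>

definition rare_classes :: "'a set \<Rightarrow> 'a \<Rightarrow> nat \<Rightarrow> nat \<Rightarrow> 'a letter list set set" where
  "rare_classes S t m N = cls S ` {w \<in> prim_words S N. occ t w \<le> m \<and> occ t w \<noteq> 1}"

lemma finite_rare_classes: "finite S \<Longrightarrow> finite (rare_classes S t m N)"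
  using finite_prim_words[of S N] by (auto simp: rare_classes_def)

lemma card_missing_words:
  fixes S :: "'a set" and t :: 'a
  defines "D \<equiv> 2 * real (card S) - 2"
  defines "\<delta> \<equiv> 1 / (16 * D)"
  assumes S: "finite S" "t \<in> S" "3 \<le> card S" and N: "0 < N"
  shows "real (card {u \<in> prim_words S N. occ t u \<le> m \<and> misses (S - {t}) u}) * (\<delta> / 8) ^ m
    \<le> (2 * real (card S))\<^sup>2 * (8 * real (card S)) * (D - 1 - \<delta> / 2) ^ N"
proof -
  let ?L = "(S - {t}) \<times> (UNIV :: bool set)"
  let ?P = "{(a, b) \<in> ?L \<times> ?L. b \<noteq> inv_letter a}"
  let ?T = "\<lambda>(a, b). {u \<in> prim_words S N. occ t u \<le> m \<and> (a, b) \<notin> set (junctions u)}"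
  let ?y = "(\<delta> / 8) ^ m" and ?R = "(D - 1 - \<delta> / 2) ^ N"
  have D4: "4 \<le> D" using S(3) by (simp add: D_def)
  then have \<delta>: "0 < \<delta>" "\<delta> \<le> 1" by (auto simp: \<delta>_def field_simps)
  have R0: "0 \<le> ?R" using D4 \<delta> by (intro zero_le_power) linarith
  have finL: "finite (?L \<times> ?L)" using S(1) by simp
  then have finP: "finite ?P" by (rule rev_finite_subset) auto
  have "{u \<in> prim_words S N. occ t u \<le> m \<and> misses (S - {t}) u} = (\<Union>p\<in>?P. ?T p)" (is "?X = _")
    unfolding misses_def by (auto simp: mem_Times_iff; force)
  then have "card ?X \<le> (\<Sum>p\<in>?P. card (?T p))" using card_UN_le[OF finP, of ?T] by simp
  then have "real (card ?X) * ?y \<le> real (\<Sum>p\<in>?P. card (?T p)) * ?y"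
    using \<delta> by (intro mult_right_mono) (simp only: of_nat_le_iff, simp)
  also have "\<dots> = (\<Sum>p\<in>?P. real (card (?T p)) * ?y)" by (simp only: sum_distrib_right of_nat_sum)
  also have "\<dots> \<le> (\<Sum>p\<in>?P. 8 * real (card S) * ?R)"
  proof (rule sum_mono)
    fix p assume "p \<in> ?P"
    then obtain a b where ab: "p = (a, b)" "fst a \<in> S - {t}" "fst b \<in> S - {t}" "b \<noteq> inv_letter a"
      by (auto simp: mem_Times_iff)
    have "real (card (?T p)) * (?y / 2) \<le> 4 * real (card S) * ?R"
      unfolding \<delta>_def D_def
      by (rule card_missing_junction[OF S ab(2,3,4) N]) (auto simp: prim_words_def ab(1))
    then show "real (card (?T p)) * ?y \<le> 8 * real (card S) * ?R" by linarith
  qed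
  also have "\<dots> = real (card ?P) * (8 * real (card S) * ?R)" by simp
  also have "\<dots> \<le> (2 * real (card S))\<^sup>2 * (8 * real (card S) * ?R)"
  proof (rule mult_right_mono)
    have "card ?P \<le> card (?L \<times> ?L)" by (intro card_mono finL) auto
    also have "\<dots> = (2 * card (S - {t}))\<^sup>2" by (simp add: card_cartesian_product card_letters power2_eq_square)
    also have "\<dots> \<le> (2 * card S)\<^sup>2" using S(1) by (intro power_mono) (auto intro: card_mono)
    finally have "real (card ?P) \<le> real ((2 * card S)\<^sup>2)" by (simp only: of_nat_le_iff)
    then show "real (card ?P) \<le> (2 * real (card S))\<^sup>2" by simp
  qed (use R0 in simp)
  finally show ?thesis by (simp add: mult.assoc)
qed

text \<open>Each letter of \<open>p\<close>, \<open>q\<close>, \<open>r\<close> has about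
  \<open>D - 1\<close> choices and costs two letters of the remaining word. Since
  \<open>D - 1\<close> is at most the square of the rate, substitutions do not increase the bound;
  the quartic factor counts the possible lengths of the four words.\<close>

lemma card_rare_classes:
  fixes S :: "'a set" and t :: 'a
  defines "D \<equiv> 2 * real (card S) - 2"
  defines "\<delta> \<equiv> 1 / (16 * D)"
  assumes S: "finite S" "3 \<le> card S" "t \<in> S" and N: "0 < N"
  shows "real (card (rare_classes S t m N)) * (\<delta> / 8) ^ m
    \<le> (real N + 1) ^ 4 * (256 * real (card S) ^ 3) * (D - 1 - \<delta> / 2) ^ N"
proof -
  let ?\<rho> = "D - 1 - \<delta> / 2" and ?y = "(\<delta> / 8) ^ m"
  define R where "R i = {u \<in> reduced_words (S - {t}). length u = i}" for i
  define B where "B M = {u \<in> prim_words S M. occ t u \<le> m \<and> misses (S - {t}) u}" for M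
  define Q where "Q = {(i, j, l, M). 0 < M \<and> M + 2 * (i + j + l) \<le> N}"
  define F where "F = (\<lambda>(p, q, r, c). act (tv t p q) (act (tv t (winv r) r) c))"
  define X where "X = (\<lambda>(i, j, l, M). F ` (R i \<times> R j \<times> R l \<times> cls S ` B M))"
  have D4: "4 \<le> D" using S(2) by (simp add: D_def)
  then have \<delta>: "0 < \<delta>" "\<delta> \<le> 1 / 64" by (auto simp: \<delta>_def field_simps)
  have y0: "0 \<le> ?y" using \<delta> by simp
  have \<rho>: "1 \<le> ?\<rho>" "D - 1 \<le> ?\<rho>\<^sup>2"
  proof -
    show 1: "1 \<le> ?\<rho>" using D4 \<delta> by linarith
    have "D - 1 \<le> 2 * ?\<rho>" using D4 \<delta> unfolding right_diff_distrib by simp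
    also have "2 * ?\<rho> \<le> ?\<rho> * ?\<rho>"
    proof (rule mult_right_mono)
      show "2 \<le> ?\<rho>" using D4 \<delta> by simp
    qed (use 1 in simp)
    finally show "D - 1 \<le> ?\<rho>\<^sup>2" by (simp add: power2_eq_square)
  qed
  have finR: "finite (R i)" for i
    unfolding R_def by (rule finite_subset[OF _ finite_reduced_words_length[of "S - {t}" i]]) (use S(1) in auto)
  have finB: "finite (B M)" for M using finite_prim_words[OF S(1), of M] by (simp add: B_def)
  have Qsub: "Q \<subseteq> {..N} \<times> {..N} \<times> {..N} \<times> {..N}" by (auto simp: Q_def)
  then have finQ: "finite Q" by (rule finite_subset) auto
  have cardQ: "real (card Q) \<le> (real N + 1) ^ 4"
  proof -
    have "card Q \<le> card ({..N} \<times> {..N} \<times> {..N} \<times> {..N})" using Qsub by (intro card_mono) auto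
    also have "\<dots> = (N + 1) ^ 4" by (simp add: card_cartesian_product power4_eq_xxxx mult.assoc)
    finally have "real (card Q) \<le> real ((N + 1) ^ 4)" by (simp only: of_nat_le_iff)
    then show ?thesis by (simp add: add.commute)
  qed
  have "rare_classes S t m N \<subseteq> (\<Union>x\<in>Q. X x)"
  proof
    fix c assume "c \<in> rare_classes S t m N"
    then obtain w where w: "w \<in> prim_words S N" "occ t w \<le> m" "occ t w \<noteq> 1" "c = cls S w"
      by (auto simp: rare_classes_def)
    obtain p q r u where nf: "rare_normal_form S t w p q r u"
      using rare_normal_form_exists[OF S w(1) N w(3)] by blast
    have "p \<in> R (length p)" "q \<in> R (length q)" "r \<in> R (length r)" "u \<in> B (length u)"
      using nf w(2) by (auto simp: rare_normal_form_def R_def B_def prim_words_def)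
    moreover have "(length p, length q, length r, length u) \<in> Q"
      using nf w(1) by (auto simp: rare_normal_form_def Q_def prim_words_def)
    moreover have "c = F (p, q, r, cls S u)" using nf w(4) by (simp add: rare_normal_form_def F_def)
    ultimately have "c \<in> X (length p, length q, length r, length u)" unfolding X_def by blast
    then show "c \<in> (\<Union>x\<in>Q. X x)" using \<open>(length p, length q, length r, length u) \<in> Q\<close> by blast
  qed
  moreover have finX: "finite (X x)" for x
    unfolding X_def by (cases x) (simp add: finR finB)
  ultimately have "card (rare_classes S t m N) \<le> card (\<Union>x\<in>Q. X x)" using finQ by (intro card_mono) auto
  also have "\<dots> \<le> (\<Sum>x\<in>Q. card (X x))" by (rule card_UN_le[OF finQ])
  finally have "real (card (rare_classes S t m N)) * ?y \<le> real (\<Sum>x\<in>Q. card (X x)) * ?y"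
    using y0 by (intro mult_right_mono) (simp_all only: of_nat_le_iff)
  also have "\<dots> = (\<Sum>x\<in>Q. real (card (X x)) * ?y)" by (simp only: sum_distrib_right of_nat_sum)
  also have "\<dots> \<le> (\<Sum>x\<in>Q. 256 * real (card S) ^ 3 * ?\<rho> ^ N)"
  proof (rule sum_mono)
    fix x assume x: "x \<in> Q"
    obtain i j l M where ijl: "x = (i, j, l, M)" by (cases x)
    have M: "0 < M" "M + 2 * (i + j + l) \<le> N" using x ijl by (auto simp: Q_def)
    have cR: "real (card (R i)) \<le> 2 * (D - 1) ^ i" for i
    proof -
      have "card (S - {t}) = card S - 1" using S by simp
      then have "card (R i) \<le> 2 * (2 * (card S - 1) - 1) ^ i"
        using card_reduced_words_le[of "S - {t}" i] S unfolding R_def by simp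
      then have "real (card (R i)) \<le> real (2 * (2 * (card S - 1) - 1) ^ i)" by (simp only: of_nat_le_iff)
      moreover have "real (2 * (card S - 1) - 1) = D - 1" using S(2) by (simp add: D_def of_nat_diff)
      ultimately show ?thesis by simp
    qed
    have "card (X x) \<le> card (R i \<times> R j \<times> R l \<times> cls S ` B M)"
      unfolding X_def ijl prod.case by (rule card_image_le) (simp add: finR finB)
    also have "\<dots> \<le> card (R i) * (card (R j) * (card (R l) * card (B M)))"
      unfolding card_cartesian_product using finB by (intro mult_le_mono card_image_le order_refl)
    finally have "real (card (X x)) \<le> real (card (R i)) * (real (card (R j)) * (real (card (R l)) * real (card (B M))))"
      by (metis of_nat_le_iff of_nat_mult)
    also have "\<dots> \<le> (2 * (D - 1) ^ i) * ((2 * (D - 1) ^ j) * ((2 * (D - 1) ^ l) * real (card (B M))))"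
      using cR D4 by (intro mult_mono mult_nonneg_nonneg) auto
    finally have "real (card (X x)) * ?y \<le> (2 * (D - 1) ^ i) * ((2 * (D - 1) ^ j) * ((2 * (D - 1) ^ l) * real (card (B M)))) * ?y"
      using y0 by (rule mult_right_mono)
    also have "\<dots> = 8 * (D - 1) ^ (i + j + l) * (real (card (B M)) * ?y)"
      by (simp add: power_add algebra_simps)
    also have "\<dots> \<le> 8 * (D - 1) ^ (i + j + l) * ((2 * real (card S))\<^sup>2 * (8 * real (card S)) * ?\<rho> ^ M)"
      using card_missing_words[OF S(1,3,2) M(1), of m] D4 unfolding B_def D_def \<delta>_def
      by (intro mult_left_mono) auto
    also have "\<dots> \<le> 8 * (?\<rho>\<^sup>2) ^ (i + j + l) * ((2 * real (card S))\<^sup>2 * (8 * real (card S)) * ?\<rho> ^ M)"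
      using \<rho> D4 by (intro mult_right_mono mult_left_mono power_mono mult_nonneg_nonneg) auto
    \<comment> \<open>A factor 2 for each of the three words gives 8; the bound for words with a
      missing junction contributes \<open>(2 * card S)^2\<close> and
      \<open>8 * card S\<close>.\<close>
    also have "\<dots> = 256 * real (card S) ^ 3 * ?\<rho> ^ (M + 2 * (i + j + l))"
    proof -
      have "?\<rho> ^ (M + 2 * (i + j + l)) = (?\<rho>\<^sup>2) ^ (i + j + l) * ?\<rho> ^ M"
        unfolding power_add power_mult by (rule mult.commute)
      then show ?thesis by (simp only:) (simp add: power2_eq_square power3_eq_cube)
    qed
    also have "\<dots> \<le> 256 * real (card S) ^ 3 * ?\<rho> ^ N"
      using \<rho> M by (intro mult_left_mono power_increasing) auto
    finally show "real (card (X x)) * ?y \<le> 256 * real (card S) ^ 3 * ?\<rho> ^ N" .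
  qed
  also have "\<dots> = real (card Q) * (256 * real (card S) ^ 3 * ?\<rho> ^ N)" by simp
  also have "\<dots> \<le> (real N + 1) ^ 4 * (256 * real (card S) ^ 3 * ?\<rho> ^ N)"
    using cardQ \<rho> by (intro mult_right_mono) auto
  finally show ?thesis by (simp add: mult.assoc)
qed

lemma poly_power_bound:
  fixes a b :: real
  assumes "0 < a" "a < b"
  shows "\<exists>C>0. \<forall>N. (real N + 1) ^ 4 * a ^ N \<le> C * b ^ N"
proof -
  define q where "q = a / b"
  have q: "0 < q" "q < 1" using assms by (auto simp: q_def)
  have "(\<lambda>N. (real N + 1) ^ 4 * q ^ N) \<longlonglongrightarrow> 0" using q by real_asymp
  then have "Bseq (\<lambda>N. (real N + 1) ^ 4 * q ^ N)" by (meson convergentI convergent_imp_Bseq)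
  then obtain C where C: "C > 0" "\<And>N. norm ((real N + 1) ^ 4 * q ^ N) \<le> C" by (auto elim: BseqE)
  have "(real N + 1) ^ 4 * a ^ N \<le> C * b ^ N" for N
  proof -
    have "(real N + 1) ^ 4 * q ^ N \<le> C" using C(2)[of N] by simp
    then have "(real N + 1) ^ 4 * q ^ N * b ^ N \<le> C * b ^ N" using assms by (intro mult_right_mono) auto
    moreover have "q ^ N * b ^ N = a ^ N" using assms by (simp add: q_def flip: power_mult_distrib)
    ultimately show ?thesis by (simp add: mult.assoc)
  qed
  then show ?thesis using C(1) by blast
qed

definition single_classes :: "'a set \<Rightarrow> 'a letter list set set" where
  "single_classes S = {c. \<exists>x\<in>S. \<exists>u\<in>c. cyclically_reduced u \<and> occ x u = 1}"

text \<open>The constants are chosen backwards. The rate for a rare generator fixes the threshold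
  \<open>\<gamma>\<close> of rarity; this fixes the gain from frequent visits to \<open>U\<close>;
  then \<open>y\<close> and \<open>\<epsilon>\<close> are made so small that they do not consume
  that gain.\<close>

theorem nonsingle_classes_bound:
  fixes S :: "'a set"
  assumes S: "finite S" "3 \<le> card S"
  shows "\<exists>C \<rho>. 0 < \<rho> \<and> \<rho> < 2 * real (card S) - 3
    \<and> (\<forall>N. real (card (prim_classes S N - single_classes S)) \<le> C * \<rho> ^ N)"
proof -
  let ?k = "real (card S)"
  define d where "d = 2 * ?k - 3"
  have k3: "3 \<le> ?k" using S(2) by simp
  have d: "3 \<le> d" using k3 by (simp add: d_def)
  have S2: "2 \<le> card S" using S(2) by simp
  define \<delta> where "\<delta> = 1 / (16 * (2 * ?k - 2))"
  have \<delta>: "0 < \<delta>" "\<delta> \<le> 1 / 64" using k3 by (auto simp: \<delta>_def field_simps)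
  define \<rho> where "\<rho> = d - \<delta> / 2"
  have \<rho>: "0 < \<rho>" "\<rho> < d" using d \<delta> by (auto simp: \<rho>_def)
  \<comment> \<open>Two intermediate rates: the first absorbs the penalties for occurrences of the
    rare generator, the second the polynomial factor.\<close>
  define \<rho>1 where "\<rho>1 = (\<rho> + d) / 2"
  define \<rho>2 where "\<rho>2 = (\<rho>1 + d) / 2"
  have "\<rho> < \<rho>1" "\<rho>1 < d" using \<rho> by (auto simp: \<rho>1_def)
  then have \<rho>12: "\<rho> < \<rho>1" "\<rho>1 < \<rho>2" "\<rho>2 < d" "0 < \<rho>1" "0 < \<rho>2" using \<rho> by (auto simp: \<rho>2_def)
  define y3 where "y3 = \<delta> / 8"
  have y3: "0 < y3" "y3 < 1" "ln y3 < 0" using \<delta> by (auto simp: y3_def)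
  define \<gamma> where "\<gamma> = ln (\<rho> / \<rho>1) / ln y3"
  have \<gamma>: "0 < \<gamma>" unfolding \<gamma>_def using \<rho> \<rho>12 y3 by (intro divide_neg_neg) auto
  have y3pow: "y3 powr \<gamma> = \<rho> / \<rho>1" using y3 \<rho> \<rho>12 by (simp add: powr_def \<gamma>_def)
  \<comment> \<open>For \<open>k\<close> at least 3 the smaller side satisfies
    \<open>k - 1 \<le> d - 1\<close>, so this weight inside \<open>U\<close> keeps its row sum
    within \<open>d\<close>.\<close>
  define \<eta> where "\<eta> = d / (d - 1)"
  have \<eta>: "1 < \<eta>" "\<eta> * (?k - 1) \<le> 2 * ?k - 3"
  proof -
    show "1 < \<eta>" using d by (simp add: \<eta>_def)
    have "\<eta> * (?k - 1) \<le> \<eta> * (d - 1)" using d k3 by (intro mult_left_mono) (auto simp: \<eta>_def d_def)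
    also have "\<dots> = d" using d by (simp add: \<eta>_def)
    finally show "\<eta> * (?k - 1) \<le> 2 * ?k - 3" by (simp add: d_def)
  qed
  \<comment> \<open>At least \<open>\<gamma> / 4 * N\<close> junctions inside \<open>U\<close> gain
    a factor \<open>s ^ 4\<close> per letter. The row sums may use up \<open>s ^ 2\<close> and the
    crossings \<open>s\<close>, which leaves the rate \<open>d / s\<close>.\<close>
  define s where "s = \<eta> powr (\<gamma> / 16)"
  have s: "1 < s" using \<eta> \<gamma> by (simp add: s_def)
  have s4: "\<eta> powr (\<gamma> / 4) = s ^ 4" using \<eta> by (simp add: s_def powr_powr flip: powr_realpow)
  define y where "y = min (1 / 2) (d * (s\<^sup>2 - 1) / (2 * ?k))"
  have s2: "1 < s\<^sup>2" using s by (simp add: one_less_power)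
  have y: "0 < y" "y < 1" "ln y < 0"
  proof -
    show "0 < y" using d k3 s2 by (auto simp: y_def)
    moreover show "y < 1" by (simp add: y_def)
    ultimately show "ln y < 0" by simp
  qed
  have "2 * ?k * y \<le> d * (s\<^sup>2 - 1)" using k3 by (auto simp: y_def min_def field_simps)
  then have row: "2 * ?k - 3 + 2 * ?k * y \<le> d * s\<^sup>2" by (simp add: d_def algebra_simps)
  have row0: "0 \<le> 2 * ?k - 3 + 2 * ?k * y" using k3 y by simp
  \<comment> \<open>The first bound keeps the contribution of crossings to the degrees in
    \<open>U\<close> small; the second limits the penalties for crossings to one factor
    \<open>s\<close> per letter.\<close>
  define \<epsilon> where "\<epsilon> = min (\<gamma> / 8) (- ln s / (2 * ln y))"
  have \<epsilon>: "0 < \<epsilon>" "\<epsilon> \<le> \<gamma> / 8" "\<epsilon> \<le> - ln s / (2 * ln y)"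
    using \<gamma> s y by (auto simp: \<epsilon>_def divide_less_0_iff zero_less_divide_iff)
  have ypow: "1 / s \<le> y powr (2 * \<epsilon>)"
  proof -
    have "- ln s \<le> 2 * \<epsilon> * ln y" using \<epsilon>(3) y(3) by (simp add: field_simps)
    then have "exp (- ln s) \<le> exp (2 * \<epsilon> * ln y)" by simp
    then show ?thesis using s y by (simp add: powr_def exp_minus inverse_eq_divide)
  qed
  define m where "m N = Suc (nat \<lfloor>\<epsilon> * real N\<rfloor>)" for N
  have m: "\<epsilon> * real N \<le> real (m N)" "real (m N) \<le> \<epsilon> * real N + 1" for N
  proof -
    have "0 \<le> \<lfloor>\<epsilon> * real N\<rfloor>" using \<epsilon> by simp
    then show "\<epsilon> * real N \<le> real (m N)" "real (m N) \<le> \<epsilon> * real N + 1"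
      unfolding m_def by (simp_all add: of_nat_nat) linarith+
  qed
  define n where "n N = nat \<lceil>\<gamma> / 4 * real N\<rceil>" for N
  have n: "\<gamma> / 4 * real N \<le> real (n N)" for N
    using real_nat_ceiling_ge[of "\<gamma> / 4 * real N"] by (simp add: n_def)
  have n': "real i \<le> \<gamma> / 4 * real N" if "i < n N" for i N
    using that unfolding n_def by linarith
  define r where "r N = nat \<lfloor>\<gamma> * real N\<rfloor> + 2" for N
  have r: "real (r N) \<le> \<gamma> * real N + 2" for N
    using of_nat_floor[of "\<gamma> * real N"] \<gamma> by (simp add: r_def)
  let ?T = "\<lambda>N. {w \<in> prim_words S N. \<exists>U\<subseteq>S \<times> UNIV. 2 \<le> card U \<and> card U \<le> card S \<and> crossings U w \<le> 2 * m N \<and> n N \<le> inside U w}"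
  have cover: "prim_classes S N - single_classes S
      \<subseteq> shortened S (m N) N \<union> cls S ` ?T N \<union> (\<Union>t\<in>S. rare_classes S t (r N) N)" if N: "0 < N" for N
  proof
    fix c assume c: "c \<in> prim_classes S N - single_classes S"
    then obtain w where w: "c = cls S w" "w \<in> prim_words S N" by (auto simp: prim_classes_def)
    have wd: "w \<in> reduced_words S" "cyclically_reduced w" using w(2) by (auto simp: prim_words_def)
    have ns: "occ t w \<noteq> 1" if "t \<in> S" for t
      using c conj_class_refl[OF wd(1)] wd(2) that unfolding single_classes_def w(1) by blast
    consider "c \<in> shortened S (m N) N"
      | U where "U \<subseteq> S \<times> UNIV" "2 \<le> card U" "card U \<le> card S" "crossings U w \<le> 2 * m N"
      using shorten_or_sparse[OF S(1) S2 w(2) N, of "m N"] w(1) by blast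
    then show "c \<in> shortened S (m N) N \<union> cls S ` ?T N \<union> (\<Union>t\<in>S. rare_classes S t (r N) N)"
    proof cases
      case (2 U)
      show ?thesis
      proof (cases "n N \<le> inside U w")
        case True
        then have "w \<in> ?T N" using 2 w(2) by blast
        then show ?thesis using w(1) by blast
      next
        case False
        \<comment> \<open>With few junctions inside \<open>U\<close> and few crossings, any vertex
          of \<open>U\<close> has small degree, so its generator is rare.\<close>
        obtain z where z: "z \<in> U" using 2(2) by fastforce
        have tS: "fst z \<in> S" using z 2(1) by auto
        have "real (occ (fst z) w) \<le> real (2 * inside U w + 2 * m N)"
          unfolding of_nat_le_iff using degree_le[OF z, of w] 2(4) by linarith
        also have "\<dots> \<le> 2 * (\<gamma> / 4 * real N) + 2 * (\<epsilon> * real N + 1)"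
          using n'[of "inside U w" N] False m(2)[of N] by simp
        also have "\<dots> \<le> \<gamma> * real N + 2"
        proof -
          have "\<epsilon> * real N \<le> \<gamma> / 8 * real N" using \<epsilon>(2) by (intro mult_right_mono) auto
          moreover have "0 \<le> \<gamma> * real N" using \<gamma> by simp
          ultimately show ?thesis by simp
        qed
        finally have "occ (fst z) w \<le> r N" unfolding r_def by linarith
        then have "c \<in> rare_classes S (fst z) (r N) N"
          using w ns[OF tS] unfolding rare_classes_def by blast
        then show ?thesis using tS by blast
      qed
    qed blast
  qed
  let ?f = "\<lambda>N. real (card (prim_classes S N - single_classes S))"
  have split: "?f N \<le> real (card (shortened S (m N) N)) + real (card (?T N)) + (\<Sum>t\<in>S. real (card (rare_classes S t (r N) N)))"
    if N: "0 < N" for N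
  proof -
    have fin: "finite (shortened S (m N) N)" "finite (?T N)" "finite (\<Union>t\<in>S. rare_classes S t (r N) N)"
      using finite_shortened[OF S(1)] finite_subset[OF _ finite_prim_words[OF S(1)], of "?T N" N]
        finite_rare_classes[OF S(1)] S(1) by auto
    have "card (prim_classes S N - single_classes S)
        \<le> card (shortened S (m N) N \<union> cls S ` ?T N \<union> (\<Union>t\<in>S. rare_classes S t (r N) N))"
      using fin by (intro card_mono cover[OF N]) simp
    also have "\<dots> \<le> card (shortened S (m N) N \<union> cls S ` ?T N) + card (\<Union>t\<in>S. rare_classes S t (r N) N)"
      by (rule card_Un_le)
    also have "\<dots> \<le> (card (shortened S (m N) N) + card (cls S ` ?T N)) + (\<Sum>t\<in>S. card (rare_classes S t (r N) N))"
      using S(1) by (intro add_mono card_Un_le card_UN_le)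
    also have "\<dots> \<le> (card (shortened S (m N) N) + card (?T N)) + (\<Sum>t\<in>S. card (rare_classes S t (r N) N))"
      using fin(2) by (intro add_mono card_image_le order_refl)
    finally have "?f N \<le> real ((card (shortened S (m N) N) + card (?T N)) + (\<Sum>t\<in>S. card (rare_classes S t (r N) N)))"
      by (simp only: of_nat_le_iff)
    then show ?thesis by simp
  qed
  \<comment> \<open>Every rate above \<open>d\<close> is available for all primitive classes. With
    this one, the rate after shortening is \<open>d powr (1 - \<epsilon>\<^sup>2)\<close>, which is
    below \<open>d\<close>.\<close>
  define \<kappa> where "\<kappa> = d powr (1 + \<epsilon>)"
  have \<kappa>: "d < \<kappa>" "1 < \<kappa>" using \<epsilon> d powr_less_mono[of 1 "1 + \<epsilon>" d] by (auto simp: \<kappa>_def)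
  define \<tau> where "\<tau> = \<kappa> powr (1 - \<epsilon>)"
  have \<tau>: "0 < \<tau>" "\<tau> < d"
  proof -
    show "0 < \<tau>" using \<kappa> by (simp add: \<tau>_def)
    have "\<tau> = d powr (1 - \<epsilon>\<^sup>2)" by (simp add: \<tau>_def \<kappa>_def powr_powr algebra_simps power2_eq_square)
    also have "\<dots> < d powr 1" using \<epsilon> d by (intro powr_less_mono) auto
    finally show "\<tau> < d" using d by simp
  qed
  obtain D where D: "\<And>N. real (card (prim_classes S N)) \<le> D * \<kappa> ^ N"
    using prim_classes_upper_bound[OF S(1) S2, of \<kappa>] \<kappa>(1) by (auto simp: d_def)
  have D0: "0 \<le> D" using D[of 0] by (auto intro: order_trans[OF of_nat_0_le_iff])
  define C1 where "C1 = 2 * ?k * 2 ^ (2 * card S) * (D * (\<kappa> / (\<kappa> - 1)))"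
  have C10: "0 \<le> C1" using D0 \<kappa> by (simp add: C1_def)
  have T1: "real (card (shortened S (m N) N)) \<le> C1 * \<tau> ^ N" for N
  proof -
    have "real (card (shortened S (m N) N)) \<le> real (2 * card S * 2 ^ (2 * card S) * (\<Sum>M | M + m N \<le> N. card (prim_classes S M)))"
      using card_shortened[OF S(1)] by (simp only: of_nat_le_iff)
    also have "\<dots> = 2 * ?k * 2 ^ (2 * card S) * (\<Sum>M | M + m N \<le> N. real (card (prim_classes S M)))" by simp
    also have "\<dots> \<le> 2 * ?k * 2 ^ (2 * card S) * (D * (\<kappa> / (\<kappa> - 1)) * \<tau> ^ N)"
    proof (rule mult_left_mono)
      show "(\<Sum>M | M + m N \<le> N. real (card (prim_classes S M))) \<le> D * (\<kappa> / (\<kappa> - 1)) * \<tau> ^ N"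
      proof (cases "m N \<le> N")
        case True
        have "(\<Sum>M | M + m N \<le> N. real (card (prim_classes S M))) \<le> (\<Sum>M | M + m N \<le> N. D * \<kappa> ^ M)"
          by (intro sum_mono D)
        also have "\<dots> \<le> D * (\<kappa> / (\<kappa> - 1) * \<tau> ^ N)"
          unfolding sum_distrib_left[symmetric] \<tau>_def
          using sum_power_le_powr[OF \<kappa>(2) m(1) True] D0 by (rule mult_left_mono)
        finally show ?thesis by (simp add: mult.assoc)
      next
        case False
        then have "{M. M + m N \<le> N} = {}" by auto
        then have "(\<Sum>M | M + m N \<le> N. real (card (prim_classes S M))) = 0" by (simp only: sum.empty)
        moreover have "0 \<le> D * (\<kappa> / (\<kappa> - 1)) * \<tau> ^ N" using D0 \<kappa> \<tau> by (intro mult_nonneg_nonneg) auto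
        ultimately show ?thesis by linarith
      qed
    qed simp
    finally show ?thesis by (simp add: C1_def mult.assoc)
  qed
  define C2 where "C2 = 2 ^ (2 * card S) * (2 * ?k) / y powr 2"
  have C20: "0 \<le> C2" by (simp add: C2_def)
  have T2: "real (card (?T N)) \<le> C2 * (d / s) ^ N" if N: "0 < N" for N
  proof -
    have "y powr 2 * (1 / s) ^ N \<le> y powr 2 * (y powr (2 * \<epsilon>)) ^ N"
      using ypow s by (intro mult_left_mono power_mono) auto
    also have "\<dots> \<le> y ^ (2 * m N)" using m(2)[of N] y by (intro power_ge_powr_power) auto
    finally have 1: "y powr 2 * (1 / s) ^ N \<le> y ^ (2 * m N)" .
    have "(s ^ 4) ^ N = \<eta> powr (\<gamma> / 4 * real N)"
      using \<eta> unfolding s4[symmetric] by (simp add: powr_powr flip: powr_realpow)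
    also have "\<dots> \<le> \<eta> powr (real (n N))" using \<eta> n[of N] by (intro powr_mono) auto
    also have "\<dots> = \<eta> ^ n N" using \<eta> by (simp add: powr_realpow)
    finally have 2: "(s ^ 4) ^ N \<le> \<eta> ^ n N" .
    have "real (card (?T N)) * ((y powr 2 * (1 / s) ^ N) * (s ^ 4) ^ N) \<le> real (card (?T N)) * (y ^ (2 * m N) * \<eta> ^ n N)"
      using 1 2 s y by (intro mult_left_mono mult_mono) auto
    also have "\<dots> \<le> 2 ^ (2 * card S) * (2 * ?k * (2 * ?k - 3 + 2 * ?k * y) ^ N)"
      using card_sparse_words[OF S(1) S2 _ _ N, of y \<eta> "2 * m N" "n N"] y \<eta> by simp
    also have "\<dots> \<le> 2 ^ (2 * card S) * (2 * ?k * (d * s\<^sup>2) ^ N)"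
      using row row0 by (intro mult_left_mono power_mono) auto
    finally have "real (card (?T N)) * ((y powr 2 * (1 / s) ^ N) * (s ^ 4) ^ N) \<le> C2 * y powr 2 * (d * s\<^sup>2) ^ N"
      using y by (simp add: C2_def)
    moreover have "1 / s * s ^ 4 = s ^ 3" "d / s * s ^ 3 = d * s\<^sup>2"
      using s by (simp_all add: power4_eq_xxxx power3_eq_cube power2_eq_square)
    then have "(1 / s) ^ N * (s ^ 4) ^ N = (s ^ 3) ^ N" "(d * s\<^sup>2) ^ N = (d / s) ^ N * (s ^ 3) ^ N"
      by (simp_all only: power_mult_distrib[symmetric])
    then have "(y powr 2 * (1 / s) ^ N) * (s ^ 4) ^ N = y powr 2 * (s ^ 3) ^ N"
      and "C2 * y powr 2 * (d * s\<^sup>2) ^ N = C2 * (d / s) ^ N * (y powr 2 * (s ^ 3) ^ N)"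
      by (simp only: mult.assoc) (simp only: \<open>(d * s\<^sup>2) ^ N = _\<close> mult_ac)
    ultimately have "real (card (?T N)) * (y powr 2 * (s ^ 3) ^ N) \<le> C2 * (d / s) ^ N * (y powr 2 * (s ^ 3) ^ N)"
      by (simp only:)
    then show ?thesis by (rule mult_right_le_imp_le) (use s y in simp)
  qed
  obtain C3 where C3: "C3 > 0" "\<And>N. (real N + 1) ^ 4 * \<rho>1 ^ N \<le> C3 * \<rho>2 ^ N"
    using poly_power_bound[OF \<rho>12(4,2)] by blast
  define C4 where "C4 = 256 * ?k ^ 3 / y3 powr 2 * C3"
  have C40: "0 \<le> C4" using C3 by (simp add: C4_def)
  have T3: "real (card (rare_classes S t (r N) N)) \<le> C4 * \<rho>2 ^ N" if N: "0 < N" and t: "t \<in> S" for N t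
  proof -
    have 1: "y3 powr 2 * (\<rho> / \<rho>1) ^ N \<le> y3 ^ r N"
      unfolding y3pow[symmetric] using r[of N] y3 by (intro power_ge_powr_power) auto
    have "real (card (rare_classes S t (r N) N)) * (y3 powr 2 * (\<rho> / \<rho>1) ^ N) \<le> real (card (rare_classes S t (r N) N)) * y3 ^ r N"
      using 1 by (intro mult_left_mono) auto
    also have "\<dots> \<le> (real N + 1) ^ 4 * (256 * ?k ^ 3) * \<rho> ^ N"
    proof -
      have "2 * ?k - 2 - 1 - \<delta> / 2 = \<rho>" by (simp add: \<rho>_def d_def)
      then show ?thesis
        using card_rare_classes[OF S t N, of "r N"] unfolding \<delta>_def[symmetric] y3_def by simp
    qed
    finally have "real (card (rare_classes S t (r N) N)) \<le> 256 * ?k ^ 3 / y3 powr 2 * ((real N + 1) ^ 4 * \<rho>1 ^ N)"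
      using \<rho> \<rho>12 y3 by (simp add: field_simps power_divide)
    also have "\<dots> \<le> 256 * ?k ^ 3 / y3 powr 2 * (C3 * \<rho>2 ^ N)"
      using C3(2) by (intro mult_left_mono) auto
    finally show ?thesis by (simp add: C4_def)
  qed
  define \<sigma> where "\<sigma> = max \<tau> (max (d / s) \<rho>2)"
  have \<sigma>: "0 < \<sigma>" "\<sigma> < d" "\<tau> \<le> \<sigma>" "d / s \<le> \<sigma>" "\<rho>2 \<le> \<sigma>"
  proof -
    have "d / s < d" using s d by (simp add: divide_less_eq)
    then show "\<sigma> < d" using \<tau> \<rho>12 by (simp add: \<sigma>_def)
    show "0 < \<sigma>" "\<tau> \<le> \<sigma>" "d / s \<le> \<sigma>" "\<rho>2 \<le> \<sigma>" using \<tau> by (simp_all add: \<sigma>_def)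
  qed
  define C where "C = max (?f 0) (C1 + C2 + ?k * C4)"
  have "?f N \<le> C * \<sigma> ^ N" for N
  proof (cases "N = 0")
    case True
    then show ?thesis by (simp add: C_def)
  next
    case False
    then have N: "0 < N" by simp
    have "?f N \<le> C1 * \<tau> ^ N + C2 * (d / s) ^ N + (\<Sum>t\<in>S. C4 * \<rho>2 ^ N)"
      using split[OF N] T1[of N] T2[OF N] sum_mono[of S "\<lambda>t. real (card (rare_classes S t (r N) N))" "\<lambda>_. C4 * \<rho>2 ^ N"] T3[OF N]
      by fastforce
    also have "\<dots> \<le> C1 * \<sigma> ^ N + C2 * \<sigma> ^ N + (\<Sum>t\<in>S. C4 * \<sigma> ^ N)"
      using \<sigma> \<tau> \<rho>12 s d C10 C20 C40 by (intro add_mono sum_mono mult_left_mono power_mono) auto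
    also have "\<dots> = (C1 + C2 + ?k * C4) * \<sigma> ^ N" by (simp add: algebra_simps)
    also have "\<dots> \<le> C * \<sigma> ^ N" using \<sigma> by (intro mult_right_mono) (auto simp: C_def)
    finally show ?thesis .
  qed
  then show ?thesis using \<sigma>(1,2) unfolding d_def by blast
qed

section \<open>Cyclic words in which a generator occurs once\<close>

text \<open>Putting the occurrence of \<open>x\<close> first selects one representative of each
  cyclic word. The rest is nonempty of length \<open>n + 1\<close>, so the cyclic length is
  \<open>n + 2\<close>.\<close>

definition single_words :: "'a set \<Rightarrow> 'a \<Rightarrow> nat \<Rightarrow> 'a letter list set" where
  "single_words S x n = (\<lambda>(a, u). a # u) ` ({(x, True), (x, False)} \<times> {u \<in> reduced_words (S - {x}). length u = Suc n})"

definition singles :: "'a set \<Rightarrow> 'a \<Rightarrow> nat \<Rightarrow> 'a letter list set set" where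
  "singles S x n = cls S ` single_words S x n"

lemma single_wordsE:
  assumes "w \<in> single_words S x n"
  obtains a u where "w = a # u" "fst a = x" "u \<in> reduced_words (S - {x})" "length u = Suc n"
  using assms unfolding single_words_def by force

lemma single_wordsI:
  assumes "fst a = x" "u \<in> reduced_words (S - {x})" "length u = Suc n"
  shows "a # u \<in> single_words S x n"
proof -
  have "a \<in> {(x, True), (x, False)}" using assms(1) by (cases a) auto
  then show ?thesis using assms unfolding single_words_def by (intro image_eqI[of _ _ "(a, u)"]) simp_all
qed

lemma occ_0: "x \<notin> fst ` set u \<Longrightarrow> occ x u = 0"
  by (auto simp: filter_empty_conv)

lemma reduced_words_minus: "u \<in> reduced_words (S - {x}) \<longleftrightarrow> u \<in> reduced_words S \<and> x \<notin> fst ` set u"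
  by (auto simp: reduced_words_def)

lemma single_words_prim:
  assumes "x \<in> S" "w \<in> single_words S x n"
  shows "w \<in> prim_words S (Suc (Suc n))" "occ x w = 1"
proof -
  obtain a u where au: "w = a # u" "fst a = x" "u \<in> reduced_words (S - {x})" "length u = Suc n"
    using assms(2) by (rule single_wordsE)
  have u: "u \<in> reduced_words S" "x \<notin> fst ` set u" using au(3) unfolding reduced_words_minus by blast+
  have ne: "u \<noteq> []" using au(4) by auto
  have "hd u \<in> set u" "last u \<in> set u" using ne by auto
  then have "fst (hd u) \<noteq> x" "fst (last u) \<noteq> x" using u(2) by force+
  then have "a \<noteq> inv_letter (hd u)" "a \<noteq> inv_letter (last u)" using au(2) by auto
  then have "cyclically_reduced w" "w \<in> reduced_words S"
    using u(1) ne assms(1) au(1,2) by (auto simp: cyclically_reduced_def reduced_Cons reduced_words_def)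
  moreover have "prim S w" unfolding au(1) by (rule prim_single) (use au assms(1) in simp_all)
  ultimately show "w \<in> prim_words S (Suc (Suc n))" using au(1,4) by (simp add: prim_words_def)
  have "occ x u = 0" by (rule occ_0[OF u(2)])
  then show "occ x w = 1" using au(1,2) by simp
qed

lemma conj_class_rotate:
  assumes "v \<in> reduced_words S" "cyclically_reduced v" "w \<in> reduced_words S" "cyclically_reduced w"
    "cls S v = cls S w"
  obtains n where "w = rotate n v"
  using conj_class_cyclically_reduced[OF assms(3), of v w] conj_class_refl[OF assms(1)] conj_class_refl[OF assms(3)] assms(2,4,5)
  by metis

text \<open>A nontrivial rotation would bring a letter of \<open>u\<close>, which is not over
  \<open>x\<close>, to the front.\<close>

lemma inj_on_single_words:
  assumes "x \<in> S"
  shows "inj_on (cls S) (single_words S x n)"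
proof (rule inj_onI)
  fix v w assume vw: "v \<in> single_words S x n" "w \<in> single_words S x n"
    and eq: "cls S v = cls S w"
  have p: "v \<in> prim_words S (Suc (Suc n))" "w \<in> prim_words S (Suc (Suc n))"
    using single_words_prim[OF assms] vw by auto
  then obtain m where m: "w = rotate m v" using conj_class_rotate[of v S w] eq by (auto simp: prim_words_def)
  obtain a u where au: "v = a # u" "fst a = x" "u \<in> reduced_words (S - {x})" "length u = Suc n"
    using vw(1) by (rule single_wordsE)
  obtain b z where bz: "w = b # z" "fst b = x" using vw(2) by (rule single_wordsE)
  define i where "i = m mod length v"
  have i: "w = drop i v @ take i v" "i < length v" using m au(1) by (auto simp: i_def rotate_drop_take)
  have "i = 0"
  proof (rule ccontr)
    assume "i \<noteq> 0"
    then obtain j where j: "i = Suc j" by (cases i) auto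
    then have "j < length u" using i(2) au(1) by simp
    then have "drop j u = u ! j # drop (Suc j) u" by (simp add: Cons_nth_drop_Suc)
    then have "b = u ! j" using i(1) au(1) bz(1) j by simp
    then have "b \<in> set u" using \<open>j < length u\<close> by simp
    moreover have "x \<notin> fst ` set u" using au(3) unfolding reduced_words_minus by blast
    ultimately show False using bz(2) by force
  qed
  then show "v = w" using i(1) by simp
qed

lemma card_singles:
  assumes "finite S" "x \<in> S"
  shows "card (singles S x n) = 2 * (2 * (card S - 1) * (2 * (card S - 1) - 1) ^ n)"
proof -
  have "card (singles S x n) = card (single_words S x n)"
    unfolding singles_def by (rule card_image[OF inj_on_single_words[OF assms(2)]])
  also have "\<dots> = card ({(x, True), (x, False)} \<times> {u \<in> reduced_words (S - {x}). length u = Suc n})"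
    unfolding single_words_def by (rule card_image) (auto simp: inj_on_def)
  also have "\<dots> = 2 * (2 * (card S - 1) * (2 * (card S - 1) - 1) ^ n)"
    using assms card_reduced_words[of "S - {x}" n] by (simp add: card_cartesian_product)
  finally show ?thesis .
qed

lemma finite_single_words: "finite S \<Longrightarrow> x \<in> S \<Longrightarrow> finite (single_words S x n)"
  by (rule finite_subset[OF subsetI finite_prim_words[of S "Suc (Suc n)"]]) (erule single_words_prim(1), assumption+)

lemma occ_1_split:
  assumes "occ x v = 1"
  obtains y a z where "v = y @ a # z" "fst a = x" "x \<notin> fst ` set y" "x \<notin> fst ` set z"
proof -
  have "filter (\<lambda>a. fst a = x) v \<noteq> []" by (rule notI) (use assms in simp)
  then have "\<exists>a\<in>set v. fst a = x" by (auto simp: filter_empty_conv)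
  then obtain y a z where s: "v = y @ a # z" "fst a = x" "\<forall>b\<in>set y. fst b \<noteq> x"
    using split_list_first_prop[of v "\<lambda>a. fst a = x"] by blast
  have "occ x v = occ x y + Suc (occ x z)" unfolding s(1) using s(2) by simp
  then have "filter (\<lambda>a. fst a = x) z = []" using assms by simp
  then have "x \<notin> fst ` set z" unfolding filter_empty_conv by blast
  moreover have "x \<notin> fst ` set y" using s(3) by blast
  ultimately show ?thesis by (intro that[OF s(1,2)])
qed

lemma prim_single_classes_eq:
  "prim_classes S (Suc (Suc n)) \<inter> single_classes S = (\<Union>x\<in>S. singles S x n)"
proof (intro equalityI subsetI)
  fix c assume c: "c \<in> prim_classes S (Suc (Suc n)) \<inter> single_classes S"
  then obtain w where w: "w \<in> prim_words S (Suc (Suc n))" "c = cls S w"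
    by (auto simp: prim_classes_def)
  obtain x v where v: "x \<in> S" "v \<in> c" "cyclically_reduced v" "occ x v = 1"
    using c by (auto simp: single_classes_def)
  have wd: "w \<in> reduced_words S" "cyclically_reduced w" "length w = Suc (Suc n)" using w by (auto simp: prim_words_def)
  have vS: "v \<in> reduced_words S" using conj_class_subset[OF wd(1)] v(2) w(2) by blast
  have vc: "cls S v = c" using conj_class_eqI[OF wd(1)] v(2) w(2) by simp
  then obtain m where "w = rotate m v" using conj_class_rotate[OF vS v(3) wd(1,2)] w(2) by metis
  then have lenv: "length v = Suc (Suc n)" using wd(3) by simp
  obtain y a z where s: "v = y @ a # z" "fst a = x" "x \<notin> fst ` set y" "x \<notin> fst ` set z"
    using occ_1_split[OF v(4)] .
  have rot: "a # z @ y = rotate (length y) v" using s(1) rotate_append[of y "a # z"] by simp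
  note r = class_mem_eq[OF vS v(3) rot]
  have "a # (z @ y) \<in> single_words S x n"
  proof (rule single_wordsI[OF s(2)])
    have "z @ y \<in> reduced_words S" using r(1) by (auto simp: reduced_words_def reduced_Cons)
    then show "z @ y \<in> reduced_words (S - {x})" using s(3,4) by (simp add: reduced_words_minus image_Un)
    show "length (z @ y) = Suc n" using lenv s(1) by simp
  qed
  then show "c \<in> (\<Union>x\<in>S. singles S x n)" using r(3) vc v(1) unfolding singles_def by blast
next
  fix c assume "c \<in> (\<Union>x\<in>S. singles S x n)"
  then obtain x w where w: "x \<in> S" "w \<in> single_words S x n" "c = cls S w"
    by (auto simp: singles_def)
  note p = single_words_prim[OF w(1,2)]
  then have "w \<in> c" "cyclically_reduced w" using w(3) conj_class_refl[of w S] by (auto simp: prim_words_def)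
  then have "c \<in> single_classes S" using w(1) p(2) unfolding single_classes_def by blast
  moreover have "c \<in> prim_classes S (Suc (Suc n))" using p(1) w(3) unfolding prim_classes_def by blast
  ultimately show "c \<in> prim_classes S (Suc (Suc n)) \<inter> single_classes S" by blast
qed

text \<open>If \<open>x\<close> and \<open>y\<close> both occur once, the word is
  \<open>a # p @ b # q\<close> with \<open>p\<close> and \<open>q\<close> in the other generators.
  There are \<open>n + 1\<close> places for \<open>b\<close>, four choices of signs, and a factor 2
  from the bound on each piece.\<close>

lemma card_singles_Int:
  assumes S: "finite S" "3 \<le> card S" "x \<in> S" "y \<in> S" "x \<noteq> y"
  shows "card (singles S x n \<inter> singles S y n) \<le> 16 * ((n + 1) * (2 * (card S - 2) - 1) ^ n)"
proof -
  let ?e = "2 * (card S - 2) - 1"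
  define R where "R i = {u \<in> reduced_words (S - {x} - {y}). length u = i}" for i
  define X where "X i = (\<lambda>(a, b, p, q). cls S (a # p @ b # q)) `
    ({(x, True), (x, False)} \<times> {(y, True), (y, False)} \<times> R i \<times> R (n - i))" for i
  have card2: "card (S - {x} - {y}) = card S - 2" using S by simp
  have finR: "finite (R i)" for i
    unfolding R_def by (rule finite_subset[OF _ finite_reduced_words_length[of "S - {x} - {y}" i]]) (use S(1) in auto)
  have cR: "card (R i) \<le> 2 * ?e ^ i" for i
    using card_reduced_words_le[of "S - {x} - {y}" i] S(1,2) card2 unfolding R_def by simp
  have finX: "finite (X i)" for i unfolding X_def by (simp add: finR)
  have "singles S x n \<inter> singles S y n \<subseteq> (\<Union>i\<in>{..n}. X i)"
  proof
    fix c assume c: "c \<in> singles S x n \<inter> singles S y n"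
    then obtain v w where v: "v \<in> single_words S x n" "c = cls S v" and w: "w \<in> single_words S y n" "c = cls S w"
      by (auto simp: singles_def)
    have pv: "v \<in> reduced_words S" "cyclically_reduced v" "w \<in> reduced_words S" "cyclically_reduced w"
      using single_words_prim(1)[OF S(3) v(1)] single_words_prim(1)[OF S(4) w(1)] by (auto simp: prim_words_def)
    obtain m where "w = rotate m v" using conj_class_rotate[OF pv] v(2) w(2) by metis
    then have "occ y v = occ y w" by (simp add: occ_rotate)
    then have "occ y v = 1" using single_words_prim(2)[OF S(4) w(1)] by simp
    obtain a u where au: "v = a # u" "fst a = x" "u \<in> reduced_words (S - {x})" "length u = Suc n"
      using v(1) by (rule single_wordsE)
    have "occ y u = 1" using \<open>occ y v = 1\<close> au(1,2) S(5) by simp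
    then obtain p b q where pq: "u = p @ b # q" "fst b = y" "y \<notin> fst ` set p" "y \<notin> fst ` set q"
      by (rule occ_1_split)
    have "p \<in> reduced_words (S - {x})" "q \<in> reduced_words (S - {x})"
      using au(3) pq(1) by (auto simp: reduced_words_def reduced_append reduced_Cons)
    then have "p \<in> R (length p)" "q \<in> R (n - length p)"
      using pq au(4) unfolding R_def mem_Collect_eq reduced_words_minus[of _ "S - {x}"] by simp_all
    moreover have "a \<in> {(x, True), (x, False)}" "b \<in> {(y, True), (y, False)}"
      using au(2) pq(2) by (cases a; cases b; auto)+
    moreover have "c = (\<lambda>(a, b, p, q). cls S (a # p @ b # q)) (a, b, p, q)" using v(2) au(1) pq(1) by simp
    ultimately have "c \<in> X (length p)" unfolding X_def by blast
    moreover have "length p \<le> n" using pq(1) au(4) by simp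
    ultimately show "c \<in> (\<Union>i\<in>{..n}. X i)" by blast
  qed
  then have "card (singles S x n \<inter> singles S y n) \<le> card (\<Union>i\<in>{..n}. X i)"
    using finX by (intro card_mono) auto
  also have "\<dots> \<le> (\<Sum>i\<in>{..n}. card (X i))" by (rule card_UN_le) simp
  also have "\<dots> \<le> (\<Sum>i\<in>{..n}. 16 * ?e ^ n)"
  proof (rule sum_mono)
    fix i assume i: "i \<in> {..n}"
    have "card (X i) \<le> card ({(x, True), (x, False)} \<times> {(y, True), (y, False)} \<times> R i \<times> R (n - i))"
      unfolding X_def by (rule card_image_le) (simp add: finR)
    also have "\<dots> = 4 * (card (R i) * card (R (n - i)))" by (simp add: card_cartesian_product)
    also have "\<dots> \<le> 4 * ((2 * ?e ^ i) * (2 * ?e ^ (n - i)))" by (intro mult_left_mono mult_mono cR) auto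
    also have "\<dots> = 16 * ?e ^ (i + (n - i))" by (simp add: power_add)
    finally show "card (X i) \<le> 16 * ?e ^ n" using i by simp
  qed
  also have "\<dots> = 16 * ((n + 1) * ?e ^ n)" by simp
  finally show ?thesis .
qed

text \<open>A crude Bonferroni inequality: removing from each set its intersections with the others
  leaves disjoint sets.\<close>

lemma card_UN_ge:
  assumes "finite I" "\<And>i. i \<in> I \<Longrightarrow> finite (A i)" "\<And>i j. i \<in> I \<Longrightarrow> j \<in> I \<Longrightarrow> i \<noteq> j \<Longrightarrow> card (A i \<inter> A j) \<le> m"
  shows "(\<Sum>i\<in>I. card (A i)) \<le> card (\<Union>i\<in>I. A i) + (card I)\<^sup>2 * m"
proof -
  define B where "B i = A i - (\<Union>j\<in>I - {i}. A j)" for i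
  have finB: "finite (B i)" if "i \<in> I" for i using assms(2)[OF that] by (simp add: B_def)
  have "card (A i) \<le> card (B i) + card I * m" if i: "i \<in> I" for i
  proof -
    have "A i = B i \<union> (\<Union>j\<in>I - {i}. A i \<inter> A j)" by (auto simp: B_def)
    then have "card (A i) \<le> card (B i) + card (\<Union>j\<in>I - {i}. A i \<inter> A j)" by (metis card_Un_le)
    also have "card (\<Union>j\<in>I - {i}. A i \<inter> A j) \<le> (\<Sum>j\<in>I - {i}. card (A i \<inter> A j))"
      using assms(1) by (intro card_UN_le) simp
    also have "\<dots> \<le> (\<Sum>j\<in>I - {i}. m)" using assms(3) i by (intro sum_mono) auto
    also have "\<dots> \<le> card I * m" using assms(1) by (simp add: card_Diff1_le)
    finally show ?thesis by simp
  qed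
  then have "(\<Sum>i\<in>I. card (A i)) \<le> (\<Sum>i\<in>I. card (B i) + card I * m)" by (rule sum_mono)
  also have "\<dots> = (\<Sum>i\<in>I. card (B i)) + (card I)\<^sup>2 * m" by (simp add: sum.distrib power2_eq_square)
  also have "(\<Sum>i\<in>I. card (B i)) = card (\<Union>i\<in>I. B i)"
    using assms(1) finB by (intro card_UN_disjoint[symmetric]) (auto simp: B_def)
  also have "card (\<Union>i\<in>I. B i) \<le> card (\<Union>i\<in>I. A i)"
    using assms(1,2) by (intro card_mono) (auto simp: B_def)
  finally show ?thesis by simp
qed

lemma card_single_classes:
  assumes S: "finite S" "3 \<le> card S"
  shows "\<bar>real (card (\<Union>x\<in>S. singles S x n)) - 2 * real (card S) * (2 * real (card S) - 2) * (2 * real (card S) - 3) ^ n\<bar>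
    \<le> 16 * (real (card S))\<^sup>2 * ((real n + 1) * (2 * real (card S) - 5) ^ n)"
proof -
  let ?k = "real (card S)" and ?U = "card (\<Union>x\<in>S. singles S x n)"
  have fin: "finite (singles S x n)" if "x \<in> S" for x
    using finite_single_words[OF S(1) that] by (simp add: singles_def)
  have r: "real (card S - 1) = ?k - 1" "real (2 * (card S - 1) - 1) = 2 * ?k - 3" "real (2 * (card S - 2) - 1) = 2 * ?k - 5"
    using S(2) by (auto simp: of_nat_diff)
  have "(\<Sum>x\<in>S. card (singles S x n)) = card S * (2 * (2 * (card S - 1) * (2 * (card S - 1) - 1) ^ n))"
    using card_singles[OF S(1)] by simp
  then have "real (\<Sum>x\<in>S. card (singles S x n)) = real (card S * (2 * (2 * (card S - 1) * (2 * (card S - 1) - 1) ^ n)))"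
    by (simp only:)
  also have "\<dots> = 2 * ?k * (2 * ?k - 2) * (2 * ?k - 3) ^ n" by (simp only: of_nat_mult of_nat_power r) simp
  finally have sum: "real (\<Sum>x\<in>S. card (singles S x n)) = 2 * ?k * (2 * ?k - 2) * (2 * ?k - 3) ^ n" .
  have "?U \<le> (\<Sum>x\<in>S. card (singles S x n))" by (rule card_UN_le[OF S(1)])
  then have "real ?U \<le> real (\<Sum>x\<in>S. card (singles S x n))" by (simp only: of_nat_le_iff)
  moreover have "(\<Sum>x\<in>S. card (singles S x n)) \<le> ?U + (card S)\<^sup>2 * (16 * ((n + 1) * (2 * (card S - 2) - 1) ^ n))"
    by (rule card_UN_ge[OF S(1) fin card_singles_Int[OF S]])
  then have "real (\<Sum>x\<in>S. card (singles S x n)) \<le> real (?U + (card S)\<^sup>2 * (16 * ((n + 1) * (2 * (card S - 2) - 1) ^ n)))"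
    by (simp only: of_nat_le_iff)
  then have "real (\<Sum>x\<in>S. card (singles S x n)) \<le> real ?U + 16 * ?k\<^sup>2 * ((real n + 1) * (2 * ?k - 5) ^ n)"
    by (simp only: of_nat_add of_nat_mult of_nat_power r) (simp add: algebra_simps)
  moreover have "0 \<le> 16 * ?k\<^sup>2 * ((real n + 1) * (2 * ?k - 5) ^ n)" using S(2) by (intro mult_nonneg_nonneg zero_le_power) auto
  ultimately show ?thesis unfolding sum by linarith
qed

text \<open>There are two error terms: the classes outside \<open>single_classes\<close>, and those
  counted for several generators. The linear factor of the latter is absorbed by passing from the
  rate \<open>d - 2\<close> to \<open>d - 1\<close>.\<close>

theorem prim_classes_asymp:
  fixes S :: "'a set"
  assumes S: "finite S" "3 \<le> card S"
  defines "d \<equiv> 2 * real (card S) - 3"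
  shows "\<exists>C \<sigma>. 0 < \<sigma> \<and> \<sigma> < d \<and>
    (\<forall>n. \<bar>real (card (prim_classes S (Suc (Suc n)))) - 2 * real (card S) * (2 * real (card S) - 2) * d ^ n\<bar> \<le> C * \<sigma> ^ n)"
proof -
  let ?k = "real (card S)"
  have k3: "3 \<le> ?k" using S(2) by simp
  obtain C1 \<rho> where C1: "0 < \<rho>" "\<rho> < d"
    "\<And>N. real (card (prim_classes S N - single_classes S)) \<le> C1 * \<rho> ^ N"
    using nonsingle_classes_bound[OF S] unfolding d_def by blast
  let ?e = "2 * ?k - 5"
  have e: "0 < ?e" "?e < d - 1" using k3 by (auto simp: d_def)
  obtain C2 where C2: "C2 > 0" "\<And>N. (real N + 1) ^ 4 * ?e ^ N \<le> C2 * (d - 1) ^ N"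
    using poly_power_bound[OF e] by blast
  have C10: "0 \<le> C1" using C1(3)[of 0] by (auto intro: order_trans[OF of_nat_0_le_iff])
  define \<sigma> where "\<sigma> = max \<rho> (d - 1)"
  have \<sigma>: "0 < \<sigma>" "\<sigma> < d" "\<rho> \<le> \<sigma>" "d - 1 \<le> \<sigma>" using C1 by (auto simp: \<sigma>_def)
  define C where "C = C1 * \<rho>\<^sup>2 + 16 * ?k\<^sup>2 * C2"
  have "\<bar>real (card (prim_classes S (Suc (Suc n)))) - 2 * ?k * (2 * ?k - 2) * d ^ n\<bar> \<le> C * \<sigma> ^ n" for n
  proof -
    let ?N = "Suc (Suc n)"
    have "card (prim_classes S ?N) = card (prim_classes S ?N \<inter> single_classes S) + card (prim_classes S ?N - single_classes S)"
      using finite_prim_classes[OF S(1)] by (metis Diff_Int_distrib2 Int_Diff_disjoint Un_Diff_Int card_Un_disjoint add.commute finite_Diff finite_Int inf_commute)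
    then have 1: "real (card (prim_classes S ?N)) = real (card (\<Union>x\<in>S. singles S x n)) + real (card (prim_classes S ?N - single_classes S))"
      unfolding prim_single_classes_eq by simp
    have 2: "real (card (prim_classes S ?N - single_classes S)) \<le> C1 * \<rho>\<^sup>2 * \<sigma> ^ n"
    proof -
      have "C1 * \<rho> ^ ?N = C1 * \<rho>\<^sup>2 * \<rho> ^ n" by (simp add: power2_eq_square)
      also have "\<dots> \<le> C1 * \<rho>\<^sup>2 * \<sigma> ^ n" using \<sigma> C1(1) C10 by (intro mult_left_mono power_mono) auto
      finally show ?thesis using C1(3)[of ?N] by linarith
    qed
    have 3: "16 * ?k\<^sup>2 * ((real n + 1) * ?e ^ n) \<le> 16 * ?k\<^sup>2 * C2 * \<sigma> ^ n"
    proof -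
      have "(real n + 1) * ?e ^ n \<le> (real n + 1) ^ 4 * ?e ^ n"
        using e by (intro mult_right_mono) (auto intro: self_le_power)
      also have "\<dots> \<le> C2 * (d - 1) ^ n" by (rule C2(2))
      also have "\<dots> \<le> C2 * \<sigma> ^ n" using C2(1) \<sigma> e by (intro mult_left_mono power_mono) auto
      finally show ?thesis by (simp add: mult.assoc mult_left_mono)
    qed
    have "0 \<le> real (card (prim_classes S ?N - single_classes S))" by simp
    then show ?thesis
      using 1 2 3 card_single_classes[OF S, of n] unfolding d_def[symmetric] C_def distrib_right by linarith
  qed
  then show ?thesis using \<sigma> by blast
qed

text \<open>The words in which one fixed generator occurs once are enough, also when there are only
  two generators.\<close>

lemma prim_classes_lower_bound:
  assumes S: "finite S" "2 \<le> card S"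
  shows "(2 * real (card S) - 3) ^ n \<le> real (card (prim_classes S (Suc (Suc n))))"
proof -
  obtain x where x: "x \<in> S" using S by fastforce
  have "singles S x n \<subseteq> prim_classes S (Suc (Suc n))" using prim_single_classes_eq[of S n] x by blast
  then have "card (singles S x n) \<le> card (prim_classes S (Suc (Suc n)))"
    using finite_prim_classes[OF S(1)] by (intro card_mono)
  moreover have "1 * (2 * (card S - 1) - 1) ^ n \<le> 2 * (2 * (card S - 1)) * (2 * (card S - 1) - 1) ^ n"
    using S(2) by (intro mult_right_mono) auto
  ultimately have "(2 * (card S - 1) - 1) ^ n \<le> card (prim_classes S (Suc (Suc n)))"
    unfolding card_singles[OF S(1) x] mult.assoc mult_1_left by linarith
  then have "real ((2 * (card S - 1) - 1) ^ n) \<le> real (card (prim_classes S (Suc (Suc n))))"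
    by (simp only: of_nat_le_iff)
  moreover have "real (2 * (card S - 1) - 1) = 2 * real (card S) - 3" using S(2) by (auto simp: of_nat_diff)
  ultimately show ?thesis by simp
qed

section \<open>Limits superior of roots and the three statements\<close>

lemma limsup_root_le:
  fixes f :: "nat \<Rightarrow> real"
  assumes "0 < b" "\<And>N. f N \<le> D * b ^ N"
  shows "limsup (\<lambda>N. ereal (root N (f N))) \<le> ereal b"
proof -
  \<comment> \<open>The constant is made positive so that its roots tend to one.\<close>
  define C where "C = max D 1"
  have C: "0 < C" by (simp add: C_def)
  have "(\<lambda>N. root N C * b) \<longlonglongrightarrow> 1 * b" by (intro tendsto_intros LIMSEQ_root_const C)
  then have "(\<lambda>N. ereal (root N C * b)) \<longlonglongrightarrow> ereal b" by simp
  then have "limsup (\<lambda>N. ereal (root N C * b)) = ereal b" by (intro lim_imp_Limsup) auto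
  moreover have "limsup (\<lambda>N. ereal (root N (f N))) \<le> limsup (\<lambda>N. ereal (root N C * b))"
  proof (rule Limsup_mono)
    show "\<forall>\<^sub>F N in sequentially. ereal (root N (f N)) \<le> ereal (root N C * b)"
      using eventually_gt_at_top[of 0]
    proof eventually_elim
      case (elim N)
      have "D * b ^ N \<le> C * b ^ N" using assms(1) by (intro mult_right_mono) (auto simp: C_def)
      then have "f N \<le> C * b ^ N" using assms(2)[of N] by linarith
      then have "root N (f N) \<le> root N (C * b ^ N)" using elim by simp
      also have "\<dots> = root N C * b" using elim assms(1) by (simp add: real_root_mult real_root_power_cancel)
      finally show ?case by simp
    qed
  qed
  ultimately show ?thesis by simp
qed

lemma limsup_root_ge:
  fixes f :: "nat \<Rightarrow> real"
  assumes "0 < b" "\<And>n. b ^ n \<le> f (Suc (Suc n))"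
  shows "ereal b \<le> limsup (\<lambda>N. ereal (root N (f N)))"
proof -
  \<comment> \<open>Compensates for the shift of the index by two.\<close>
  let ?c = "1 / b\<^sup>2"
  have "(\<lambda>N. root N ?c * b) \<longlonglongrightarrow> 1 * b" using assms(1) by (intro tendsto_intros LIMSEQ_root_const) simp
  then have "(\<lambda>N. ereal (root N ?c * b)) \<longlonglongrightarrow> ereal b" by simp
  then have "limsup (\<lambda>N. ereal (root N ?c * b)) = ereal b" by (intro lim_imp_Limsup) auto
  moreover have "limsup (\<lambda>N. ereal (root N ?c * b)) \<le> limsup (\<lambda>N. ereal (root N (f N)))"
  proof (rule Limsup_mono)
    show "\<forall>\<^sub>F N in sequentially. ereal (root N ?c * b) \<le> ereal (root N (f N))"
      using eventually_ge_at_top[of 2]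
    proof eventually_elim
      case (elim N)
      then obtain n where n: "N = Suc (Suc n)" by (metis add_2_eq_Suc le_Suc_ex)
      have "root N ?c * b = root N (?c * b ^ N)" using n assms(1) by (simp only: real_root_mult real_root_power_cancel zero_less_Suc less_imp_le)
      also have "?c * b ^ N = b ^ n" using n assms(1) by (simp add: power2_eq_square)
      also have "root N (b ^ n) \<le> root N (f N)" using n assms(2)[of n] by simp
      finally show ?case by simp
    qed
  qed
  ultimately show ?thesis by simp
qed

theorem theorem1p3:
  shows "(\<forall>k\<ge>2. limsup (\<lambda>N. ereal (root N (real (card (primitive_cyclic_words k N)))))
            = ereal (2 * real k - 3))
    \<and> (\<forall>k\<ge>3. limsup (\<lambda>N. ereal (root N
            (real (card (primitive_cyclic_words k N - primitive_cyclic_words_single k N)))))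
            < ereal (2 * real k - 3))
    \<and> (\<forall>k\<ge>3. (\<lambda>N. real (card (primitive_cyclic_words k N))) \<sim>[at_top]
         (\<lambda>N. 2 * real k * (2 * real k - 2) / (2 * real k - 3)\<^sup>2 * (2 * real k - 3) ^ N))"
proof (intro conjI allI impI)
  fix k :: nat assume k: "2 \<le> k"
  let ?S = "gens k"
  have S: "finite ?S" "2 \<le> card ?S" "card ?S = k" using k by auto
  let ?f = "\<lambda>N. real (card (primitive_cyclic_words k N))"
  have d: "0 < 2 * real k - 3" using k by simp
  show "limsup (\<lambda>N. ereal (root N (?f N))) = ereal (2 * real k - 3)"
  proof (rule antisym)
    show "limsup (\<lambda>N. ereal (root N (?f N))) \<le> ereal (2 * real k - 3)"
    proof (rule ereal_le_epsilon2)
      fix e :: real assume e: "0 < e"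
      obtain D where "\<And>N. real (card (prim_classes ?S N)) \<le> D * (2 * real k - 3 + e) ^ N"
        using prim_classes_upper_bound[OF S(1,2), of "2 * real k - 3 + e"] S(3) e by auto
      then have "limsup (\<lambda>N. ereal (root N (?f N))) \<le> ereal (2 * real k - 3 + e)"
        using d e by (intro limsup_root_le[of _ _ D]) (auto simp: primitive_cyclic_words_eq)
      then show "limsup (\<lambda>N. ereal (root N (?f N))) \<le> ereal (2 * real k - 3) + ereal e" by simp
    qed
    show "ereal (2 * real k - 3) \<le> limsup (\<lambda>N. ereal (root N (?f N)))"
      using prim_classes_lower_bound[OF S(1,2)] S(3) d
      by (intro limsup_root_ge) (auto simp: primitive_cyclic_words_eq)
  qed
next
  fix k :: nat assume k: "3 \<le> k"
  let ?S = "gens k"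
  have S: "finite ?S" "3 \<le> card ?S" "card ?S = k" using k by auto
  have eq: "primitive_cyclic_words k N - primitive_cyclic_words_single k N = prim_classes ?S N - single_classes ?S" for N
    by (auto simp: primitive_cyclic_words_single_def single_classes_def primitive_cyclic_words_eq)
  obtain C \<rho> where "0 < \<rho>" "\<rho> < 2 * real k - 3"
    "\<And>N. real (card (prim_classes ?S N - single_classes ?S)) \<le> C * \<rho> ^ N"
    using nonsingle_classes_bound[OF S(1,2)] S(3) by auto
  then have "limsup (\<lambda>N. ereal (root N (real (card (primitive_cyclic_words k N - primitive_cyclic_words_single k N))))) \<le> ereal \<rho>"
    unfolding eq by (intro limsup_root_le[of _ _ C])
  also have "\<dots> < ereal (2 * real k - 3)" using \<open>\<rho> < 2 * real k - 3\<close> by simp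
  finally show "limsup (\<lambda>N. ereal (root N (real (card (primitive_cyclic_words k N - primitive_cyclic_words_single k N)))))
      < ereal (2 * real k - 3)" .
next
  fix k :: nat assume k: "3 \<le> k"
  let ?S = "gens k"
  have S: "finite ?S" "3 \<le> card ?S" "card ?S = k" using k by auto
  define d where "d = 2 * real k - 3"
  define A where "A = 2 * real k * (2 * real k - 2)"
  let ?f = "\<lambda>N. real (card (primitive_cyclic_words k N))" and ?g = "\<lambda>N. A / d\<^sup>2 * d ^ N"
  have pos: "0 < A" "0 < d" using k by (auto simp: A_def d_def)
  obtain C \<sigma> where C: "0 < \<sigma>" "\<sigma> < d"
    "\<And>n. \<bar>real (card (prim_classes ?S (Suc (Suc n)))) - A * d ^ n\<bar> \<le> C * \<sigma> ^ n"
    using prim_classes_asymp[OF S(1,2)] S(3) unfolding A_def d_def by auto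
  have g: "?g (Suc (Suc n)) = A * d ^ n" for n using pos by (simp add: power2_eq_square)
  have "(\<lambda>n. ?f (Suc (Suc n)) / ?g (Suc (Suc n)) - 1) \<longlonglongrightarrow> 0"
  proof (rule tendsto_0_le[where K = 1])
    have "(\<lambda>n. (\<sigma> / d) ^ n) \<longlonglongrightarrow> 0" using C pos by (intro LIMSEQ_power_zero) simp
    from tendsto_mult_left[OF this, of "C / A"] show "(\<lambda>n. C / A * (\<sigma> / d) ^ n) \<longlonglongrightarrow> 0" by simp
    have le: "norm (?f (Suc (Suc n)) / ?g (Suc (Suc n)) - 1) \<le> C / A * (\<sigma> / d) ^ n" for n
    proof -
      have "?f (Suc (Suc n)) / (A * d ^ n) - 1 = (?f (Suc (Suc n)) - A * d ^ n) / (A * d ^ n)"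
        using pos by (simp add: diff_divide_distrib)
      then have "norm (?f (Suc (Suc n)) / ?g (Suc (Suc n)) - 1) = \<bar>?f (Suc (Suc n)) - A * d ^ n\<bar> / (A * d ^ n)"
        unfolding g using pos by (simp add: abs_mult)
      also have "\<dots> \<le> C * \<sigma> ^ n / (A * d ^ n)"
        using C(3)[of n] pos by (intro divide_right_mono) (auto simp: primitive_cyclic_words_eq)
      finally show ?thesis by (simp add: power_divide)
    qed
    show "\<forall>\<^sub>F n in sequentially. norm (?f (Suc (Suc n)) / ?g (Suc (Suc n)) - 1) \<le> norm (C / A * (\<sigma> / d) ^ n) * 1"
      by (intro always_eventually allI) (simp only: mult_1_right real_norm_def order_trans[OF le[unfolded real_norm_def] abs_ge_self])
  qed
  then have "(\<lambda>n. ?f (Suc (Suc n)) / ?g (Suc (Suc n)) - 1 + 1) \<longlonglongrightarrow> 0 + 1" by (intro tendsto_intros)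
  then have "(\<lambda>n. ?f (Suc (Suc n)) / ?g (Suc (Suc n))) \<longlonglongrightarrow> 1" by simp
  \<comment> \<open>Undoing the shift by two, one index at a time.\<close>
  then have "(\<lambda>n. ?f (Suc n) / ?g (Suc n)) \<longlonglongrightarrow> 1" by (rule LIMSEQ_imp_Suc)
  then have "(\<lambda>N. ?f N / ?g N) \<longlonglongrightarrow> 1" by (rule LIMSEQ_imp_Suc)
  then have "?f \<sim>[at_top] ?g" by (rule asymp_equivI')
  then show "(\<lambda>N. real (card (primitive_cyclic_words k N))) \<sim>[at_top]
         (\<lambda>N. 2 * real k * (2 * real k - 2) / (2 * real k - 3)\<^sup>2 * (2 * real k - 3) ^ N)"
    unfolding A_def d_def .
qed

end
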